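(* Up to existential interdefinability, the random graph has exactly five reducts.
   Context: The random graph $G=(V;E)$ is the countably infinite (undirected, loopless) graph, unique up to isomorphism, such that for all finite disjoint $U,U'\subseteq V$ there is $v\in V\setminus(U\cup U')$ adjacent to all vertices in $U$ and to none in $U'$. A reduct of $G$ is a relational structure with domain $V$ all of whose relations are first-order definable (without parameters) in $G$. A first-order formula is existential iff it is of the form $\exists x_1,\dots,x_k.\ \psi$ with $\psi$ quantifier-free. Two structures on the same domain are existentially interdefinable iff every relation of each has a definition by an existential formula in the other. *)

theory Defs
  imports "HOL-Library.Countable_Set"
begin

text \<open>
  A relational structure has the whole type \<open>'v\<close> as its domain; its signature consists of
  the symbols in \<open>symbols\<close>, so the signature may be empty, finite or infinite.
  The values of \<open>arity\<close> and \<open>interp\<close> on other elements of \<open>'s\<close> are irrelevant.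
  An \<open>n\<close>-ary relation is a set of lists of length \<open>n\<close>.
\<close>

record ('s, 'v) rel_structure =
  symbols :: "'s set"
  arity :: "'s \<Rightarrow> nat"
  interp :: "'s \<Rightarrow> 'v list set"

definition is_rel_structure :: "('s, 'v) rel_structure \<Rightarrow> bool" where
  "is_rel_structure \<Gamma> \<longleftrightarrow>
     (\<forall>s\<in>symbols \<Gamma>. \<forall>xs\<in>interp \<Gamma> s. length xs = arity \<Gamma> s)"

text \<open>Variables are natural numbers; \<open>Ex i \<phi>\<close> binds the (named) variable \<open>i\<close> in \<open>\<phi>\<close>.\<close>

datatype 's fm =
    Eq nat nat
  | Rel 's "nat list"
  | Neg "'s fm"
  | Conj "'s fm" "'s fm"
  | Ex nat "'s fm"

primrec wf_fm :: "('s, 'v) rel_structure \<Rightarrow> 's fm \<Rightarrow> bool" where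
  "wf_fm \<Gamma> (Eq i j) \<longleftrightarrow> True"
| "wf_fm \<Gamma> (Rel s js) \<longleftrightarrow> s \<in> symbols \<Gamma> \<and> length js = arity \<Gamma> s"
| "wf_fm \<Gamma> (Neg \<phi>) \<longleftrightarrow> wf_fm \<Gamma> \<phi>"
| "wf_fm \<Gamma> (Conj \<phi> \<psi>) \<longleftrightarrow> wf_fm \<Gamma> \<phi> \<and> wf_fm \<Gamma> \<psi>"
| "wf_fm \<Gamma> (Ex i \<phi>) \<longleftrightarrow> wf_fm \<Gamma> \<phi>"

primrec fv :: "'s fm \<Rightarrow> nat set" where
  "fv (Eq i j) = {i, j}"
| "fv (Rel s js) = set js"
| "fv (Neg \<phi>) = fv \<phi>"
| "fv (Conj \<phi> \<psi>) = fv \<phi> \<union> fv \<psi>"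
| "fv (Ex i \<phi>) = fv \<phi> - {i}"

primrec sat :: "('s, 'v) rel_structure \<Rightarrow> (nat \<Rightarrow> 'v) \<Rightarrow> 's fm \<Rightarrow> bool" where
  "sat \<Gamma> e (Eq i j) \<longleftrightarrow> e i = e j"
| "sat \<Gamma> e (Rel s js) \<longleftrightarrow> map e js \<in> interp \<Gamma> s"
| "sat \<Gamma> e (Neg \<phi>) \<longleftrightarrow> \<not> sat \<Gamma> e \<phi>"
| "sat \<Gamma> e (Conj \<phi> \<psi>) \<longleftrightarrow> sat \<Gamma> e \<phi> \<and> sat \<Gamma> e \<psi>"
| "sat \<Gamma> e (Ex i \<phi>) \<longleftrightarrow> (\<exists>v. sat \<Gamma> (e(i := v)) \<phi>)"

primrec quantifier_free :: "'s fm \<Rightarrow> bool" where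
  "quantifier_free (Eq i j) \<longleftrightarrow> True"
| "quantifier_free (Rel s js) \<longleftrightarrow> True"
| "quantifier_free (Neg \<phi>) \<longleftrightarrow> quantifier_free \<phi>"
| "quantifier_free (Conj \<phi> \<psi>) \<longleftrightarrow> quantifier_free \<phi> \<and> quantifier_free \<psi>"
| "quantifier_free (Ex i \<phi>) \<longleftrightarrow> False"

definition existential :: "'s fm \<Rightarrow> bool" where
  "existential \<phi> \<longleftrightarrow> (\<exists>js \<psi>. quantifier_free \<psi> \<and> \<phi> = foldr Ex js \<psi>)"

text \<open>
  The variables \<open>0, \<dots>, n - 1\<close> stand for the \<open>n\<close> coordinates. Every list of length \<open>n\<close> is of
  the form \<open>map e [0..<n]\<close>, and no parameters enter since \<open>\<phi>\<close> has no other free variables.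
\<close>

definition fm_defines :: "('s, 'v) rel_structure \<Rightarrow> 's fm \<Rightarrow> nat \<Rightarrow> 'v list set \<Rightarrow> bool" where
  "fm_defines \<Gamma> \<phi> n R \<longleftrightarrow>
     wf_fm \<Gamma> \<phi> \<and> fv \<phi> \<subseteq> {..<n} \<and> (\<forall>e. map e [0..<n] \<in> R \<longleftrightarrow> sat \<Gamma> e \<phi>)"

definition reduct_of :: "('s, 'v) rel_structure \<Rightarrow> ('t, 'v) rel_structure \<Rightarrow> bool" where
  "reduct_of \<Delta> \<Gamma> \<longleftrightarrow>
     is_rel_structure \<Delta> \<and>
     (\<forall>s\<in>symbols \<Delta>. \<exists>\<phi>. fm_defines \<Gamma> \<phi> (arity \<Delta> s) (interp \<Delta> s))"

definition ex_definable_in :: "('s, 'v) rel_structure \<Rightarrow> ('t, 'v) rel_structure \<Rightarrow> bool" where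
  "ex_definable_in \<Delta> \<Gamma> \<longleftrightarrow>
     (\<forall>s\<in>symbols \<Delta>. \<exists>\<phi>. existential \<phi> \<and> fm_defines \<Gamma> \<phi> (arity \<Delta> s) (interp \<Delta> s))"

definition ex_interdefinable :: "('s, 'v) rel_structure \<Rightarrow> ('t, 'v) rel_structure \<Rightarrow> bool" where
  "ex_interdefinable \<Gamma> \<Delta> \<longleftrightarrow> ex_definable_in \<Gamma> \<Delta> \<and> ex_definable_in \<Delta> \<Gamma>"

locale random_graph =
  fixes E :: "('v \<times> 'v) set"
  assumes countable_vertices: "countable (UNIV :: 'v set)"
    and infinite_vertices: "infinite (UNIV :: 'v set)"
    and sym_edges: "sym E"
    and irrefl_edges: "irrefl E"
    and extension:
      "\<And>U U'. finite U \<Longrightarrow> finite U' \<Longrightarrow> U \<inter> U' = {} \<Longrightarrow>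
         \<exists>v. v \<notin> U \<union> U' \<and> (\<forall>u\<in>U. (v, u) \<in> E) \<and> (\<forall>u\<in>U'. (v, u) \<notin> E)"

definition graph_structure :: "('v \<times> 'v) set \<Rightarrow> (unit, 'v) rel_structure" where
  "graph_structure E =
     \<lparr>symbols = UNIV, arity = (\<lambda>_. 2), interp = (\<lambda>_. {[x, y] | x y. (x, y) \<in> E})\<rparr>"

definition reducts :: "('v \<times> 'v) set \<Rightarrow> ('s, 'v) rel_structure set" where
  "reducts E = {\<Gamma>. reduct_of \<Gamma> (graph_structure E)}"

text \<open>
  Existential definitions need not compose, since a defined symbol may occur negated, so
  existential interdefinability is not an equivalence relation on arbitrary structures.
\<close>

definition ex_interdef_rel ::
    "('v \<times> 'v) set \<Rightarrow> (('s, 'v) rel_structure \<times> ('s, 'v) rel_structure) set" where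
  "ex_interdef_rel E =
     {(\<Gamma>, \<Delta>). \<Gamma> \<in> reducts E \<and> \<Delta> \<in> reducts E \<and> ex_interdefinable \<Gamma> \<Delta>}"

end

theory Submission
  imports Defs "HOL-Library.Ramsey"
begin

text \<open>
  A reduct \<open>\<Gamma>\<close> of the random graph cannot distinguish two tuples of distinct vertices by
  quantifier-free formulas unless the graphs induced on them differ, because the random graph is
  homogeneous. So \<open>\<Gamma>\<close> determines, for every \<open>n\<close>, an equivalence relation on the graphs with
  vertex set \<open>{..<n}\<close>, and these relations are compatible with injective reindexing of the vertices. Three
  properties of this system matter: all graphs of the same size are equivalent; every graph is
  equivalent to its complement; every graph is equivalent to the graph obtained by switching at a
  vertex (exchanging its neighbours and its non-neighbours). The first property implies the other
  two, so there are five combinations, and each of them occurs: for the structure without relations,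
  for the graph itself, and for the relations \<open>E(x, y) \<longleftrightarrow> E(u, v)\<close>, ``the triple \<open>x, y, z\<close> spans an
  odd number of edges'', and ``two triples have the same parity''.

  Everything follows once the three properties are known to be a complete invariant: \<open>\<Delta>\<close> is
  existentially definable in \<open>\<Gamma>\<close> if and only if each property of \<open>\<Gamma>\<close> is also a property of
  \<open>\<Delta>\<close>. One direction (\<open>profile_mono\<close>) holds because complementing, switching or arbitrarily changing
  a graph can be carried along to every extension of the graph, hence to the witnesses of an
  existential formula.

  The other direction (\<open>profile_le_imp_ex_definable\<close>) rests on \<open>rigid_extension\<close>: unless all graphs
  are equivalent for \<open>\<Gamma>\<close>, every graph \<open>h\<close> on \<open>p\<close> points has a finite extension \<open>k\<close> such that each
  graph equivalent to \<open>k\<close> restricts on the \<open>p\<close> points to \<open>h\<close> up to those complements and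
  switchings that \<open>\<Gamma>\<close> allows. The formula ``there are further vertices which together with the given
  ones have the quantifier-free type of \<open>k\<close> in \<open>\<Gamma>\<close>'' is existential and fixes the given tuple up to
  changes that \<open>\<Delta>\<close> does not see, so a finite disjunction of such formulas defines a relation of
  \<open>\<Delta>\<close>.

  The extension \<open>k\<close> comes from structural Ramsey theory. If \<open>k'\<close> is equivalent to \<open>k\<close>, then colour
  each pair of new vertices by what \<open>k'\<close> does with it and with its connections to the \<open>p\<close> points. By
  the Ramsey theorem for vertex-labelled graphs (\<open>labelled_ramsey\<close>), \<open>k\<close> can be chosen so large that
  on a copy of any prescribed graph the passage from \<open>k\<close> to \<open>k'\<close> is canonical: the new value at a
  pair depends only on the old value and on how its vertices are joined to the \<open>p\<close> points.
  A canonical change is a complement followed by a switching, or else it leads to one of two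
  collapses: graphs that differ in a single pair become equivalent, or all information about the edges
  at one vertex is lost. Either collapse can be repeated until all graphs have become equivalent.

  The Ramsey theorem is obtained by the partite construction of Nesetril and Roedl, whose basic step,
  for pairs between two fixed parts, is an application of the Hales-Jewett theorem.
\<close>

section \<open>The Hales-Jewett theorem\<close>

text \<open>
  A combinatorial line in the words of length \<open>N\<close> over \<open>A\<close> is encoded by a list with entries
  \<open>None\<close> at its active coordinates, of which there must be at least one, and \<open>Some a\<close> at the
  fixed ones.
\<close>

definition fill :: "'a option list \<Rightarrow> 'a \<Rightarrow> 'a list" where
  "fill \<tau> x = map (\<lambda>c. case c of None \<Rightarrow> x | Some a \<Rightarrow> a) \<tau>"

definition template :: "'a set \<Rightarrow> nat \<Rightarrow> 'a option list \<Rightarrow> bool" where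
  "template A N \<tau> \<longleftrightarrow> length \<tau> = N \<and> None \<in> set \<tau> \<and> set \<tau> \<subseteq> insert None (Some ` A)"

definition words :: "'a set \<Rightarrow> nat \<Rightarrow> 'a list set" where
  "words A N = {w. set w \<subseteq> A \<and> length w = N}"

lemma finite_words: "finite A \<Longrightarrow> finite (words A N)"
  unfolding words_def by (rule finite_lists_length_eq)

lemma fill_in_words: "template A N \<tau> \<Longrightarrow> x \<in> A \<Longrightarrow> fill \<tau> x \<in> words A N"
  by (fastforce simp: fill_def template_def words_def split: option.splits)

lemma fill_append: "fill (\<sigma> @ \<tau>) x = fill \<sigma> x @ fill \<tau> x"
  by (simp add: fill_def)

lemma fill_map_Some: "fill (map Some w) x = w"
  by (simp add: fill_def comp_def)

lemma template_mono: "template A N \<tau> \<Longrightarrow> A \<subseteq> B \<Longrightarrow> template B N \<tau>"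
  unfolding template_def by blast

lemma template_append:
  "template A M \<sigma> \<Longrightarrow> template A N \<tau> \<Longrightarrow> template A (M + N) (\<sigma> @ \<tau>)"
  by (auto simp: template_def)

lemma template_append_word:
  "template A M \<sigma> \<Longrightarrow> w \<in> words A N \<Longrightarrow> template A (M + N) (\<sigma> @ map Some w)"
  by (auto simp: template_def words_def)

lemma template_word_append:
  "w \<in> words A M \<Longrightarrow> template A N \<tau> \<Longrightarrow> template A (M + N) (map Some w @ \<tau>)"
  by (auto simp: template_def words_def)

lemma append_in_words: "u \<in> words A M \<Longrightarrow> v \<in> words A N \<Longrightarrow> u @ v \<in> words A (M + N)"
  by (auto simp: words_def)

definition has_line :: "'a set \<Rightarrow> nat \<Rightarrow> ('a list \<Rightarrow> nat) \<Rightarrow> bool" where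
  "has_line A N \<chi> \<longleftrightarrow> (\<exists>\<tau> c. template A N \<tau> \<and> (\<forall>x\<in>A. \<chi> (fill \<tau> x) = c))"

lemma has_lineI: "template A N \<tau> \<Longrightarrow> (\<And>x. x \<in> A \<Longrightarrow> \<chi> (fill \<tau> x) = c) \<Longrightarrow> has_line A N \<chi>"
  unfolding has_line_def by blast

lemma has_lineE:
  assumes "has_line A N \<chi>"
  obtains \<tau> c where "template A N \<tau>" "\<And>x. x \<in> A \<Longrightarrow> \<chi> (fill \<tau> x) = c"
  using assms unfolding has_line_def by blast

text \<open>
  A line over \<open>insert z A\<close> that has colour \<open>c\<close> except possibly at its last point \<open>f\<close>, the one for
  the letter \<open>z\<close>. Several such lines with different colours may share the point \<open>f\<close>.
\<close>

definition focused :: "'a set \<Rightarrow> 'a \<Rightarrow> nat \<Rightarrow> ('a list \<Rightarrow> nat) \<Rightarrow> 'a list \<Rightarrow> nat \<Rightarrow> bool" where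
  "focused A z N \<chi> f c \<longleftrightarrow>
     (\<exists>\<tau>. template (insert z A) N \<tau> \<and> fill \<tau> z = f \<and> (\<forall>x\<in>A. \<chi> (fill \<tau> x) = c))"

lemma focusedI:
  "template (insert z A) N \<tau> \<Longrightarrow> fill \<tau> z = f \<Longrightarrow> (\<And>x. x \<in> A \<Longrightarrow> \<chi> (fill \<tau> x) = c) \<Longrightarrow>
     focused A z N \<chi> f c"
  unfolding focused_def by blast

lemma focusedE:
  assumes "focused A z N \<chi> f c"
  obtains \<tau> where "template (insert z A) N \<tau>" "fill \<tau> z = f" "\<And>x. x \<in> A \<Longrightarrow> \<chi> (fill \<tau> x) = c"
  using assms unfolding focused_def by blast

lemma focused_has_line:
  assumes "focused A z N \<chi> f (\<chi> f)"
  shows "has_line (insert z A) N \<chi>"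
  using assms by (elim focusedE) (auto intro: has_lineI)

lemma has_line_append:
  assumes "has_line A N (\<lambda>v. \<chi> (u @ v))" "u \<in> words A M"
  shows "has_line A (M + N) \<chi>"
  using assms(1)
proof (elim has_lineE)
  fix \<tau> c assume "template A N \<tau>" and c: "\<And>x. x \<in> A \<Longrightarrow> \<chi> (u @ fill \<tau> x) = c"
  then have "template A (M + N) (map Some u @ \<tau>)" using assms(2) by (simp add: template_word_append)
  then show ?thesis by (rule has_lineI) (simp add: fill_append fill_map_Some c)
qed

text \<open>
  The colour-focusing argument. Blocks of length \<open>N'\<close> over the smaller alphabet \<open>A\<close> are coloured by
  the pattern that they induce on all continuations of length \<open>N\<close>; a line \<open>\<sigma>\<close> that is monochromatic for
  this colouring makes the colour independent of the letter put into \<open>\<sigma>\<close>, as long as it is not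
  \<open>z\<close>. Prolonging \<open>k\<close> focused lines by \<open>\<sigma>\<close>, and adding \<open>\<sigma>\<close> itself followed by the old focus, gives
  \<open>k + 1\<close> focused lines. Colours that are already used cannot occur at the focus, for then a whole
  line would be monochromatic.
\<close>

lemma focused_lines:
  fixes A :: "'a set" and C :: "nat set"
  assumes fA: "finite A" and A: "A \<noteq> {}" and z: "z \<notin> A" and fC: "finite C"
    and IH: "\<And>C :: nat set. finite C \<Longrightarrow> \<exists>N. \<forall>\<chi>. \<chi> ` words A N \<subseteq> C \<longrightarrow> has_line A N \<chi>"
  shows "\<exists>N. \<forall>\<chi>. \<chi> ` words (insert z A) N \<subseteq> C \<longrightarrow> has_line (insert z A) N \<chi> \<or>
       (\<exists>D f. D \<subseteq> C \<and> card D = k \<and> f \<in> words (insert z A) N \<and> (\<forall>c\<in>D. focused A z N \<chi> f c))"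
proof (induction k)
  case 0
  have "[] \<in> words (insert z A) 0" by (simp add: words_def)
  then show ?case by (intro exI[of _ 0] allI impI disjI2 exI[of _ "{}"] exI[of _ "[]"]) simp
next
  case (Suc k)
  let ?B = "insert z A"
  obtain N where N: "\<And>\<chi>. \<chi> ` words ?B N \<subseteq> C \<Longrightarrow> has_line ?B N \<chi> \<or>
       (\<exists>D f. D \<subseteq> C \<and> card D = k \<and> f \<in> words ?B N \<and> (\<forall>c\<in>D. focused A z N \<chi> f c))"
    using Suc by auto
  \<comment> \<open>A list of all continuations turns the induced pattern of colours into a single natural number.\<close>
  obtain ws where ws: "set ws = words ?B N"
    using finite_words[of ?B N] fA finite_list by blast
  define C' where "C' = (to_nat :: nat list \<Rightarrow> nat) ` {l. set l \<subseteq> C \<and> length l = length ws}"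
  have "finite C'" unfolding C'_def using fC by (intro finite_imageI finite_lists_length_eq)
  then obtain N' where N': "\<And>\<chi>. \<chi> ` words A N' \<subseteq> C' \<Longrightarrow> has_line A N' \<chi>" using IH by metis
  have AB: "words A N' \<subseteq> words ?B N'" by (auto simp: words_def)
  have "has_line ?B (N' + N) \<chi> \<or>
       (\<exists>D f. D \<subseteq> C \<and> card D = Suc k \<and> f \<in> words ?B (N' + N) \<and>
          (\<forall>c\<in>D. focused A z (N' + N) \<chi> f c))"
    if \<chi>: "\<chi> ` words ?B (N' + N) \<subseteq> C" for \<chi>
  proof -
    have \<chi>C: "\<chi> (u @ v) \<in> C" if "u \<in> words ?B N'" "v \<in> words ?B N" for u v
      using \<chi> append_in_words[OF that] by blast
    define \<chi>' where "\<chi>' u = to_nat (map (\<lambda>v. \<chi> (u @ v)) ws)" for u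
    have "has_line A N' \<chi>'"
    proof (intro N' image_subsetI)
      fix u assume "u \<in> words A N'"
      then have "\<forall>v\<in>set ws. \<chi> (u @ v) \<in> C" using \<chi>C AB ws by blast
      then have "set (map (\<lambda>v. \<chi> (u @ v)) ws) \<subseteq> C" by auto
      then show "\<chi>' u \<in> C'" unfolding \<chi>'_def C'_def by (intro imageI) simp
    qed
    then obtain \<sigma> c' where \<sigma>: "template A N' \<sigma>" and c': "\<And>x. x \<in> A \<Longrightarrow> \<chi>' (fill \<sigma> x) = c'"
      by (rule has_lineE) (rule that)
    obtain x0 where x0: "x0 \<in> A" using A by blast
    have \<sigma>eq: "\<chi> (fill \<sigma> x @ v) = \<chi> (fill \<sigma> x0 @ v)" if "x \<in> A" "v \<in> words ?B N" for x v
    proof -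
      have "\<chi>' (fill \<sigma> x) = \<chi>' (fill \<sigma> x0)" using c' that x0 by simp
      then show ?thesis using that(2) unfolding ws[symmetric] by (simp add: \<chi>'_def)
    qed
    have \<sigma>B: "template ?B N' \<sigma>" using template_mono[OF \<sigma>] by blast
    have \<sigma>0: "fill \<sigma> x0 \<in> words ?B N'" using fill_in_words[OF \<sigma> x0] AB by blast
    define \<chi>2 where "\<chi>2 = (\<lambda>v. \<chi> (fill \<sigma> x0 @ v))"
    have \<chi>2: "\<chi>2 ` words ?B N \<subseteq> C" unfolding \<chi>2_def using \<chi>C[OF \<sigma>0] by (rule image_subsetI)
    show ?thesis
    proof (cases "has_line ?B N \<chi>2")
      case True
      then show ?thesis using has_line_append[OF _ \<sigma>0] unfolding \<chi>2_def by blast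
    next
      case noline: False
      then obtain D f where D: "D \<subseteq> C" "card D = k" and f: "f \<in> words ?B N"
        and foc: "\<And>c. c \<in> D \<Longrightarrow> focused A z N \<chi>2 f c"
        using N[OF \<chi>2] by metis
      have new: "\<chi>2 f \<notin> D" using noline foc focused_has_line by metis
      let ?D = "insert (\<chi>2 f) D" and ?f = "fill \<sigma> z @ f"
      have "focused A z (N' + N) \<chi> ?f (\<chi>2 f)"
        using template_append_word[OF \<sigma>B f]
        by (rule focusedI) (simp_all add: fill_append fill_map_Some \<chi>2_def \<sigma>eq f)
      moreover have "focused A z (N' + N) \<chi> ?f c" if "c \<in> D" for c
        using foc[OF that]
      proof (elim focusedE)
        fix \<tau> assume \<tau>: "template ?B N \<tau>" "fill \<tau> z = f" "\<And>x. x \<in> A \<Longrightarrow> \<chi>2 (fill \<tau> x) = c"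
        have "\<chi> (fill \<sigma> x @ fill \<tau> x) = c" if "x \<in> A" for x
          using \<sigma>eq[OF that fill_in_words[OF \<tau>(1)]] \<tau>(3)[OF that] that by (simp add: \<chi>2_def)
        then have "\<chi> (fill (\<sigma> @ \<tau>) x) = c" if "x \<in> A" for x
          using that by (simp add: fill_append)
        moreover have "fill (\<sigma> @ \<tau>) z = ?f" using \<tau>(2) by (simp add: fill_append)
        ultimately show ?thesis
          using template_append[OF \<sigma>B \<tau>(1)] by (intro focusedI)
      qed
      moreover have "?D \<subseteq> C" using D \<chi>2 f by blast
      moreover have "card ?D = Suc k"
        using new D fC by (simp add: finite_subset)
      moreover have "?f \<in> words ?B (N' + N)"
        using fill_in_words[OF \<sigma>B, of z] f by (simp add: append_in_words)
      ultimately show ?thesis by (metis insert_iff)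
    qed
  qed
  then show ?case by (intro exI allI impI)
qed

text \<open>
  By induction on the alphabet: once as many focused lines as colours are available, the colour of
  the focus is the colour of one of them.
\<close>

theorem hales_jewett:
  fixes A :: "'a set" and C :: "nat set"
  assumes "finite A" "finite C"
  shows "\<exists>N. \<forall>\<chi>. \<chi> ` words A N \<subseteq> C \<longrightarrow> has_line A N \<chi>"
  using assms
proof (induction A arbitrary: C rule: finite_induct)
  case empty
  have "template {} 1 [None]" by (simp add: template_def)
  then have "has_line {} 1 \<chi>" for \<chi> by (rule has_lineI) simp
  then show ?case by (intro exI allI impI)
next
  case (insert z A)
  show ?case
  proof (cases "A = {}")
    case True
    have "template {z} 1 [None]" by (simp add: template_def)
    then have "has_line {z} 1 \<chi>" for \<chi> by (rule has_lineI) simp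
    then show ?thesis unfolding True by (intro exI allI impI)
  next
    case False
    let ?B = "insert z A"
    obtain N where N: "\<And>\<chi>. \<chi> ` words ?B N \<subseteq> C \<Longrightarrow> has_line ?B N \<chi> \<or>
       (\<exists>D f. D \<subseteq> C \<and> card D = card C \<and> f \<in> words ?B N \<and> (\<forall>c\<in>D. focused A z N \<chi> f c))"
      using focused_lines[OF insert.hyps(1) False insert.hyps(2) insert.prems, of "card C"] insert.IH
      by auto
    have "has_line ?B N \<chi>" if \<chi>: "\<chi> ` words ?B N \<subseteq> C" for \<chi>
    proof (rule ccontr)
      assume no: "\<not> has_line ?B N \<chi>"
      then obtain D f where D: "D \<subseteq> C" "card D = card C" and f: "f \<in> words ?B N"
        and foc: "\<And>c. c \<in> D \<Longrightarrow> focused A z N \<chi> f c"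
        using N[OF \<chi>] by metis
      have "D = C" using D insert.prems by (simp add: card_subset_eq)
      then have "\<chi> f \<in> D" using f \<chi> by blast
      then show False using no foc focused_has_line by metis
    qed
    then show ?thesis by (intro exI allI impI)
  qed
qed

section \<open>The partite construction\<close>

text \<open>
  In an ordered partite graph \<open>(X, \<pi>, e)\<close> the vertex \<open>x\<close> lies in the part with number \<open>\<pi> x\<close>, and
  \<open>e x y\<close> is read only for \<open>\<pi> x < \<pi> y\<close>. Copies are finally applied to sets that contain one
  vertex from each part, and there they are injective because they preserve the parts.
\<close>

definition partite_copy ::
    "'a set \<Rightarrow> ('a \<Rightarrow> nat) \<Rightarrow> ('a \<Rightarrow> 'a \<Rightarrow> bool) \<Rightarrow> 'b set \<Rightarrow> ('b \<Rightarrow> nat) \<Rightarrow> ('b \<Rightarrow> 'b \<Rightarrow> bool) \<Rightarrow>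
     ('a \<Rightarrow> 'b) \<Rightarrow> bool" where
  "partite_copy X \<pi> e X' \<pi>' e' g \<longleftrightarrow>
     (\<forall>x\<in>X. g x \<in> X' \<and> \<pi>' (g x) = \<pi> x) \<and>
     (\<forall>x\<in>X. \<forall>y\<in>X. \<pi> x < \<pi> y \<longrightarrow> e' (g x) (g y) = e x y)"

lemma partite_copy_comp:
  "partite_copy X \<pi> e X' \<pi>' e' g \<Longrightarrow> partite_copy X' \<pi>' e' X'' \<pi>'' e'' h \<Longrightarrow>
     partite_copy X \<pi> e X'' \<pi>'' e'' (h \<circ> g)"
  by (simp add: partite_copy_def)

text \<open>
  Vertices of the partite graph that arises from one step: words for the two parts that are raised
  to a power, and for the other parts one separate vertex for every line and every old vertex.
\<close>

type_synonym power_vertex = "nat list + ((nat \<times> nat) option list \<times> nat)"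

definition line_point :: "(nat \<times> nat \<Rightarrow> nat) \<Rightarrow> (nat \<times> nat) option list \<Rightarrow> nat \<Rightarrow> nat list" where
  "line_point s \<tau> x = map (\<lambda>c. case c of None \<Rightarrow> x | Some p \<Rightarrow> s p) \<tau>"

lemma length_line_point [simp]: "length (line_point s \<tau> x) = length \<tau>"
  by (simp add: line_point_def)

lemma nth_line_point [simp]:
  "k < length \<tau> \<Longrightarrow> line_point s \<tau> x ! k = (case \<tau> ! k of None \<Rightarrow> x | Some p \<Rightarrow> s p)"
  by (simp add: line_point_def)

lemma line_point_fst: "line_point fst \<tau> x = map fst (fill \<tau> (x, y))"
  and line_point_snd: "line_point snd \<tau> y = map snd (fill \<tau> (x, y))"
  by (auto simp: line_point_def fill_def split: option.splits)

text \<open>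
  An active coordinate shows which vertex the word comes from, whichever of the two parts it is in.
\<close>

lemma line_point_inj:
  assumes "None \<in> set \<tau>" "line_point s \<tau> x = line_point s' \<tau> y"
  shows "x = y"
proof -
  obtain k where k: "k < length \<tau>" "\<tau> ! k = None" using assms(1) by (metis in_set_conv_nth)
  have "line_point s \<tau> x ! k = line_point s' \<tau> y ! k" using assms(2) by simp
  then show ?thesis using k by simp
qed

text \<open>
  Only pairs of the type \<open>(i, j, b)\<close> are made monochromatic: those between the parts \<open>i\<close> and
  \<open>j\<close> with edge value \<open>b\<close>. These pairs form the alphabet \<open>A\<close>. A word over \<open>A\<close> is a pair of words
  over \<open>X\<close>, one in each of the parts \<open>i\<close> and \<open>j\<close> of the new graph, and the two have edge value \<open>b\<close>
  exactly if all their coordinates do. Along a line, coordinates that are fixed contribute \<open>b\<close>, so the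
  edge value is the one at the active coordinates; thus every line carries a copy of the parts \<open>i\<close>
  and \<open>j\<close>, and it is completed by its own copy of the remaining parts. A monochromatic line is the
  required copy.
\<close>

lemma partite_step:
  fixes X :: "nat set" and C :: "nat set"
  assumes fX: "finite X" and fC: "finite C" and ij: "i < j"
  shows "\<exists>(X' :: nat set) \<pi>' e'. finite X' \<and> (\<forall>\<chi>. (\<forall>x y. \<chi> x y \<in> C) \<longrightarrow>
     (\<exists>g c. partite_copy X \<pi> e X' \<pi>' e' g \<and>
        (\<forall>x\<in>X. \<forall>y\<in>X. \<pi> x = i \<and> \<pi> y = j \<and> e x y = b \<longrightarrow> \<chi> (g x) (g y) = c)))"
proof -
  define A where "A = {(x, y). x \<in> X \<and> y \<in> X \<and> \<pi> x = i \<and> \<pi> y = j \<and> e x y = b}"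
  have "A \<subseteq> X \<times> X" by (auto simp: A_def)
  then have fA: "finite A" using fX finite_subset by blast
  obtain N where N: "\<And>\<chi>. \<chi> ` words A N \<subseteq> C \<Longrightarrow> has_line A N \<chi>"
    using hales_jewett[OF fA fC] by metis
  define T where "T = {\<tau>. template A N \<tau>}"
  have "T \<subseteq> {\<tau>. set \<tau> \<subseteq> insert None (Some ` A) \<and> length \<tau> = N}"
    by (auto simp: T_def template_def)
  then have fT: "finite T"
    using finite_lists_length_eq[of "insert None (Some ` A)" N] fA finite_subset by blast
  define \<gamma> :: "(nat \<times> nat) option list \<Rightarrow> nat \<Rightarrow> power_vertex" where
    "\<gamma> \<tau> x = (if \<pi> x = i then Inl (line_point fst \<tau> x)
            else if \<pi> x = j then Inl (line_point snd \<tau> x) else Inr (\<tau>, x))" for \<tau> x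
  define X' :: "power_vertex set" where "X' = Inl ` words X N \<union> Inr ` (T \<times> X)"
  define \<pi>' :: "power_vertex \<Rightarrow> nat" where
    "\<pi>' v = (case v of Inl xs \<Rightarrow> \<pi> (hd xs) | Inr p \<Rightarrow> \<pi> (snd p))" for v
  define mixed where "mixed u v \<longleftrightarrow>
      (\<exists>\<tau>\<in>T. \<exists>x\<in>X. \<exists>y\<in>X. u = \<gamma> \<tau> x \<and> v = \<gamma> \<tau> y \<and> e x y)" for u v
  define e' :: "power_vertex \<Rightarrow> power_vertex \<Rightarrow> bool" where
    "e' u v = (case u of
        Inl xs \<Rightarrow> (case v of
            Inl ys \<Rightarrow> (if \<forall>k<N. e (xs ! k) (ys ! k) = b then b else \<not> b)
          | Inr _ \<Rightarrow> mixed u v)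
      | Inr _ \<Rightarrow> mixed u v)" for u v
  have fX': "finite X'" unfolding X'_def using fX fT by (simp add: finite_words)
  have tmpl: "\<tau> \<noteq> []" "length \<tau> = N" "None \<in> set \<tau>"
      "\<And>k. k < N \<Longrightarrow> \<tau> ! k = None \<or> (\<exists>x y. (x, y) \<in> A \<and> \<tau> ! k = Some (x, y))" if "\<tau> \<in> T" for \<tau>
  proof -
    show "\<tau> \<noteq> []" "length \<tau> = N" "None \<in> set \<tau>" using that by (auto simp: T_def template_def)
    fix k assume "k < N"
    then have "\<tau> ! k \<in> insert None (Some ` A)"
      using that nth_mem[of k \<tau>] by (auto simp only: T_def template_def mem_Collect_eq)
    then show "\<tau> ! k = None \<or> (\<exists>x y. (x, y) \<in> A \<and> \<tau> ! k = Some (x, y))" by auto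
  qed
  have \<gamma>inj: "x = y" if "\<tau> \<in> T" "\<gamma> \<tau> x = \<gamma> \<tau> y" for \<tau> x y
    using that(2) line_point_inj[OF tmpl(3)[OF that(1)]]
    by (auto simp: \<gamma>_def split: if_splits)
  have \<gamma>Inr: "\<tau>' = \<tau> \<and> y = z" if "\<gamma> \<tau>' y = Inr (\<tau>, z)" for \<tau> \<tau>' y z
    using that by (auto simp: \<gamma>_def split: if_splits)
  have mixed_iff: "mixed (\<gamma> \<tau> x) (\<gamma> \<tau> y) \<longleftrightarrow> e x y"
    if \<tau>: "\<tau> \<in> T" and xy: "x \<in> X" "y \<in> X" and Inr: "\<gamma> \<tau> x = Inr (\<tau>, x) \<or> \<gamma> \<tau> y = Inr (\<tau>, y)" for \<tau> x y
  proof
    assume "mixed (\<gamma> \<tau> x) (\<gamma> \<tau> y)"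
    then obtain \<tau>' x' y' where *: "\<tau>' \<in> T" "\<gamma> \<tau> x = \<gamma> \<tau>' x'" "\<gamma> \<tau> y = \<gamma> \<tau>' y'" "e x' y'"
      unfolding mixed_def by blast
    have "\<tau>' = \<tau>" using Inr * \<gamma>Inr by metis
    then show "e x y" using \<gamma>inj[OF \<tau>] * by metis
  next
    assume "e x y"
    then show "mixed (\<gamma> \<tau> x) (\<gamma> \<tau> y)" unfolding mixed_def using \<tau> xy by blast
  qed
  have cop: "partite_copy X \<pi> e X' \<pi>' e' (\<gamma> \<tau>)" if \<tau>: "\<tau> \<in> T" for \<tau>
    unfolding partite_copy_def
  proof (intro conjI ballI impI)
    fix x assume x: "x \<in> X"
    have lp: "line_point s \<tau> x \<in> words X N" if s: "\<And>p. p \<in> A \<Longrightarrow> s p \<in> X" for s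
    proof -
      have "line_point s \<tau> x ! k \<in> X" if "k < N" for k
        using tmpl(4)[OF \<tau> that] tmpl(2)[OF \<tau>] x that s by auto
      then show ?thesis using tmpl(2)[OF \<tau>] by (auto simp: words_def in_set_conv_nth)
    qed
    show "\<gamma> \<tau> x \<in> X'"
      using lp[of fst] lp[of snd] x \<tau> by (auto simp: \<gamma>_def X'_def A_def)
    have hd: "hd (line_point s \<tau> x) = line_point s \<tau> x ! 0" for s
      using tmpl(1)[OF \<tau>] by (simp add: line_point_def hd_conv_nth)
    have "0 < N" using tmpl(1,2)[OF \<tau>] by auto
    then show "\<pi>' (\<gamma> \<tau> x) = \<pi> x"
      using tmpl(4)[OF \<tau>, of 0] tmpl(2)[OF \<tau>]
      by (auto simp: \<gamma>_def \<pi>'_def hd A_def)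
  next
    fix x y assume xy: "x \<in> X" "y \<in> X" "\<pi> x < \<pi> y"
    show "e' (\<gamma> \<tau> x) (\<gamma> \<tau> y) = e x y"
    proof (cases "\<pi> x = i \<and> \<pi> y = j")
      case True
      obtain k where k: "k < N" "\<tau> ! k = None" using tmpl(2,3)[OF \<tau>] by (metis in_set_conv_nth)
      have "(\<forall>k<N. e (line_point fst \<tau> x ! k) (line_point snd \<tau> y ! k) = b) \<longleftrightarrow> e x y = b"
      proof
        assume "\<forall>k<N. e (line_point fst \<tau> x ! k) (line_point snd \<tau> y ! k) = b"
        then show "e x y = b" using k tmpl(2)[OF \<tau>] by fastforce
      next
        assume eb: "e x y = b"
        show "\<forall>k<N. e (line_point fst \<tau> x ! k) (line_point snd \<tau> y ! k) = b"
        proof (intro allI impI)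
          fix k assume "k < N"
          then show "e (line_point fst \<tau> x ! k) (line_point snd \<tau> y ! k) = b"
            using tmpl(4)[OF \<tau>, of k] tmpl(2)[OF \<tau>] eb by (auto simp: A_def)
        qed
      qed
      then show ?thesis using True ij by (auto simp: e'_def \<gamma>_def)
    next
      case False
      then have "\<gamma> \<tau> x = Inr (\<tau>, x) \<or> \<gamma> \<tau> y = Inr (\<tau>, y)" using xy(3) ij by (auto simp: \<gamma>_def)
      moreover from this have "e' (\<gamma> \<tau> x) (\<gamma> \<tau> y) = mixed (\<gamma> \<tau> x) (\<gamma> \<tau> y)"
        by (auto simp: e'_def split: sum.splits)
      ultimately show ?thesis using mixed_iff[OF \<tau> xy(1,2)] by simp
    qed
  qed
  let ?enc = "to_nat :: power_vertex \<Rightarrow> nat" and ?dec = "from_nat :: nat \<Rightarrow> power_vertex"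
  have enc: "partite_copy X' \<pi>' e' (?enc ` X') (\<pi>' \<circ> ?dec) (\<lambda>u v. e' (?dec u) (?dec v)) ?enc"
    by (simp add: partite_copy_def)
  have "\<exists>g c. partite_copy X \<pi> e (?enc ` X') (\<pi>' \<circ> ?dec) (\<lambda>u v. e' (?dec u) (?dec v)) g \<and>
        (\<forall>x\<in>X. \<forall>y\<in>X. \<pi> x = i \<and> \<pi> y = j \<and> e x y = b \<longrightarrow> \<chi> (g x) (g y) = c)"
    if \<chi>: "\<forall>x y. \<chi> x y \<in> C" for \<chi>
  proof -
    let ?\<chi> = "\<lambda>w. \<chi> (?enc (Inl (map fst w))) (?enc (Inl (map snd w)))"
    have "has_line A N ?\<chi>" by (rule N) (simp add: image_subset_iff \<chi>)
    then obtain \<tau> c where \<tau>: "template A N \<tau>" and c: "\<And>p. p \<in> A \<Longrightarrow> ?\<chi> (fill \<tau> p) = c"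
      by (rule has_lineE) (rule that)
    have "\<tau> \<in> T" using \<tau> by (simp add: T_def)
    note copy = partite_copy_comp[OF cop[OF this] enc]
    have "\<chi> ((?enc \<circ> \<gamma> \<tau>) x) ((?enc \<circ> \<gamma> \<tau>) y) = c"
      if "x \<in> X" "y \<in> X" "\<pi> x = i" "\<pi> y = j" "e x y = b" for x y
    proof -
      have "\<gamma> \<tau> x = Inl (map fst (fill \<tau> (x, y)))" "\<gamma> \<tau> y = Inl (map snd (fill \<tau> (x, y)))"
        using that ij by (simp_all add: \<gamma>_def flip: line_point_fst line_point_snd)
      then show ?thesis using c[of "(x, y)"] that by (simp add: A_def)
    qed
    then show ?thesis using copy by blast
  qed
  moreover have "finite (?enc ` X')" using fX' by simp
  ultimately show ?thesis by blast
qed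

text \<open>
  Applying the step for one pair type after the other: later copies live inside earlier ones, so
  the pair types already treated stay monochromatic.
\<close>

lemma partite_iterate:
  fixes X :: "nat set" and C :: "nat set"
  assumes "finite T" "finite X" and fC: "finite C" and "\<And>i j b. (i, j, b) \<in> T \<Longrightarrow> i < j"
  shows "\<exists>(X' :: nat set) \<pi>' e'. finite X' \<and> (\<forall>\<chi>. (\<forall>x y. \<chi> x y \<in> C) \<longrightarrow>
     (\<exists>g c. partite_copy X \<pi> e X' \<pi>' e' g \<and>
        (\<forall>x\<in>X. \<forall>y\<in>X. (\<pi> x, \<pi> y, e x y) \<in> T \<longrightarrow> \<chi> (g x) (g y) = c (\<pi> x, \<pi> y, e x y))))"
  using assms(1,2,4)
proof (induction T rule: finite_induct)
  case empty
  have "partite_copy X \<pi> e X \<pi> e id" by (simp add: partite_copy_def)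
  then show ?case using empty(1) by (intro exI[of _ X] exI[of _ \<pi>] exI[of _ e]) auto
next
  case (insert t T)
  obtain i j b where t: "t = (i, j, b)" by (cases t)
  then have ij: "i < j" using insert.prems by blast
  obtain X1 \<pi>1 e1 where X1: "finite (X1 :: nat set)" and Q1: "\<And>\<chi>. (\<forall>x y. \<chi> x y \<in> C) \<Longrightarrow>
     (\<exists>g c. partite_copy X \<pi> e X1 \<pi>1 e1 g \<and>
        (\<forall>x\<in>X. \<forall>y\<in>X. (\<pi> x, \<pi> y, e x y) \<in> T \<longrightarrow> \<chi> (g x) (g y) = c (\<pi> x, \<pi> y, e x y)))"
    using insert.IH insert.prems by (metis (no_types, lifting) insertCI)
  obtain X2 \<pi>2 e2 where X2: "finite (X2 :: nat set)" and Q2: "\<And>\<chi>. (\<forall>x y. \<chi> x y \<in> C) \<Longrightarrow>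
     (\<exists>g c. partite_copy X1 \<pi>1 e1 X2 \<pi>2 e2 g \<and>
        (\<forall>x\<in>X1. \<forall>y\<in>X1. \<pi>1 x = i \<and> \<pi>1 y = j \<and> e1 x y = b \<longrightarrow> \<chi> (g x) (g y) = c))"
    using partite_step[OF X1 fC ij, of \<pi>1 e1 b] by auto
  have "\<forall>\<chi>. (\<forall>x y. \<chi> x y \<in> C) \<longrightarrow> (\<exists>g c. partite_copy X \<pi> e X2 \<pi>2 e2 g \<and>
        (\<forall>x\<in>X. \<forall>y\<in>X. (\<pi> x, \<pi> y, e x y) \<in> insert t T \<longrightarrow> \<chi> (g x) (g y) = c (\<pi> x, \<pi> y, e x y)))"
  proof (intro allI impI)
    fix \<chi> :: "nat \<Rightarrow> nat \<Rightarrow> nat" assume \<chi>: "\<forall>x y. \<chi> x y \<in> C"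
    obtain g2 c2 where g2: "partite_copy X1 \<pi>1 e1 X2 \<pi>2 e2 g2"
      and c2: "\<And>x y. x \<in> X1 \<Longrightarrow> y \<in> X1 \<Longrightarrow> \<pi>1 x = i \<Longrightarrow> \<pi>1 y = j \<Longrightarrow> e1 x y = b \<Longrightarrow> \<chi> (g2 x) (g2 y) = c2"
      using Q2[OF \<chi>] by auto
    obtain g1 c1 where g1: "partite_copy X \<pi> e X1 \<pi>1 e1 g1"
      and c1: "\<And>x y. x \<in> X \<Longrightarrow> y \<in> X \<Longrightarrow> (\<pi> x, \<pi> y, e x y) \<in> T \<Longrightarrow>
                 \<chi> (g2 (g1 x)) (g2 (g1 y)) = c1 (\<pi> x, \<pi> y, e x y)"
      using Q1[of "\<lambda>x y. \<chi> (g2 x) (g2 y)"] \<chi> by auto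
    let ?c = "c1(t := c2)"
    have "\<chi> ((g2 \<circ> g1) x) ((g2 \<circ> g1) y) = ?c (\<pi> x, \<pi> y, e x y)"
      if xy: "x \<in> X" "y \<in> X" "(\<pi> x, \<pi> y, e x y) \<in> insert t T" for x y
    proof (cases "(\<pi> x, \<pi> y, e x y) = t")
      case True
      then have "\<pi>1 (g1 x) = i" "\<pi>1 (g1 y) = j" "e1 (g1 x) (g1 y) = b" "g1 x \<in> X1" "g1 y \<in> X1"
        using g1 xy ij t by (auto simp: partite_copy_def)
      then show ?thesis using c2 True by simp
    next
      case False
      then show ?thesis using c1 xy by simp
    qed
    then show "\<exists>g c. partite_copy X \<pi> e X2 \<pi>2 e2 g \<and>
        (\<forall>x\<in>X. \<forall>y\<in>X. (\<pi> x, \<pi> y, e x y) \<in> insert t T \<longrightarrow> \<chi> (g x) (g y) = c (\<pi> x, \<pi> y, e x y))"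
      using partite_copy_comp[OF g1 g2]
      by (intro exI[of _ "g2 \<circ> g1"] exI[of _ ?c] conjI ballI impI)
  qed
  with X2 show ?case by (intro exI[of _ X2] exI[of _ \<pi>2] exI[of _ e2] conjI)
qed

text \<open>
  The starting point is a partite graph that contains every graph on \<open>{..<n}\<close> as a transversal: the
  vertices of part \<open>j\<close> are the possible neighbourhoods among the parts before it.
\<close>

theorem partite_ramsey:
  fixes C :: "nat set" and n :: nat
  assumes fC: "finite C"
  shows "\<exists>(X :: nat set) \<pi> (e :: nat \<Rightarrow> nat \<Rightarrow> bool). finite X \<and> (\<forall>\<chi>. (\<forall>x y. \<chi> x y \<in> C) \<longrightarrow>
     (\<exists>c. \<forall>a. \<exists>g. (\<forall>i<n. g i \<in> X \<and> \<pi> (g i) = i) \<and>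
        (\<forall>i j. i < j \<and> j < n \<longrightarrow> e (g i) (g j) = a i j \<and> \<chi> (g i) (g j) = c i j (a i j))))"
proof -
  define X where "X = prod_encode ` ({..<n} \<times> set_encode ` Pow {..<n :: nat})"
  define \<pi> where "\<pi> = fst \<circ> prod_decode"
  define e where "e u v \<longleftrightarrow> \<pi> u \<in> set_decode (snd (prod_decode v))" for u v
  define T where "T = {(i, j, b :: bool). i < j \<and> j < n}"
  have "T \<subseteq> {..<n} \<times> {..<n} \<times> UNIV" by (auto simp: T_def)
  then have fT: "finite T" by (rule finite_subset) simp
  have fX: "finite X" by (simp add: X_def)
  obtain X' \<pi>' e' where X': "finite (X' :: nat set)" and Q: "\<And>\<chi>. (\<forall>x y. \<chi> x y \<in> C) \<Longrightarrow>
     (\<exists>g c. partite_copy X \<pi> e X' \<pi>' e' g \<and>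
        (\<forall>x\<in>X. \<forall>y\<in>X. (\<pi> x, \<pi> y, e x y) \<in> T \<longrightarrow> \<chi> (g x) (g y) = c (\<pi> x, \<pi> y, e x y)))"
    using partite_iterate[OF fT fX fC, of \<pi> e] by (auto simp: T_def)
  have "\<forall>\<chi>. (\<forall>x y. \<chi> x y \<in> C) \<longrightarrow> (\<exists>c. \<forall>a. \<exists>g. (\<forall>i<n. g i \<in> X' \<and> \<pi>' (g i) = i) \<and>
        (\<forall>i j. i < j \<and> j < n \<longrightarrow> e' (g i) (g j) = a i j \<and> \<chi> (g i) (g j) = c i j (a i j)))"
  proof (intro allI impI)
    fix \<chi> :: "nat \<Rightarrow> nat \<Rightarrow> nat" assume \<chi>: "\<forall>x y. \<chi> x y \<in> C"
    obtain h c where h: "partite_copy X \<pi> e X' \<pi>' e' h"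
      and c: "\<And>x y. x \<in> X \<Longrightarrow> y \<in> X \<Longrightarrow> (\<pi> x, \<pi> y, e x y) \<in> T \<Longrightarrow>
                \<chi> (h x) (h y) = c (\<pi> x, \<pi> y, e x y)"
      using Q[OF \<chi>] by auto
    have "\<exists>g. (\<forall>i<n. g i \<in> X' \<and> \<pi>' (g i) = i) \<and>
        (\<forall>i j. i < j \<and> j < n \<longrightarrow> e' (g i) (g j) = a i j \<and> \<chi> (g i) (g j) = c (i, j, a i j))" for a
    proof -
      define x where "x j = prod_encode (j, set_encode {i. i < j \<and> a i j})" for j
      have xX: "x j \<in> X" if "j < n" for j
      proof -
        have "{i. i < j \<and> a i j} \<subseteq> {..<n}" using that by auto
        then show ?thesis using that by (auto simp: x_def X_def)
      qed
      have \<pi>x: "\<pi> (x j) = j" for j by (simp add: x_def \<pi>_def)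
      have ex: "e (x i) (x j) = a i j" if "i < j" for i j
        using that by (simp add: e_def \<pi>x) (simp add: x_def)
      show ?thesis
        using h xX \<pi>x ex c[of "x _" "x _"]
        by (intro exI[of _ "h \<circ> x"]) (auto simp: partite_copy_def T_def)
    qed
    then show "\<exists>c. \<forall>a. \<exists>g. (\<forall>i<n. g i \<in> X' \<and> \<pi>' (g i) = i) \<and>
        (\<forall>i j. i < j \<and> j < n \<longrightarrow> e' (g i) (g j) = a i j \<and> \<chi> (g i) (g j) = c i j (a i j))"
      by (intro exI[of _ "\<lambda>i j b. c (i, j, b)"] allI)
  qed
  with X' show ?thesis by (intro exI[of _ X'] exI[of _ \<pi>'] exI[of _ e'] conjI)
qed

text \<open>
  In the partite theorem the colour of a pair still depends on the two parts. The parts are grouped into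
  blocks of \<open>q\<close> parts, one for each label, and the finite Ramsey theorem for pairs is applied to
  the blocks, a pair of blocks being coloured by the list of all colours between their parts. The same
  \<open>F\<close> serves all labellings \<open>l\<close> and all graphs \<open>a\<close> at once. It cannot be made symmetric, since the
  colour may depend on the order of the two vertices.
\<close>

theorem labelled_ramsey:
  fixes C :: "nat set" and q N :: nat
  assumes fC: "finite C" and q: "0 < q"
  shows "\<exists>(X :: nat set) lab (\<epsilon> :: nat set \<Rightarrow> bool). finite X \<and> (\<forall>x. lab x < q) \<and>
     (\<forall>\<chi>. (\<forall>x y. \<chi> x y \<in> C) \<longrightarrow> (\<exists>F. \<forall>l a. (\<forall>i<N. l i < q) \<longrightarrow>
       (\<exists>g. inj_on g {..<N} \<and> (\<forall>i<N. g i \<in> X \<and> lab (g i) = l i) \<and>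
          (\<forall>i j. i < j \<and> j < N \<longrightarrow>
             \<epsilon> {g i, g j} = a i j \<and> \<chi> (g i) (g j) = F (l i) (l j) (a i j)))))"
proof -
  define ts where "ts = List.product [0..<q] (List.product [0..<q] [False, True])"
  define D where "D = {cs. set cs \<subseteq> C \<and> length cs = length ts}"
  have fD: "finite D" unfolding D_def using fC by (rule finite_lists_length_eq)
  obtain M :: nat where M: "partn_lst {..<M} (replicate (card D) N) 2" using ramsey_full by blast
  obtain h :: "nat list \<Rightarrow> nat" where h: "bij_betw h D {..<card D}"
    using fD ex_bij_betw_finite_nat[of D] by (auto simp: atLeast0LessThan)
  obtain X \<pi> and e :: "nat \<Rightarrow> nat \<Rightarrow> bool" where X: "finite (X :: nat set)" and Q: "\<forall>\<chi>. (\<forall>x y. \<chi> x y \<in> C) \<longrightarrow>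
     (\<exists>c. \<forall>a. \<exists>g. (\<forall>i<M*q. g i \<in> X \<and> \<pi> (g i) = i) \<and>
        (\<forall>i j. i < j \<and> j < M*q \<longrightarrow> e (g i) (g j) = a i j \<and> \<chi> (g i) (g j) = c i j (a i j)))"
    using partite_ramsey[OF fC, of "M*q"] by (elim exE conjE) (rule that, assumption+)
  \<comment> \<open>The order of the parts turns \<open>e\<close> into a symmetric adjacency relation.\<close>
  define \<epsilon> where "\<epsilon> d \<longleftrightarrow> (\<exists>u v. d = {u, v} \<and> \<pi> u < \<pi> v \<and> e u v)" for d
  have \<epsilon>: "\<epsilon> {u, v} = e u v" if "\<pi> u < \<pi> v" for u v
    using that by (auto simp: \<epsilon>_def doubleton_eq_iff)
  have "\<forall>\<chi>. (\<forall>x y. \<chi> x y \<in> C) \<longrightarrow> (\<exists>F. \<forall>l a. (\<forall>i<N. l i < q) \<longrightarrow>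
       (\<exists>g. inj_on g {..<N} \<and> (\<forall>i<N. g i \<in> X \<and> \<pi> (g i) mod q = l i) \<and>
          (\<forall>i j. i < j \<and> j < N \<longrightarrow>
             \<epsilon> {g i, g j} = a i j \<and> \<chi> (g i) (g j) = F (l i) (l j) (a i j))))"
  proof (intro allI impI)
    fix \<chi> :: "nat \<Rightarrow> nat \<Rightarrow> nat" assume \<chi>: "\<forall>x y. \<chi> x y \<in> C"
    obtain c where c: "\<forall>a. \<exists>g. (\<forall>i<M*q. g i \<in> X \<and> \<pi> (g i) = i) \<and>
        (\<forall>i j. i < j \<and> j < M*q \<longrightarrow> e (g i) (g j) = a i j \<and> \<chi> (g i) (g j) = c i j (a i j))"
      using mp[OF spec[OF Q] \<chi>] by (elim exE) (rule that)
    have cC: "c i j b \<in> C" if "i < j" "j < M*q" for i j b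
    proof -
      obtain g where "\<forall>i j. i < j \<and> j < M*q \<longrightarrow> e (g i) (g j) = b \<and> \<chi> (g i) (g j) = c i j b"
        using spec[OF c, of "\<lambda>_ _. b"] by (elim exE conjE) (rule that)
      then have "\<chi> (g i) (g j) = c i j b" using that by simp
      then show ?thesis using \<chi> by metis
    qed
    define pal where "pal k k' = map (\<lambda>(l, l', b). c (k*q + l) (k'*q + l') b) ts" for k k'
    have less: "k * q + l < M * q" if "k < M" "l < q" for k l
    proof -
      have "k * q + l < k * q + q" using that by simp
      also have "\<dots> \<le> M * q" using that(1) mult_le_mono1[of "Suc k" M q] by simp
      finally show ?thesis .
    qed
    have less2: "k * q + l < k' * q + l'" if "k < k'" "l < q" for k k' l l'
    proof -
      have "k * q + l < k * q + q" using that by simp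
      also have "\<dots> \<le> k' * q + l'" using that(1) mult_le_mono1[of "Suc k" k' q] by simp
      finally show ?thesis .
    qed
    have palD: "pal k k' \<in> D" if "k < k'" "k' < M" for k k'
      using that cC less less2 by (auto simp: D_def pal_def ts_def)
    define f where "f d = h (pal (Min d) (Max d))" for d
    have f: "f {k, k'} = h (pal k k')" if "k < k'" for k k'
      using that by (simp add: f_def)
    have "f \<in> nsets {..<M} 2 \<rightarrow> {..<card D}"
    proof
      fix d assume "d \<in> nsets {..<M} 2"
      then obtain k k' where d: "d = {k, k'}" "k < k'" "k' < M"
        by (auto simp: ordered_nsets_2_eq)
      then show "f d \<in> {..<card D}" using f palD h by (auto simp: bij_betw_def)
    qed
    then obtain r H where r: "r < card D" and H: "H \<in> nsets {..<M} N" and mono: "f ` nsets H 2 \<subseteq> {r}"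
      using partn_lstE[OF M, of f "card D"] by (metis length_replicate nth_replicate)
    define Y where "Y i = sorted_list_of_set H ! i" for i
    have fH: "finite H" and cH: "card H = N" and HM: "H \<subseteq> {..<M}" using H by (auto simp: nsets_def)
    have Ymono: "Y i < Y j" if "i < j" "j < N" for i j
      using that fH cH strict_sorted_list_of_set[of H]
      by (simp add: Y_def sorted_wrt_nth_less)
    have YH: "Y i \<in> H" if "i < N" for i
      using that fH cH nth_mem[of i "sorted_list_of_set H"] by (simp add: Y_def)
    have YM: "Y i < M" if "i < N" for i using YH HM that by blast
    have Yinj: "inj_on Y {..<N}"
      using Ymono by (metis inj_onI lessThan_iff linorder_neqE_nat nat_less_le)
    have pal_eq: "pal (Y i) (Y j) = pal (Y 0) (Y 1)" if ij: "i < j" "j < N" for i j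
    proof -
      have 01: "Y 0 < Y 1" "1 < N" using Ymono[of 0 1] ij by auto
      have fr: "f {Y i, Y j} = r" if "i < j" "j < N" for i j
      proof -
        have "{Y i, Y j} \<in> nsets H 2" using YH Ymono[OF that] that by simp
        then show ?thesis using mono by blast
      qed
      have "f {Y i, Y j} = r" "f {Y 0, Y 1} = r" using fr[OF ij] fr[of 0 1] 01 by simp_all
      then have "h (pal (Y i) (Y j)) = h (pal (Y 0) (Y 1))" using f Ymono[OF ij] 01 by simp
      then show ?thesis
        using h palD[OF Ymono[OF ij] YM] palD[OF 01(1) YM] ij 01
        by (auto simp: bij_betw_def inj_on_def)
    qed
    \<comment> \<open>The first two blocks of the homogeneous set represent all pairs of blocks.\<close>
    define F where "F l l' b = c (Y 0 * q + l) (Y 1 * q + l') b" for l l' b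
    have cF: "c (Y i * q + l) (Y j * q + l') b = F l l' b" if "i < j" "j < N" "l < q" "l' < q" for i j l l' b
    proof -
      have "(l, l', b) \<in> set ts" using that by (cases b) (auto simp: ts_def)
      then show ?thesis using pal_eq[OF that(1,2)] by (auto simp: pal_def F_def)
    qed
    have "\<exists>g. inj_on g {..<N} \<and> (\<forall>i<N. g i \<in> X \<and> \<pi> (g i) mod q = l i) \<and>
          (\<forall>i j. i < j \<and> j < N \<longrightarrow> \<epsilon> {g i, g j} = a i j \<and> \<chi> (g i) (g j) = F (l i) (l j) (a i j))"
      if l: "\<forall>i<N. l i < q" for l a
    proof -
      define p where "p i = Y i * q + l i" for i
      define idx where "idx s = inv_into {..<N} Y (s div q)" for s
      have idx: "idx (p i) = i" if "i < N" for i
        using that l q Yinj by (simp add: idx_def p_def inv_into_f_f)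
      obtain g where "\<forall>s<M*q. g s \<in> X \<and> \<pi> (g s) = s"
        and "\<forall>s t. s < t \<and> t < M*q \<longrightarrow> e (g s) (g t) = a (idx s) (idx t) \<and>
                   \<chi> (g s) (g t) = c s t (a (idx s) (idx t))"
        using spec[OF c, of "\<lambda>s t. a (idx s) (idx t)"] by (elim exE conjE) (rule that)
      then have g: "\<And>s. s < M*q \<Longrightarrow> g s \<in> X \<and> \<pi> (g s) = s"
        and ge: "\<And>s t. s < t \<Longrightarrow> t < M*q \<Longrightarrow> e (g s) (g t) = a (idx s) (idx t) \<and>
                   \<chi> (g s) (g t) = c s t (a (idx s) (idx t))"
        by simp_all
      have pM: "p i < M * q" if "i < N" for i using less YM l that by (simp add: p_def)
      have pl: "p i < p j" if "i < j" "j < N" for i j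
        using less2[OF Ymono[OF that]] l that by (simp add: p_def)
      have "inj_on (\<lambda>i. g (p i)) {..<N}"
      proof (rule inj_onI)
        fix i j assume "i \<in> {..<N}" "j \<in> {..<N}" "g (p i) = g (p j)"
        then show "i = j" using g[OF pM] idx by (metis lessThan_iff)
      qed
      moreover have "\<pi> (g (p i)) mod q = l i" if "i < N" for i
        using g[OF pM[OF that]] l that by (simp add: p_def)
      moreover have "\<epsilon> {g (p i), g (p j)} = a i j \<and> \<chi> (g (p i)) (g (p j)) = F (l i) (l j) (a i j)"
        if ij: "i < j" "j < N" for i j
      proof -
        have "\<pi> (g (p i)) < \<pi> (g (p j))" using g[OF pM] pl[OF ij] ij by simp
        then show ?thesis using \<epsilon> ge[OF pl[OF ij] pM[OF ij(2)]] idx ij l cF[OF ij]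
          by (simp add: p_def)
      qed
      moreover have "g (p i) \<in> X" if "i < N" for i using g[OF pM[OF that]] by simp
      ultimately show ?thesis by (intro exI[of _ "\<lambda>i. g (p i)"]) simp
    qed
    then show "\<exists>F. \<forall>l a. (\<forall>i<N. l i < q) \<longrightarrow>
       (\<exists>g. inj_on g {..<N} \<and> (\<forall>i<N. g i \<in> X \<and> \<pi> (g i) mod q = l i) \<and>
          (\<forall>i j. i < j \<and> j < N \<longrightarrow>
             \<epsilon> {g i, g j} = a i j \<and> \<chi> (g i) (g j) = F (l i) (l j) (a i j)))"
      by (intro exI[of _ F] allI impI)
  qed
  moreover have "\<forall>x. \<pi> x mod q < q" using q by simp
  ultimately show ?thesis using X
    by (intro exI[of _ X] exI[of _ "\<lambda>x. \<pi> x mod q"] exI[of _ \<epsilon>] conjI)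
qed

section \<open>Equivalences of finite graphs\<close>

text \<open>
  A graph on a set of natural numbers is a predicate on sets, of which only the values at doubletons
  \<open>{i, j}\<close> with \<open>i \<noteq> j\<close> are relevant; this makes adjacency symmetric without further conditions.
  Switching exchanges edges and non-edges between \<open>J\<close> and its complement.
\<close>

definition switch :: "nat set \<Rightarrow> (nat set \<Rightarrow> bool) \<Rightarrow> nat set \<Rightarrow> bool" where
  "switch J h d \<longleftrightarrow> h d \<noteq> (d \<inter> J \<noteq> {} \<and> \<not> d \<subseteq> J)"

lemma switch_doubleton [simp]:
  "switch J h {i, j} \<longleftrightarrow> h {i, j} \<noteq> ((i \<in> J) \<noteq> (j \<in> J))"
  by (auto simp: switch_def)

definition toggle :: "nat set \<Rightarrow> (nat set \<Rightarrow> bool) \<Rightarrow> nat set \<Rightarrow> bool" where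
  "toggle d0 h d \<longleftrightarrow> h d \<noteq> (d = d0)"

lemma ex_permutation_two:
  fixes u u' v w :: nat
  assumes "u \<noteq> u'" "v \<noteq> w" "u < n" "u' < n" "v < n" "w < n"
  shows "\<exists>\<sigma>. bij \<sigma> \<and> \<sigma> ` {..<n} = {..<n} \<and> \<sigma> u = v \<and> \<sigma> u' = w"
proof -
  define \<tau> where "\<tau> a b = id(a := b, b := a)" for a b :: nat
  have \<tau>\<tau>: "\<tau> a b (\<tau> a b x) = x" for a b x by (simp add: \<tau>_def)
  have bij: "bij (\<tau> a b)" for a b by (rule o_bij[of "\<tau> a b"]) (auto simp: \<tau>\<tau>)
  have lt: "\<tau> a b x < n" if "a < n" "b < n" "x < n" for a b x using that by (simp add: \<tau>_def)
  let ?\<sigma> = "\<tau> (\<tau> u v u') w \<circ> \<tau> u v"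
  have "?\<sigma> u = v" "?\<sigma> u' = w" using assms by (auto simp: \<tau>_def)
  moreover have "bij ?\<sigma>" using bij by (intro bij_comp)
  moreover have "?\<sigma> ` {..<n} = {..<n}"
  proof (rule card_subset_eq)
    show "?\<sigma> ` {..<n} \<subseteq> {..<n}" using lt[OF lt[OF assms(3,5,4)] assms(6) lt[OF assms(3,5)]] by auto
    show "card (?\<sigma> ` {..<n}) = card {..<n}"
      by (rule card_image[OF inj_on_subset[OF bij_is_inj[OF \<open>bij ?\<sigma>\<close>] subset_UNIV]])
  qed simp
  ultimately show ?thesis by blast
qed

text \<open>
  The abstract properties of ``having the same quantifier-free type in a reduct'': \<open>eqv n h h'\<close> relates
  graphs with vertex set \<open>{..<n}\<close>. The rule for reindexing covers both restriction to fewer vertices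
  and permutation of the vertices.
\<close>

locale graph_type_equivalence =
  fixes eqv :: "nat \<Rightarrow> (nat set \<Rightarrow> bool) \<Rightarrow> (nat set \<Rightarrow> bool) \<Rightarrow> bool"
  assumes eqv_sym: "eqv n h h' \<Longrightarrow> eqv n h' h"
    and eqv_trans [trans]: "eqv n h h' \<Longrightarrow> eqv n h' h'' \<Longrightarrow> eqv n h h''"
    and eqv_reindex: "eqv n h h' \<Longrightarrow> inj_on \<sigma> {..<m} \<Longrightarrow> \<sigma> ` {..<m} \<subseteq> {..<n} \<Longrightarrow>
           eqv m (\<lambda>d. h (\<sigma> ` d)) (\<lambda>d. h' (\<sigma> ` d))"
    and eqv_agree: "(\<And>i j. i < j \<Longrightarrow> j < n \<Longrightarrow> h {i, j} = h' {i, j}) \<Longrightarrow> eqv n h h'"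
begin

definition trivial_at :: "nat \<Rightarrow> bool" where "trivial_at n \<longleftrightarrow> (\<forall>h h'. eqv n h h')"
definition complement_at :: "nat \<Rightarrow> bool" where "complement_at n \<longleftrightarrow> (\<forall>h. eqv n h (\<lambda>d. \<not> h d))"
definition switch_at :: "nat \<Rightarrow> bool" where "switch_at n \<longleftrightarrow> (\<forall>h v. eqv n h (switch {v} h))"

definition trivial :: bool where "trivial \<longleftrightarrow> (\<forall>n. trivial_at n)"
definition complement_closed :: bool where "complement_closed \<longleftrightarrow> (\<forall>n. complement_at n)"
definition switch_closed :: bool where "switch_closed \<longleftrightarrow> (\<forall>n. switch_at n)"

lemma eqv_refl: "eqv n h h"
  by (rule eqv_agree) simp

lemma eqv_reindex':
  assumes "eqv n h h'" "inj_on \<sigma> {..<m}" "\<sigma> ` {..<m} \<subseteq> {..<n}"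
    and "\<And>i j. i < j \<Longrightarrow> j < m \<Longrightarrow> k {i, j} = h {\<sigma> i, \<sigma> j}"
    and "\<And>i j. i < j \<Longrightarrow> j < m \<Longrightarrow> k' {i, j} = h' {\<sigma> i, \<sigma> j}"
  shows "eqv m k k'"
proof -
  have "eqv m k (\<lambda>d. h (\<sigma> ` d))" by (rule eqv_agree) (simp add: assms(4))
  also have "eqv m (\<lambda>d. h (\<sigma> ` d)) (\<lambda>d. h' (\<sigma> ` d))" using assms(1-3) by (rule eqv_reindex)
  also have "eqv m (\<lambda>d. h' (\<sigma> ` d)) k'" by (rule eqv_agree) (simp add: assms(5))
  finally show ?thesis .
qed

lemma eqv_agree_right:
  assumes "eqv n h h'" "\<And>i j. i < j \<Longrightarrow> j < n \<Longrightarrow> h' {i, j} = h'' {i, j}"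
  shows "eqv n h h''"
  using eqv_trans[OF assms(1) eqv_agree] assms(2) by blast

lemma eqv_restrict: "eqv n h h' \<Longrightarrow> m \<le> n \<Longrightarrow> eqv m h h'"
  by (erule eqv_reindex'[where \<sigma> = id]) auto

lemma eqv_conjugate:
  assumes \<sigma>: "bij \<sigma>" "\<sigma> ` {..<n} = {..<n}" and e: "eqv n (\<lambda>d. h (inv \<sigma> ` d)) h'"
  shows "eqv n h (\<lambda>d. h' (\<sigma> ` d))"
proof (rule eqv_reindex'[OF e, where \<sigma> = \<sigma>])
  show "inj_on \<sigma> {..<n}" by (rule inj_on_subset[OF bij_is_inj[OF \<sigma>(1)] subset_UNIV])
qed (use \<sigma> in \<open>simp_all add: bij_is_inj inv_f_f\<close>)

lemma trivial_of_constant: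
  assumes "\<And>h. eqv n h (\<lambda>_. b)"
  shows "trivial_at n"
  unfolding trivial_at_def using eqv_trans[OF assms eqv_sym[OF assms]] by blast

text \<open>
  If all edges at one vertex may be overwritten, then the same can be done at every vertex in
  turn, and any graph becomes equivalent to a constant one.
\<close>

lemma trivial_of_star:
  assumes v: "v < n" and e: "\<And>h. eqv n h (\<lambda>d. if v \<in> d then b else h d)"
  shows "trivial_at n"
proof -
  have u: "eqv n h (\<lambda>d. if u \<in> d then b else h d)" if un: "u < n" for u h
  proof (cases "n = 1")
    case True
    then show ?thesis by (intro eqv_agree) simp
  next
    case False
    obtain w where w: "w < n" "w \<noteq> v" using False v
      by (intro that[of "if v = 0 then 1 else 0"]) auto
    obtain w' where w': "w' < n" "w' \<noteq> u" using False un
      by (intro that[of "if u = 0 then 1 else 0"]) auto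
    obtain \<sigma> where \<sigma>: "bij \<sigma>" "\<sigma> ` {..<n} = {..<n}" "\<sigma> u = v"
      using ex_permutation_two[of u w' v w n] w w' un v by metis
    have inj: "inj \<sigma>" using \<sigma>(1) by (rule bij_is_inj)
    have "eqv n h (\<lambda>d. if v \<in> \<sigma> ` d then b else h (inv \<sigma> ` \<sigma> ` d))"
      using eqv_conjugate[OF \<sigma>(1,2) e] by simp
    then show ?thesis
      by (rule eqv_agree_right) (use inj \<sigma>(3) in \<open>auto simp: inv_f_f dest: injD\<close>)
  qed
  have all: "eqv n h (\<lambda>d. if \<exists>u<k. u \<in> d then b else h d)" if "k \<le> n" for k h
    using that
  proof (induction k)
    case 0
    then show ?case by (simp add: eqv_refl)
  next
    case (Suc k)
    then have "eqv n h (\<lambda>d. if \<exists>u<k. u \<in> d then b else h d)" by simp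
    also have "eqv n (\<lambda>d. if \<exists>u<k. u \<in> d then b else h d)
        (\<lambda>d. if k \<in> d then b else if \<exists>u<k. u \<in> d then b else h d)"
      using u Suc.prems by simp
    finally show ?case
      by (rule eqv_agree_right) (auto simp: less_Suc_eq)
  qed
  have "eqv n h (\<lambda>_. b)" for h
    by (rule eqv_agree_right[OF all[of n]]) auto
  then show ?thesis by (rule trivial_of_constant)
qed

text \<open>
  Toggling a pair whose value is \<open>b\<close> can be undone by symmetry, so the pair can be toggled in any case;
  after permuting the vertices, so can every other pair, and any graph can be reached from any other.
\<close>

lemma trivial_of_pair:
  assumes vw: "v < n" "w < n" "v \<noteq> w"
    and e: "\<And>h. h {v, w} = b \<Longrightarrow> eqv n h (toggle {v, w} h)"
  shows "trivial_at n"
proof -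
  have e': "eqv n h (toggle {v, w} h)" for h
  proof (cases "h {v, w} = b")
    case False
    then have "eqv n (toggle {v, w} h) (toggle {v, w} (toggle {v, w} h))"
      by (intro e) (auto simp: toggle_def)
    moreover have "toggle {v, w} (toggle {v, w} h) = h" by (auto simp: toggle_def)
    ultimately show ?thesis by (metis eqv_sym)
  qed (rule e)
  have pair: "eqv n h (toggle {i, j} h)" if ij: "i < j" "j < n" for i j h
  proof -
    obtain \<sigma> where \<sigma>: "bij \<sigma>" "\<sigma> ` {..<n} = {..<n}" "\<sigma> i = v" "\<sigma> j = w"
      using ex_permutation_two[of i j v w n] ij vw by auto
    have inj: "inj \<sigma>" using \<sigma>(1) by (rule bij_is_inj)
    have "eqv n h (\<lambda>d. toggle {v, w} (\<lambda>d. h (inv \<sigma> ` d)) (\<sigma> ` d))"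
      using eqv_conjugate[OF \<sigma>(1,2) e'] by simp
    then show ?thesis
    proof (rule eqv_agree_right)
      fix i' j' :: nat
      have "{\<sigma> i', \<sigma> j'} = {v, w} \<longleftrightarrow> {i', j'} = {i, j}"
        using inj \<sigma>(3,4) by (metis (no_types, opaque_lifting) image_empty image_insert inj_image_eq_iff)
      then show "toggle {v, w} (\<lambda>d. h (inv \<sigma> ` d)) (\<sigma> ` {i', j'}) = toggle {i, j} h {i', j'}"
        using inj by (simp add: toggle_def inv_f_f)
    qed
  qed
  have many: "eqv n h (\<lambda>d. h d \<noteq> (d \<in> D))"
    if "finite D" "D \<subseteq> {{i, j} | i j. i < j \<and> j < n}" for D h
    using that
  proof (induction D rule: finite_induct)
    case empty
    then show ?case by (simp add: eqv_refl)
  next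
    case (insert d0 D)
    then have "eqv n h (\<lambda>d. h d \<noteq> (d \<in> D))" by simp
    also have "eqv n (\<lambda>d. h d \<noteq> (d \<in> D)) (toggle d0 (\<lambda>d. h d \<noteq> (d \<in> D)))"
      using insert.prems pair by auto
    finally show ?case
      by (rule eqv_agree_right) (use insert.hyps in \<open>auto simp: toggle_def\<close>)
  qed
  have "eqv n h h'" for h h'
  proof -
    let ?D = "{{i, j} | i j. i < j \<and> j < n \<and> h {i, j} \<noteq> h' {i, j}}"
    have "?D \<subseteq> Pow {..<n}" by auto
    then have "finite ?D" by (rule finite_subset) simp
    then have "eqv n h (\<lambda>d. h d \<noteq> (d \<in> ?D))" by (rule many) auto
    then show ?thesis by (rule eqv_agree_right) auto
  qed
  then show ?thesis by (simp add: trivial_at_def)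
qed

lemma switch_at_of_vertex:
  assumes v: "v < n" and e: "\<And>h. eqv n h (switch {v} h)"
  shows "switch_at n"
proof -
  have "eqv n h (switch {u} h)" for u h
  proof (cases "u < n \<and> n \<noteq> 1")
    case True
    obtain w where w: "w < n" "w \<noteq> v" using True v
      by (intro that[of "if v = 0 then 1 else 0"]) auto
    obtain w' where w': "w' < n" "w' \<noteq> u" using True
      by (intro that[of "if u = 0 then 1 else 0"]) auto
    obtain \<sigma> where \<sigma>: "bij \<sigma>" "\<sigma> ` {..<n} = {..<n}" "\<sigma> u = v"
      using ex_permutation_two[of u w' v w n] w w' True v by metis
    have inj: "inj \<sigma>" using \<sigma>(1) by (rule bij_is_inj)
    have "eqv n h (\<lambda>d. switch {v} (\<lambda>d. h (inv \<sigma> ` d)) (\<sigma> ` d))"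
      using eqv_conjugate[OF \<sigma>(1,2) e] by simp
    then show ?thesis
      by (rule eqv_agree_right) (use inj \<sigma>(3) in \<open>auto simp: inv_f_f dest: injD\<close>)
  next
    case False
    then show ?thesis by (intro eqv_agree) auto
  qed
  then show ?thesis by (simp add: switch_at_def)
qed

lemma eqv_switch_set:
  assumes "finite J" "J \<noteq> {} \<longrightarrow> switch_closed"
  shows "eqv n h (switch J h)"
  using assms
proof (induction J rule: finite_induct)
  case empty
  then show ?case by (intro eqv_agree) simp
next
  case (insert v J)
  then have "eqv n h (switch J h)" by blast
  also have "eqv n (switch J h) (switch {v} (switch J h))"
    using insert.prems by (simp add: switch_closed_def switch_at_def)
  finally show ?case
    by (rule eqv_agree_right) (use insert.hyps in auto)
qed

text \<open>
  Complements and switchings that are available may be divided out of a change; this is how the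
  changes produced by the Ramsey theorem are brought into normal form.
\<close>

lemma eqv_normalise:
  assumes e: "eqv n h h'" and b: "b \<longrightarrow> complement_closed"
    and J: "finite J" "J \<noteq> {} \<longrightarrow> switch_closed"
    and h'': "\<And>i j. i < j \<Longrightarrow> j < n \<Longrightarrow> h'' {i, j} = (h' {i, j} \<noteq> (b \<noteq> ((i \<in> J) \<noteq> (j \<in> J))))"
  shows "eqv n h h''"
proof -
  have "eqv n h' (\<lambda>d. h' d \<noteq> b)"
    using b by (cases b) (simp_all add: eqv_refl complement_closed_def complement_at_def)
  from eqv_trans[OF eqv_trans[OF e this] eqv_switch_set[OF J]] show ?thesis
    by (rule eqv_agree_right) (auto simp: h'')
qed

text \<open>
  A single size suffices to witness the failure of each property that fails, because by restriction a
  property for one size implies the property for all smaller sizes.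
\<close>

lemma ex_witness_size:
  assumes "\<not> trivial"
  shows "\<exists>m. \<forall>n\<ge>m. \<not> trivial_at n \<and> (complement_at n \<longrightarrow> complement_closed) \<and>
           (switch_at n \<longrightarrow> switch_closed)"
proof -
  have trivial: "trivial_at m" if "trivial_at n" "m \<le> n" for m n
    using that eqv_restrict unfolding trivial_at_def by blast
  have complement: "complement_at m" if "complement_at n" "m \<le> n" for m n
    using that eqv_restrict unfolding complement_at_def by blast
  have switch: "switch_at m" if "switch_at n" "m \<le> n" for m n
    using that eqv_restrict unfolding switch_at_def by blast
  obtain t where t: "\<not> trivial_at t" using assms unfolding trivial_def by blast
  obtain c where c: "complement_at c \<longrightarrow> complement_closed" unfolding complement_closed_def by blast
  obtain s where s: "switch_at s \<longrightarrow> switch_closed" unfolding switch_closed_def by blast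
  have "\<not> trivial_at n \<and> (complement_at n \<longrightarrow> complement_closed) \<and> (switch_at n \<longrightarrow> switch_closed)"
    if "t + c + s \<le> n" for n
    using t c s trivial[of n t] complement[of n c] switch[of n s] that by linarith
  then show ?thesis by blast
qed

end

section \<open>Canonical changes of a graph\<close>

text \<open>
  The graph \<open>h\<close> on \<open>{..<p}\<close> together with a copy of \<open>\<epsilon>\<close> on the vertices \<open>p + u\<close>. The label of
  \<open>u\<close> encodes the set of its neighbours among the \<open>p\<close> points.
\<close>

definition extend_graph ::
    "nat \<Rightarrow> (nat set \<Rightarrow> bool) \<Rightarrow> (nat \<Rightarrow> nat) \<Rightarrow> (nat set \<Rightarrow> bool) \<Rightarrow> nat set \<Rightarrow> bool" where
  "extend_graph p h lab \<epsilon> d \<longleftrightarrow>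
     (if Max d < p then h d
      else if Min d < p then Min d \<in> set_decode (lab (Max d - p))
      else \<epsilon> ((\<lambda>i. i - p) ` d))"

lemma extend_graph_simps:
  "i \<noteq> j \<Longrightarrow> i < p \<Longrightarrow> j < p \<Longrightarrow> extend_graph p h lab \<epsilon> {i, j} = h {i, j}"
  "i < p \<Longrightarrow> extend_graph p h lab \<epsilon> {i, p + u} \<longleftrightarrow> i \<in> set_decode (lab u)"
  "u \<noteq> v \<Longrightarrow> extend_graph p h lab \<epsilon> {p + u, p + v} = \<epsilon> {u, v}"
  by (auto simp: extend_graph_def)

context graph_type_equivalence
begin

text \<open>
  The change from the extension of \<open>h\<close> to \<open>k'\<close> is canonical on enough vertices to transform any
  graph \<open>A\<close> on \<open>{..<n}\<close> of the following form into an equivalent \<open>A'\<close>. The first \<open>r\<close> vertices are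
  distinct points \<open>cs i\<close> among the \<open>p\<close> ones, so \<open>A\<close> agrees with \<open>h\<close> on them. Each later vertex \<open>j\<close> is
  new and its neighbours among the \<open>p\<close> points are \<open>l j\<close>. Then \<open>A'\<close> takes its values from \<open>k'\<close> on the first
  kind of pairs, from \<open>vec\<close> between old points and new vertices, and from \<open>Fe\<close> on pairs of new
  vertices; \<open>Fe\<close> and \<open>vec\<close> depend on a new vertex only through its label.
\<close>

definition canonical_change ::
    "nat \<Rightarrow> nat \<Rightarrow> (nat set \<Rightarrow> bool) \<Rightarrow> (nat set \<Rightarrow> bool) \<Rightarrow>
     (nat set \<Rightarrow> nat set \<Rightarrow> bool \<Rightarrow> bool) \<Rightarrow> (nat set \<Rightarrow> nat \<Rightarrow> bool) \<Rightarrow> bool" where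
  "canonical_change n p h k' Fe vec \<longleftrightarrow> (\<forall>r cs (l :: nat \<Rightarrow> nat set) A A'.
       inj_on cs {..<r} \<and> cs ` {..<r} \<subseteq> {..<p} \<and> (\<forall>i. l i \<subseteq> {..<p}) \<and>
       (\<forall>i j. i < j \<and> j < r \<longrightarrow> A {i, j} = h {cs i, cs j} \<and> A' {i, j} = k' {cs i, cs j}) \<and>
       (\<forall>i j. i < r \<and> r \<le> j \<and> j < n \<longrightarrow> A {i, j} = (cs i \<in> l j) \<and> A' {i, j} = vec (l j) (cs i)) \<and>
       (\<forall>i j. r \<le> i \<and> i < j \<and> j < n \<longrightarrow> A' {i, j} = Fe (l i) (l j) (A {i, j})) \<longrightarrow>
       eqv n A A')"

lemma canonical_changeI:
  assumes "\<And>r cs l A A'. inj_on cs {..<r} \<Longrightarrow> cs ` {..<r} \<subseteq> {..<p} \<Longrightarrow> (\<And>i. l i \<subseteq> {..<p}) \<Longrightarrow>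
       (\<And>i j. i < j \<Longrightarrow> j < r \<Longrightarrow> A {i, j} = h {cs i, cs j} \<and> A' {i, j} = k' {cs i, cs j}) \<Longrightarrow>
       (\<And>i j. i < r \<Longrightarrow> r \<le> j \<Longrightarrow> j < n \<Longrightarrow> A {i, j} = (cs i \<in> l j) \<and> A' {i, j} = vec (l j) (cs i)) \<Longrightarrow>
       (\<And>i j. r \<le> i \<Longrightarrow> i < j \<Longrightarrow> j < n \<Longrightarrow> A' {i, j} = Fe (l i) (l j) (A {i, j})) \<Longrightarrow>
       eqv n A A'"
  shows "canonical_change n p h k' Fe vec"
  unfolding canonical_change_def
proof (intro allI impI)
  fix r cs A A' and l :: "nat \<Rightarrow> nat set"
  assume *: "inj_on cs {..<r} \<and> cs ` {..<r} \<subseteq> {..<p} \<and> (\<forall>i. l i \<subseteq> {..<p}) \<and>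
       (\<forall>i j. i < j \<and> j < r \<longrightarrow> A {i, j} = h {cs i, cs j} \<and> A' {i, j} = k' {cs i, cs j}) \<and>
       (\<forall>i j. i < r \<and> r \<le> j \<and> j < n \<longrightarrow> A {i, j} = (cs i \<in> l j) \<and> A' {i, j} = vec (l j) (cs i)) \<and>
       (\<forall>i j. r \<le> i \<and> i < j \<and> j < n \<longrightarrow> A' {i, j} = Fe (l i) (l j) (A {i, j}))"
  show "eqv n A A'"
    by (rule assms[where r = r and cs = cs and l = l]) (use * in \<open>simp_all only:\<close>)
qed

lemma canonical_changeD:
  assumes "canonical_change n p h k' Fe vec"
    and "inj_on cs {..<r}" "cs ` {..<r} \<subseteq> {..<p}" "\<And>i. l i \<subseteq> {..<p}"
    and "\<And>i j. i < j \<Longrightarrow> j < r \<Longrightarrow> A {i, j} = h {cs i, cs j} \<and> A' {i, j} = k' {cs i, cs j}"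
    and "\<And>i j. i < r \<Longrightarrow> r \<le> j \<Longrightarrow> j < n \<Longrightarrow> A {i, j} = (cs i \<in> l j) \<and> A' {i, j} = vec (l j) (cs i)"
    and "\<And>i j. r \<le> i \<Longrightarrow> i < j \<Longrightarrow> j < n \<Longrightarrow> A' {i, j} = Fe (l i) (l j) (A {i, j})"
  shows "eqv n A A'"
proof -
  have "inj_on cs {..<r} \<and> cs ` {..<r} \<subseteq> {..<p} \<and> (\<forall>i. l i \<subseteq> {..<p}) \<and>
       (\<forall>i j. i < j \<and> j < r \<longrightarrow> A {i, j} = h {cs i, cs j} \<and> A' {i, j} = k' {cs i, cs j}) \<and>
       (\<forall>i j. i < r \<and> r \<le> j \<and> j < n \<longrightarrow> A {i, j} = (cs i \<in> l j) \<and> A' {i, j} = vec (l j) (cs i)) \<and>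
       (\<forall>i j. r \<le> i \<and> i < j \<and> j < n \<longrightarrow> A' {i, j} = Fe (l i) (l j) (A {i, j}))"
    using assms(2-) by (intro conjI allI impI; (elim conjE)?) simp_all
  then show ?thesis
    by (rule assms(1)[unfolded canonical_change_def, THEN spec, of r, THEN spec, of cs,
          THEN spec, of l, THEN spec, of A, THEN spec, of A', THEN mp])
qed

text \<open>
  The colour of an ordered pair of new vertices records the value of \<open>k'\<close> at the pair and the
  connections of its first vertex to the \<open>p\<close> points.
\<close>

lemma canonical_extension:
  fixes p n :: nat and h :: "nat set \<Rightarrow> bool"
  shows "\<exists>M k. p \<le> M \<and> (\<forall>i j. i < j \<and> j < p \<longrightarrow> k {i, j} = h {i, j}) \<and>
    (\<forall>k'. eqv M k k' \<longrightarrow> (\<exists>Fe vec. canonical_change n p h k' Fe vec))"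
proof -
  define q where "q = Suc (Max (set_encode ` Pow {..<p}))"
  have q: "set_encode S < q" if "S \<subseteq> {..<p}" for S
    using that by (simp add: q_def less_Suc_eq_le)
  have q0: "0 < q" by (simp add: q_def)
  define C where "C = (to_nat :: bool \<times> bool list \<Rightarrow> nat) ` (UNIV \<times> {bs. set bs \<subseteq> UNIV \<and> length bs = p})"
  have fC: "finite C" unfolding C_def
    by (intro finite_imageI finite_cartesian_product finite_lists_length_eq) simp_all
  obtain X :: "nat set" and lab :: "nat \<Rightarrow> nat" and \<epsilon> :: "nat set \<Rightarrow> bool" where X: "finite X"
    and R: "\<forall>\<chi>. (\<forall>x y. \<chi> x y \<in> C) \<longrightarrow> (\<exists>F. \<forall>l a. (\<forall>i<n+1. l i < q) \<longrightarrow>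
       (\<exists>g. inj_on g {..<n+1} \<and> (\<forall>i<n+1. g i \<in> X \<and> lab (g i) = l i) \<and>
          (\<forall>i j. i < j \<and> j < n+1 \<longrightarrow>
             \<epsilon> {g i, g j} = a i j \<and> \<chi> (g i) (g j) = F (l i) (l j) (a i j))))"
    \<comment> \<open>One vertex more than asked for: as a last partner it reveals the colour of every other vertex.\<close>
    using labelled_ramsey[OF fC q0, of "n+1"] by (elim exE conjE) (rule that)
  define M where "M = p + Suc (Max (insert 0 X))"
  define k where "k = extend_graph p h lab \<epsilon>"
  have XM: "p + u < M" if "u \<in> X" for u
    using that X by (simp add: M_def less_Suc_eq_le)
  have "\<exists>Fe vec. canonical_change n p h k' Fe vec"
    if k': "eqv M k k'" for k'
  proof -
    define col where "col u v = (k' {p + u, p + v}, map (\<lambda>c. k' {c, p + u}) [0..<p])" for u v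
    have colC: "\<forall>x y. to_nat (col x y) \<in> C" by (simp add: C_def col_def)
    obtain F where F: "\<forall>l a. (\<forall>i<n+1. l i < q) \<longrightarrow>
       (\<exists>g. inj_on g {..<n+1} \<and> (\<forall>i<n+1. g i \<in> X \<and> lab (g i) = l i) \<and>
          (\<forall>i j. i < j \<and> j < n+1 \<longrightarrow>
             \<epsilon> {g i, g j} = a i j \<and> to_nat (col (g i) (g j)) = F (l i) (l j) (a i j)))"
      using mp[OF spec[OF R, of "\<lambda>x y. to_nat (col x y)"] colC] by (elim exE) (rule that)
    define Fd :: "nat set \<Rightarrow> nat set \<Rightarrow> bool \<Rightarrow> bool \<times> bool list" where
      "Fd l l' x = from_nat (F (set_encode l) (set_encode l') x)" for l l' x
    define vec where "vec l c = snd (Fd l {} False) ! c" for l c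
    have eqv: "eqv n A A'"
      if cs: "inj_on cs {..<r}" "cs ` {..<r} \<subseteq> {..<p}" and l: "\<And>i. l i \<subseteq> {..<p}"
        and A_in: "\<And>i j. i < j \<Longrightarrow> j < r \<Longrightarrow> A {i, j} = h {cs i, cs j} \<and> A' {i, j} = k' {cs i, cs j}"
        and A_mixed: "\<And>i j. i < r \<Longrightarrow> r \<le> j \<Longrightarrow> j < n \<Longrightarrow> A {i, j} = (cs i \<in> l j) \<and> A' {i, j} = vec (l j) (cs i)"
        and A_out: "\<And>i j. r \<le> i \<Longrightarrow> i < j \<Longrightarrow> j < n \<Longrightarrow> A' {i, j} = fst (Fd (l i) (l j) (A {i, j}))"
      for r cs A A' and l :: "nat \<Rightarrow> nat set"
    proof -
      define l' where "l' i = (if i < n then l i else {})" for i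
      have l': "l' i \<subseteq> {..<p}" for i using l by (simp add: l'_def)
      have lq: "\<forall>i<n+1. set_encode (l' i) < q" using q[OF l'] by simp
      obtain g where g_inj: "inj_on g {..<n+1}" and "\<forall>i<n+1. g i \<in> X \<and> lab (g i) = set_encode (l' i)"
        and "\<forall>i j. i < j \<and> j < n+1 \<longrightarrow> \<epsilon> {g i, g j} = (j < n \<and> A {i, j}) \<and>
               to_nat (col (g i) (g j)) = F (set_encode (l' i)) (set_encode (l' j)) (j < n \<and> A {i, j})"
        using mp[OF spec[OF spec[OF F, of "\<lambda>i. set_encode (l' i)"], of "\<lambda>i j. j < n \<and> A {i, j}"] lq]
        by (elim exE conjE) (rule that)
      then have gX: "\<And>i. i \<le> n \<Longrightarrow> g i \<in> X \<and> lab (g i) = set_encode (l' i)"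
        and g\<epsilon>: "\<And>i j. i < j \<Longrightarrow> j \<le> n \<Longrightarrow> \<epsilon> {g i, g j} = (j < n \<and> A {i, j})"
        and gcol: "\<And>i j. i < j \<Longrightarrow> j \<le> n \<Longrightarrow>
               to_nat (col (g i) (g j)) = F (set_encode (l' i)) (set_encode (l' j)) (j < n \<and> A {i, j})"
        by simp_all
      have col: "col (g i) (g j) = Fd (l' i) (l' j) (j < n \<and> A {i, j})" if "i < j" "j \<le> n" for i j
        unfolding Fd_def gcol[OF that, symmetric] by simp
      have gne: "g i \<noteq> g j" if "i < j" "j < n" for i j
        using inj_onD[OF g_inj, of i j] that by auto
      have vec: "k' {c, p + g i} = vec (l i) c" if "i < n" "c < p" for c i
      proof -
        have "vec (l i) c = snd (col (g i) (g n)) ! c"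
          using col[OF that(1)] that by (simp add: vec_def l'_def)
        then show ?thesis using that by (simp add: col_def)
      qed
      have csp: "cs i < p" if "i < r" for i using cs(2) that by auto
      have dec: "set_decode (lab (g j)) = l j" if "j < n" for j
        using gX[of j] that finite_subset[OF l, of j] by (simp add: l'_def)
      define \<sigma> where "\<sigma> i = (if i < r then cs i else p + g i)" for i
      show ?thesis
      proof (rule eqv_reindex'[OF k'])
        show "inj_on \<sigma> {..<n}"
        proof (rule inj_onI)
          fix i j assume ij: "i \<in> {..<n}" "j \<in> {..<n}" "\<sigma> i = \<sigma> j"
          then show "i = j"
            using inj_onD[OF cs(1), of i j] inj_onD[OF g_inj, of i j] csp[of i] csp[of j]
            by (auto simp: \<sigma>_def split: if_splits)
        qed
        show "\<sigma> ` {..<n} \<subseteq> {..<M}"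
        proof
          fix x assume "x \<in> \<sigma> ` {..<n}"
          then obtain i where i: "i < n" "x = \<sigma> i" by auto
          have "p < M" by (simp add: M_def)
          then show "x \<in> {..<M}"
            using csp[of i] XM[of "g i"] gX[of i] i by (auto simp: \<sigma>_def)
        qed
        fix i j assume ij: "i < j" "j < n"
        consider (inner) "j < r" | (mixed) "i < r" "r \<le> j" | (outer) "r \<le> i" using ij by linarith
        then have "A {i, j} = k {\<sigma> i, \<sigma> j} \<and> A' {i, j} = k' {\<sigma> i, \<sigma> j}"
        proof cases
          case inner
          then have "cs i \<noteq> cs j" using inj_onD[OF cs(1), of i j] ij by auto
          then show ?thesis
            using inner ij csp[of i] csp[of j] A_in[of i j]
            by (simp add: \<sigma>_def k_def extend_graph_simps)
        next
          case mixed
          then show ?thesis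
            using ij csp[of i] dec[of j] vec[of j "cs i"] A_mixed[of i j]
            by (simp add: \<sigma>_def k_def extend_graph_simps)
        next
          case outer
          have "fst (col (g i) (g j)) = k' {p + g i, p + g j}" by (simp add: col_def)
          then have "k' {p + g i, p + g j} = fst (Fd (l i) (l j) (A {i, j}))"
            using col[of i j] ij by (simp add: l'_def)
          then show ?thesis
            using outer ij gne[OF ij] g\<epsilon>[of i j] A_out[of i j]
            by (simp add: \<sigma>_def k_def extend_graph_simps)
        qed
        then show "A {i, j} = k {\<sigma> i, \<sigma> j}" "A' {i, j} = k' {\<sigma> i, \<sigma> j}" by simp_all
      qed
    qed
    have "canonical_change n p h k' (\<lambda>l l' x. fst (Fd l l' x)) vec"
      by (rule canonical_changeI) (rule eqv)
    then show ?thesis by (intro exI)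
  qed
  then have "\<forall>k'. eqv M k k' \<longrightarrow> (\<exists>Fe vec. canonical_change n p h k' Fe vec)"
    by (intro allI impI)
  moreover have "\<forall>i j. i < j \<and> j < p \<longrightarrow> k {i, j} = h {i, j}"
    by (simp add: k_def extend_graph_simps)
  moreover have "p \<le> M" by (simp add: M_def)
  ultimately show ?thesis by (intro exI[of _ M] exI[of _ k] conjI)
qed

text \<open>
  With the functions \<open>Fe\<close> and \<open>vec\<close> at hand, each step prescribes a graph in which the change,
  after normalisation, affects very few pairs, and then excludes all but one behaviour: any other would
  make the system trivial by \<open>trivial_of_constant\<close>, \<open>trivial_of_star\<close> or \<open>trivial_of_pair\<close>. First, new vertices
  without neighbours among the \<open>p\<close> points (label \<open>{}\<close>) determine the complement \<open>b\<close>; comparing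
  other labels with \<open>{}\<close> determines the labels \<open>l\<close>, marked by \<open>K l\<close>, whose vertices have to be switched; then nothing is left to
  happen among the new vertices. The same is done for one old point against the new vertices,
  which yields the set \<open>J\<close> of old points to be switched, and finally for a pair of old points.
\<close>

theorem rigid_extension:
  assumes nontriv: "\<not> trivial"
  shows "\<exists>M k. p \<le> M \<and> (\<forall>i j. i < j \<and> j < p \<longrightarrow> k {i, j} = h {i, j}) \<and>
    (\<forall>k'. eqv M k k' \<longrightarrow> (\<exists>b J. (b \<longrightarrow> complement_closed) \<and> (J \<noteq> {} \<longrightarrow> switch_closed) \<and>
       (\<forall>i j. i < j \<and> j < p \<longrightarrow> k' {i, j} = (h {i, j} \<noteq> (b \<noteq> ((i \<in> J) \<noteq> (j \<in> J)))))))"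
proof -
  obtain m where m: "\<forall>n\<ge>m. \<not> trivial_at n \<and> (complement_at n \<longrightarrow> complement_closed) \<and>
           (switch_at n \<longrightarrow> switch_closed)"
    using ex_witness_size[OF nontriv] by blast
  \<comment> \<open>Room for the two distinguished vertices of the last steps.\<close>
  define n where "n = m + 3"
  have n3: "3 \<le> n" by (simp add: n_def)
  have nt: "\<not> trivial_at n" and cc: "complement_at n \<longrightarrow> complement_closed"
    and sc: "switch_at n \<longrightarrow> switch_closed"
    using m n_def by (meson le_add1)+
  obtain M k where "p \<le> M" and kh: "\<forall>i j. i < j \<and> j < p \<longrightarrow> k {i, j} = h {i, j}"
    and can: "\<forall>k'. eqv M k k' \<longrightarrow> (\<exists>Fe vec. canonical_change n p h k' Fe vec)"
    using canonical_extension[of p h n] by (elim exE conjE) (rule that)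
  have "\<exists>b J. (b \<longrightarrow> complement_closed) \<and> (J \<noteq> {} \<longrightarrow> switch_closed) \<and>
       (\<forall>i j. i < j \<and> j < p \<longrightarrow> k' {i, j} = (h {i, j} \<noteq> (b \<noteq> ((i \<in> J) \<noteq> (j \<in> J)))))"
    if k': "eqv M k k'" for k'
  proof -
    obtain Fe vec where can': "canonical_change n p h k' Fe vec"
      using mp[OF spec[OF can] k'] by (elim exE) (rule that)
    note pick = canonical_changeD[OF can']
    have pick0: "eqv n A A'"
      if "\<And>i. l i \<subseteq> {..<p}" "\<And>i j. i < j \<Longrightarrow> j < n \<Longrightarrow> A' {i, j} = Fe (l i) (l j) (A {i, j})"
      for A A' and l :: "nat \<Rightarrow> nat set"
      by (rule pick[where r = 0 and l = l]) (use that in auto)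
    \<comment> \<open>Among new vertices with label \<open>{}\<close> the change is either nothing or the complement.\<close>
    define b where "b = Fe {} {} False"
    have Fe00: "Fe {} {} x = (x \<noteq> b)" for x
    proof (rule ccontr)
      assume "Fe {} {} x \<noteq> (x \<noteq> b)"
      then have "Fe {} {} y = b" for y by (cases x; cases y) (auto simp: b_def)
      then have "eqv n A (\<lambda>_. b)" for A by (intro pick0[of "\<lambda>_. {}"]) auto
      then show False using nt trivial_of_constant by blast
    qed
    have b: "b \<longrightarrow> complement_closed"
    proof
      assume b
      then have "eqv n A (\<lambda>d. \<not> A d)" for A by (intro pick0[of "\<lambda>_. {}"]) (auto simp: Fe00)
      then show complement_closed using cc by (simp add: complement_at_def)
    qed
    \<comment> \<open>One vertex with label \<open>l\<close> after many with label \<open>{}\<close>: its star is kept, switched or erased.\<close>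
    define K where "K l \<longleftrightarrow> Fe {} l False \<noteq> b" for l
    have Fe0: "Fe {} l x = (x \<noteq> (b \<noteq> K l))" and K: "K l \<longrightarrow> switch_closed" if l: "l \<subseteq> {..<p}" for l x
    proof -
      have e: "eqv n A (\<lambda>d. if n - 1 \<in> d then Fe {} l (A d) \<noteq> b else A d)" for A
      proof (rule eqv_normalise[where J = "{}" and b = b])
        show "eqv n A (\<lambda>d. if n - 1 \<in> d then Fe {} l (A d) else A d \<noteq> b)"
          by (rule pick0[of "\<lambda>i. if i = n - 1 then l else {}"]) (use l in \<open>auto simp: Fe00\<close>)
      qed (use b in auto)
      show Fe0: "Fe {} l x = (x \<noteq> (b \<noteq> K l))" for x
      proof (rule ccontr)
        assume "Fe {} l x \<noteq> (x \<noteq> (b \<noteq> K l))"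
        then have "Fe {} l y = (b \<noteq> K l)" for y by (cases x; cases y) (auto simp: K_def)
        then have "eqv n A (\<lambda>d. if n - 1 \<in> d then K l else A d)" for A
          by (intro eqv_agree_right[OF e]) auto
        then show False using nt trivial_of_star[of "n - 1" n "K l"] n3 by auto
      qed
      show "K l \<longrightarrow> switch_closed"
      proof
        assume Kl: "K l"
        have "eqv n A (switch {n - 1} A)" for A
          by (rule eqv_agree_right[OF e]) (use Kl in \<open>auto simp: Fe0\<close>)
        then show switch_closed using sc switch_at_of_vertex[of "n - 1" n] n3 by auto
      qed
    qed
    have Fe: "Fe l l' x = (x \<noteq> (b \<noteq> (K l \<noteq> K l')))" if l: "l \<subseteq> {..<p}" "l' \<subseteq> {..<p}" for l l' x
    proof (rule ccontr)
      \<comment> \<open>The last two vertices get the labels \<open>l\<close> and \<open>l'\<close>, the others \<open>{}\<close>; only the last pair can change.\<close>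
      assume bad: "Fe l l' x \<noteq> (x \<noteq> (b \<noteq> (K l \<noteq> K l')))"
      define L where "L i = (if i = n - 2 then l else if i = n - 1 then l' else {})" for i
      have L: "L i \<subseteq> {..<p}" for i using l by (simp add: L_def)
      have Ll: "L (n - 2) = l" "L (n - 1) = l'" using n3 by (auto simp: L_def)
      have K0: "\<not> K {}" by (simp add: K_def b_def)
      have "eqv n A (toggle {n - 2, n - 1} A)" if A: "A {n - 2, n - 1} = x" for A
      proof (rule eqv_normalise[where J = "{i. i < n \<and> K (L i)}" and b = b])
        define A' where "A' d = (if d = {n - 2, n - 1} then Fe l l' x
          else A d \<noteq> (b \<noteq> (K (L (Min d)) \<noteq> K (L (Max d)))))" for d
        have A': "A' {i, j} = (if i = n - 2 \<and> j = n - 1 then Fe l l' x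
            else A {i, j} \<noteq> (b \<noteq> (K (L i) \<noteq> K (L j))))" if "i < j" "j < n" for i j
        proof -
          have "{i, j} = {n - 2, n - 1} \<longleftrightarrow> i = n - 2 \<and> j = n - 1"
            using that n3 by (auto simp: doubleton_eq_iff)
          then show ?thesis using that by (simp add: A'_def)
        qed
        show "eqv n A A'"
        proof (rule pick0[of L, OF L])
          fix i j assume ij: "i < j" "j < n"
          show "A' {i, j} = Fe (L i) (L j) (A {i, j})"
          proof (cases "i = n - 2")
            case True
            then have "j = n - 1" using ij by simp
            then show ?thesis using True A A'[OF ij] Ll by simp
          next
            case False
            moreover have "i \<noteq> n - 1" using ij by linarith
            ultimately have "L i = {}" by (simp add: L_def)
            then show ?thesis using A'[OF ij] False Fe0[OF L] K0 by simp
          qed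
        qed
        fix i j assume ij: "i < j" "j < n"
        have "{i, j} = {n - 2, n - 1} \<longleftrightarrow> i = n - 2 \<and> j = n - 1"
          using ij n3 by (auto simp: doubleton_eq_iff)
        moreover have "K (L (n - 2)) = K l" "K (L (n - 1)) = K l'" using Ll by simp_all
        ultimately show "toggle {n - 2, n - 1} A {i, j} = (A' {i, j} \<noteq> (b \<noteq>
             ((i \<in> {i. i < n \<and> K (L i)}) \<noteq> (j \<in> {i. i < n \<and> K (L i)}))))"
          using A'[OF ij] ij A bad by (auto simp: toggle_def)
      qed (use b K L in auto)
      moreover have "n - 2 < n" "n - 1 < n" "n - 2 \<noteq> n - 1" using n3 by linarith+
      ultimately show False using nt trivial_of_pair by blast
    qed
    define w where "w c l \<longleftrightarrow> vec l c \<noteq> (b \<noteq> K l)" for c l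
    \<comment> \<open>The old point \<open>c\<close> is vertex \<open>0\<close>. Prescribing its star by the labels \<open>l\<close> and \<open>l'\<close> allows any \<open>A\<close>.\<close>
    have one: "eqv n A (\<lambda>d. if 0 \<in> d then w c (if A d then l' else l) else A d)"
      if c: "c < p" and l: "l \<subseteq> {..<p}" "c \<notin> l" and l': "l' \<subseteq> {..<p}" "c \<in> l'" for A c l l'
    proof -
      define L where "L j = (if A {0, j} then l' else l)" for j
      have L: "L i \<subseteq> {..<p}" for i using l l' by (simp add: L_def)
      define A' where "A' d = (if 0 \<in> d then vec (L (Max d)) c
          else A d \<noteq> (b \<noteq> (K (L (Min d)) \<noteq> K (L (Max d)))))" for d
      have A': "A' {i, j} = (if i = 0 then vec (L j) c
            else A {i, j} \<noteq> (b \<noteq> (K (L i) \<noteq> K (L j))))" if "i < j" for i j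
        using that by (simp add: A'_def)
      show ?thesis
      proof (rule eqv_normalise[where J = "{j. 1 \<le> j \<and> j < n \<and> K (L j)}" and b = b])
        show "eqv n A A'"
        proof (rule pick[where r = 1 and cs = "\<lambda>_. c" and l = L])
          show "A {i, j} = (c \<in> L j) \<and> A' {i, j} = vec (L j) c" if "i < 1" "1 \<le> j" for i j
            using that A'[of i j] l l' by (simp add: L_def)
          show "A' {i, j} = Fe (L i) (L j) (A {i, j})" if "1 \<le> i" "i < j" for i j
            using that A'[of i j] Fe[OF L L] by simp
        qed (use c L in \<open>auto simp: inj_on_def\<close>)
        show "(if 0 \<in> {i, j} then w c (if A {i, j} then l' else l) else A {i, j}) =
            (A' {i, j} \<noteq> (b \<noteq> ((i \<in> {j. 1 \<le> j \<and> j < n \<and> K (L j)}) \<noteq> (j \<in> {j. 1 \<le> j \<and> j < n \<and> K (L j)}))))"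
          if "i < j" "j < n" for i j
        proof (cases "i = 0")
          case True
          then show ?thesis using that A'[of i j] by (simp add: w_def) (simp add: L_def)
        next
          case False
          then show ?thesis using that A'[of i j] by auto
        qed
      qed (use b K L in auto)
    qed
    have w: "w c l' \<noteq> w c l"
      if c: "c < p" and l: "l \<subseteq> {..<p}" "c \<notin> l" and l': "l' \<subseteq> {..<p}" "c \<in> l'" for c l l'
    proof
      assume "w c l' = w c l"
      then have "eqv n A (\<lambda>d. if 0 \<in> d then w c l else A d)" for A
        by (intro eqv_agree_right[OF one[OF c l l']]) auto
      then show False using nt trivial_of_star[of 0 n "w c l"] n3 by auto
    qed
    define J where "J = {c. c < p \<and> w c {}}"
    have wJ: "w c l = ((c \<in> l) \<noteq> (c \<in> J))" if "c < p" "l \<subseteq> {..<p}" for c l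
      using w[of c "{}" l] w[of c l "{c}"] w[of c "{}" "{c}"] that by (auto simp: J_def)
    have J: "J \<noteq> {} \<longrightarrow> switch_closed"
    proof
      assume "J \<noteq> {}"
      then obtain c where c: "c < p" "w c {}" by (auto simp: J_def)
      then have c': "\<not> w c {c}" using w[of c "{}" "{c}"] by auto
      have "eqv n A (switch {0} A)" for A
        by (rule eqv_agree_right[OF one[of c "{}" "{c}"]]) (use c c' in auto)
      then show switch_closed using sc switch_at_of_vertex[of 0 n] n3 by auto
    qed
    have "k' {c, c'} = (h {c, c'} \<noteq> (b \<noteq> ((c \<in> J) \<noteq> (c' \<in> J))))" if cc': "c < c'" "c' < p" for c c'
    proof (rule ccontr)
      \<comment> \<open>The old points \<open>c\<close> and \<open>c'\<close> are the vertices \<open>0\<close> and \<open>1\<close>; labels realise any edges to the others.\<close>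
      assume bad: "k' {c, c'} \<noteq> (h {c, c'} \<noteq> (b \<noteq> ((c \<in> J) \<noteq> (c' \<in> J))))"
      have "eqv n A (toggle {0, 1} A)" if A: "A {0, 1} = h {c, c'}" for A
      proof -
        define L where "L j = (if A {0, j} then {c} else {}) \<union> (if A {1, j} then {c'} else {})" for j
        have L: "L i \<subseteq> {..<p}" for i using cc' by (auto simp: L_def)
        define cs where "cs i = (if i = 0 then c else c')" for i :: nat
        have csp: "cs i < p" for i using cc' by (simp add: cs_def)
        define A' where "A' d = (if d = {0, 1} then k' {c, c'} else if Min d < 2 then vec (L (Max d)) (cs (Min d))
            else A d \<noteq> (b \<noteq> (K (L (Min d)) \<noteq> K (L (Max d)))))" for d :: "nat set"
        have A': "A' {i, j} = (if i = 0 \<and> j = 1 then k' {c, c'} else if i < 2 then vec (L j) (cs i)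
            else A {i, j} \<noteq> (b \<noteq> (K (L i) \<noteq> K (L j))))" if "i < j" for i j
        proof -
          have "{i, j} = {0, 1} \<longleftrightarrow> i = 0 \<and> j = 1" using that by (auto simp: doubleton_eq_iff)
          then show ?thesis using that by (simp add: A'_def)
        qed
        have AL: "A {i, j} = (cs i \<in> L j)" if "i < 2" for i j
          using that cc' less_2_cases[OF that] by (auto simp: L_def cs_def)
        define S where "S = {j. j < n \<and> (if j < 2 then cs j \<in> J else K (L j))}"
        show ?thesis
        proof (rule eqv_normalise[where J = S and b = b])
          show "eqv n A A'"
          proof (rule pick[where r = 2 and cs = cs and l = L])
            show "inj_on cs {..<2}" using cc' by (auto simp: inj_on_def cs_def less_2_cases_iff)
            show "A {i, j} = h {cs i, cs j} \<and> A' {i, j} = k' {cs i, cs j}" if "i < j" "j < 2" for i j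
            proof -
              have "i = 0" "j = 1" using that by auto
              then show ?thesis using A A'[of 0 1] by (simp add: cs_def)
            qed
          qed (use csp L AL in \<open>auto simp: A' Fe[OF L L]\<close>)
          fix i j assume ij: "i < j" "j < n"
          have eq: "{i, j} = {0, 1} \<longleftrightarrow> i = 0 \<and> j = 1" using ij by (auto simp: doubleton_eq_iff)
          consider (both) "i = 0" "j = 1" | (mixed) "i < 2" "2 \<le> j" | (outside) "2 \<le> i" "2 \<le> j"
            using ij by linarith
          then show "toggle {0, 1} A {i, j} = (A' {i, j} \<noteq> (b \<noteq> ((i \<in> S) \<noteq> (j \<in> S))))"
          proof cases
            case both
            then show ?thesis using A'[OF ij(1)] A bad n3 by (auto simp: toggle_def S_def cs_def)
          next
            case mixed
            then have "vec (L j) (cs i) = ((cs i \<in> L j) \<noteq> ((cs i \<in> J) \<noteq> (b \<noteq> K (L j))))"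
              using wJ[OF csp L, of i j] by (auto simp: w_def)
            then show ?thesis using mixed A'[OF ij(1)] AL[of i j] ij eq by (auto simp: toggle_def S_def)
          next
            case outside
            then show ?thesis using A'[OF ij(1)] ij eq by (auto simp: toggle_def S_def)
          qed
        qed (use b K L J in \<open>auto simp: S_def split: if_splits\<close>)
      qed
      then show False using nt trivial_of_pair[of 0 n 1 "h {c, c'}"] n3 by auto
    qed
    then show ?thesis
      by (intro exI[of _ b] exI[of _ J] conjI allI impI) (use b J in auto)
  qed
  then have "\<forall>k'. eqv M k k' \<longrightarrow> (\<exists>b J. (b \<longrightarrow> complement_closed) \<and> (J \<noteq> {} \<longrightarrow> switch_closed) \<and>
       (\<forall>i j. i < j \<and> j < p \<longrightarrow> k' {i, j} = (h {i, j} \<noteq> (b \<noteq> ((i \<in> J) \<noteq> (j \<in> J))))))"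
    by (intro allI impI)
  with \<open>p \<le> M\<close> kh show ?thesis by (intro exI[of _ M] exI[of _ k] conjI)
qed

end

section \<open>Quantifier-free types in the random graph\<close>

lemma sat_cong: "(\<And>x. x \<in> fv \<phi> \<Longrightarrow> e x = e' x) \<Longrightarrow> sat \<Gamma> e \<phi> = sat \<Gamma> e' \<phi>"
proof (induction \<phi> arbitrary: e e')
  case (Rel s js)
  then have "map e js = map e' js" by simp
  then show ?case by (simp only: sat.simps)
next
  case (Neg \<phi>)
  then have "sat \<Gamma> e \<phi> = sat \<Gamma> e' \<phi>" by (intro Neg.IH) simp
  then show ?case by simp
next
  case (Conj \<phi> \<psi>)
  have "sat \<Gamma> e \<phi> = sat \<Gamma> e' \<phi>" "sat \<Gamma> e \<psi> = sat \<Gamma> e' \<psi>"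
    using Conj.prems by (auto intro!: Conj.IH)
  then show ?case by simp
next
  case (Ex i \<phi>)
  have "sat \<Gamma> (e(i := v)) \<phi> = sat \<Gamma> (e'(i := v)) \<phi>" for v
    using Ex.prems by (intro Ex.IH) auto
  then show ?case by simp
qed simp

lemma finite_fv: "finite (fv \<phi>)"
  by (induction \<phi>) simp_all

lemma wf_foldr_Ex: "wf_fm \<Gamma> (foldr Ex xs \<phi>) \<longleftrightarrow> wf_fm \<Gamma> \<phi>"
  by (induction xs) simp_all

lemma fv_foldr_Ex: "fv (foldr Ex xs \<phi>) = fv \<phi> - set xs"
  by (induction xs) auto

lemma sat_foldr_Ex:
  "sat \<Gamma> e (foldr Ex xs \<phi>) \<longleftrightarrow> (\<exists>e'. (\<forall>x. x \<notin> set xs \<longrightarrow> e' x = e x) \<and> sat \<Gamma> e' \<phi>)"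
proof (induction xs arbitrary: e)
  case Nil
  have "(\<forall>x. e' x = e x) \<longleftrightarrow> e' = e" for e' by auto
  then show ?case by simp
next
  case (Cons y xs)
  show ?case
  proof
    assume "sat \<Gamma> e (foldr Ex (y # xs) \<phi>)"
    then obtain v e' where "\<forall>x. x \<notin> set xs \<longrightarrow> e' x = (e(y := v)) x" "sat \<Gamma> e' \<phi>"
      using Cons.IH by auto
    then show "\<exists>e'. (\<forall>x. x \<notin> set (y # xs) \<longrightarrow> e' x = e x) \<and> sat \<Gamma> e' \<phi>"
      by (intro exI[of _ e']) auto
  next
    assume "\<exists>e'. (\<forall>x. x \<notin> set (y # xs) \<longrightarrow> e' x = e x) \<and> sat \<Gamma> e' \<phi>"
    then obtain e' where e': "\<forall>x. x \<notin> set (y # xs) \<longrightarrow> e' x = e x" "sat \<Gamma> e' \<phi>" by auto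
    then have "sat \<Gamma> (e(y := e' y)) (foldr Ex xs \<phi>)"
      unfolding Cons.IH by (intro exI[of _ e']) auto
    then show "sat \<Gamma> e (foldr Ex (y # xs) \<phi>)" by auto
  qed
qed

text \<open>
  The variable \<open>z\<close> is there because the conjunction of no formulas has to mention some variable.
\<close>

lemma ex_finite_conjunction:
  assumes "finite A" "\<forall>\<phi>\<in>A. quantifier_free \<phi> \<and> wf_fm \<Gamma> \<phi> \<and> fv \<phi> \<subseteq> S" "z \<in> S"
  shows "\<exists>\<psi>. quantifier_free \<psi> \<and> wf_fm \<Gamma> \<psi> \<and> fv \<psi> \<subseteq> S \<and> (\<forall>e. sat \<Gamma> e \<psi> \<longleftrightarrow> (\<forall>\<phi>\<in>A. sat \<Gamma> e \<phi>))"
  using assms(1,2)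
proof (induction A rule: finite_induct)
  case empty
  then show ?case using assms(3) by (intro exI[of _ "Eq z z"]) simp
next
  case (insert \<phi> A)
  then obtain \<psi> where "quantifier_free \<psi>" "wf_fm \<Gamma> \<psi>" "fv \<psi> \<subseteq> S"
      "\<forall>e. sat \<Gamma> e \<psi> \<longleftrightarrow> (\<forall>\<phi>\<in>A. sat \<Gamma> e \<phi>)" by auto
  then show ?case using insert.prems by (intro exI[of _ "Conj \<phi> \<psi>"]) simp
qed

lemma ex_finite_disjunction:
  assumes "finite A" "\<forall>\<phi>\<in>A. quantifier_free \<phi> \<and> wf_fm \<Gamma> \<phi> \<and> fv \<phi> \<subseteq> S" "z \<in> S"
  shows "\<exists>\<psi>. quantifier_free \<psi> \<and> wf_fm \<Gamma> \<psi> \<and> fv \<psi> \<subseteq> S \<and> (\<forall>e. sat \<Gamma> e \<psi> \<longleftrightarrow> (\<exists>\<phi>\<in>A. sat \<Gamma> e \<phi>))"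
proof -
  obtain \<psi> where "quantifier_free \<psi>" "wf_fm \<Gamma> \<psi>" "fv \<psi> \<subseteq> S"
      "\<forall>e. sat \<Gamma> e \<psi> \<longleftrightarrow> (\<forall>\<phi>\<in>Neg ` A. sat \<Gamma> e \<phi>)"
    using ex_finite_conjunction[of "Neg ` A" \<Gamma> S z] assms by auto
  then show ?thesis by (intro exI[of _ "Neg \<psi>"]) simp
qed

context random_graph
begin

definition realises :: "nat \<Rightarrow> (nat \<Rightarrow> 'v) \<Rightarrow> (nat set \<Rightarrow> bool) \<Rightarrow> bool" where
  "realises n \<rho> h \<longleftrightarrow> inj_on \<rho> {..<n} \<and> (\<forall>i j. i < j \<and> j < n \<longrightarrow> (\<rho> i, \<rho> j) \<in> E \<longleftrightarrow> h {i, j})"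

definition graph_of :: "(nat \<Rightarrow> 'v) \<Rightarrow> nat set \<Rightarrow> bool" where
  "graph_of \<rho> d \<longleftrightarrow> (\<exists>i j. d = {i, j} \<and> (\<rho> i, \<rho> j) \<in> E)"

definition same_type :: "nat set \<Rightarrow> (nat \<Rightarrow> 'v) \<Rightarrow> (nat \<Rightarrow> 'v) \<Rightarrow> bool" where
  "same_type S e e' \<longleftrightarrow>
     (\<forall>i\<in>S. \<forall>j\<in>S. (e i = e j \<longleftrightarrow> e' i = e' j) \<and> ((e i, e j) \<in> E \<longleftrightarrow> (e' i, e' j) \<in> E))"

lemma E_sym: "(x, y) \<in> E \<longleftrightarrow> (y, x) \<in> E"
  using sym_edges by (auto dest: symD)

lemma E_irrefl: "(x, x) \<notin> E"
  using irrefl_edges by (simp add: irrefl_def)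

lemma graph_of_doubleton [simp]: "graph_of \<rho> {i, j} \<longleftrightarrow> (\<rho> i, \<rho> j) \<in> E"
  using E_sym by (auto simp: graph_of_def doubleton_eq_iff)

lemma realises_graph_of: "inj_on \<rho> {..<n} \<Longrightarrow> realises n \<rho> (graph_of \<rho>)"
  by (simp add: realises_def)

lemma realises_edge:
  assumes "realises n \<rho> h" "i < n" "j < n" "i \<noteq> j"
  shows "(\<rho> i, \<rho> j) \<in> E \<longleftrightarrow> h {i, j}"
proof (cases "i < j")
  case True
  then show ?thesis using assms by (simp add: realises_def)
next
  case False
  then have "(\<rho> j, \<rho> i) \<in> E \<longleftrightarrow> h {j, i}" using assms by (simp add: realises_def)
  then show ?thesis using E_sym by (simp add: insert_commute)
qed

lemma realises_inj: "realises n \<rho> h \<Longrightarrow> i < n \<Longrightarrow> j < n \<Longrightarrow> \<rho> i = \<rho> j \<longleftrightarrow> i = j"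
  by (auto simp: realises_def inj_on_def)

lemma realises_agree:
  assumes "realises n \<rho> h" "\<And>i j. i < j \<Longrightarrow> j < n \<Longrightarrow> h {i, j} = h' {i, j}"
  shows "realises n \<rho> h'"
  using assms by (simp add: realises_def)

lemma realises_same_type:
  assumes "realises n \<rho> h" "realises n \<rho>' h'" "\<And>i j. i < j \<Longrightarrow> j < n \<Longrightarrow> h {i, j} = h' {i, j}"
  shows "same_type {..<n} \<rho> \<rho>'"
proof -
  have \<rho>': "realises n \<rho>' h" using assms(2,3) by (simp add: realises_def)
  show ?thesis
    unfolding same_type_def
  proof (intro ballI conjI)
    fix i j assume "i \<in> {..<n}" "j \<in> {..<n}"
    then have ij: "i < n" "j < n" by simp_all
    show "\<rho> i = \<rho> j \<longleftrightarrow> \<rho>' i = \<rho>' j"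
      using realises_inj[OF assms(1) ij] realises_inj[OF \<rho>' ij] by simp
    show "(\<rho> i, \<rho> j) \<in> E \<longleftrightarrow> (\<rho>' i, \<rho>' j) \<in> E"
      using realises_edge[OF assms(1) ij] realises_edge[OF \<rho>' ij] E_irrefl by (cases "i = j") simp_all
  qed
qed

text \<open>
  New vertices are found one at a time by the extension axiom.
\<close>

lemma realises_extend:
  assumes "p \<le> M" and \<rho>: "realises p \<rho> k"
  shows "\<exists>\<rho>'. (\<forall>i<p. \<rho>' i = \<rho> i) \<and> realises M \<rho>' k"
  using assms(1)
proof (induction M rule: dec_induct)
  case base
  then show ?case using \<rho> by blast
next
  case (step m)
  then obtain \<rho>' where \<rho>': "\<forall>i<p. \<rho>' i = \<rho> i" "realises m \<rho>' k" by blast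
  let ?U = "\<rho>' ` {i. i < m \<and> k {i, m}}" and ?U' = "\<rho>' ` {i. i < m \<and> \<not> k {i, m}}"
  have "?U \<inter> ?U' = {}" using realises_inj[OF \<rho>'(2)] by auto
  then obtain v where v: "v \<notin> ?U \<union> ?U'" "\<forall>u\<in>?U. (v, u) \<in> E" "\<forall>u\<in>?U'. (v, u) \<notin> E"
    using extension[of ?U ?U'] by auto
  have new: "\<rho>' i \<noteq> v" "(\<rho>' i, v) \<in> E \<longleftrightarrow> k {i, m}" if "i < m" for i
    using v that E_sym by auto
  have "realises (Suc m) (\<rho>'(m := v)) k"
    unfolding realises_def
  proof (intro conjI allI impI)
    show "inj_on (\<rho>'(m := v)) {..<Suc m}"
    proof (rule inj_onI)
      fix a b assume "a \<in> {..<Suc m}" "b \<in> {..<Suc m}" "(\<rho>'(m := v)) a = (\<rho>'(m := v)) b"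
      then show "a = b"
        using new(1)[of a] new(1)[of b] realises_inj[OF \<rho>'(2), of a b]
        by (auto simp: less_Suc_eq split: if_splits)
    qed
    fix i j assume "i < j \<and> j < Suc m"
    then show "((\<rho>'(m := v)) i, (\<rho>'(m := v)) j) \<in> E \<longleftrightarrow> k {i, j}"
      using \<rho>'(2) new(2) by (auto simp: realises_def less_Suc_eq)
  qed
  moreover have "\<forall>i<p. (\<rho>'(m := v)) i = \<rho> i" using \<rho>'(1) step.hyps by simp
  ultimately show ?case by blast
qed

lemma realisable: "\<exists>\<rho>. realises n \<rho> h"
  using realises_extend[of 0 n "\<lambda>_. undefined" h] by (auto simp: realises_def)

lemma same_type_sym: "same_type S e e' \<Longrightarrow> same_type S e' e"
  by (auto simp: same_type_def)

lemma same_type_extend: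
  assumes S: "finite S" and st: "same_type (S - {i}) e e'"
  shows "\<exists>v'. same_type S (e(i := v)) (e'(i := v'))"
proof (cases "\<exists>s\<in>S - {i}. e s = v")
  case True
  then obtain s where s: "s \<in> S - {i}" "e s = v" by blast
  have "same_type S (e(i := v)) (e'(i := e' s))"
    using st s unfolding same_type_def by (auto simp: E_irrefl)
  then show ?thesis by blast
next
  case False
  let ?U = "e' ` {s \<in> S - {i}. (v, e s) \<in> E}" and ?U' = "e' ` {s \<in> S - {i}. (v, e s) \<notin> E}"
  have "?U \<inter> ?U' = {}"
  proof (rule ccontr)
    assume "?U \<inter> ?U' \<noteq> {}"
    then obtain s t where "s \<in> S - {i}" "t \<in> S - {i}" "(v, e s) \<in> E" "(v, e t) \<notin> E" "e' s = e' t"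
      by auto
    then show False using st unfolding same_type_def by metis
  qed
  then obtain v' where v': "v' \<notin> ?U \<union> ?U'" "\<forall>u\<in>?U. (v', u) \<in> E" "\<forall>u\<in>?U'. (v', u) \<notin> E"
    using extension[of ?U ?U'] S by auto
  have new: "e s \<noteq> v" "e' s \<noteq> v'" "(v', e' s) \<in> E \<longleftrightarrow> (v, e s) \<in> E" "(e' s, v') \<in> E \<longleftrightarrow> (e s, v) \<in> E"
    if "s \<in> S" "s \<noteq> i" for s
    using v' False that E_sym by auto
  have "same_type S (e(i := v)) (e'(i := v'))"
    unfolding same_type_def
  proof (intro ballI)
    fix a b assume ab: "a \<in> S" "b \<in> S"
    show "((e(i := v)) a = (e(i := v)) b \<longleftrightarrow> (e'(i := v')) a = (e'(i := v')) b) \<and>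
          (((e(i := v)) a, (e(i := v)) b) \<in> E \<longleftrightarrow> ((e'(i := v')) a, (e'(i := v')) b) \<in> E)"
      using ab new[of a] new[of b] st E_irrefl
      by (cases "a = i"; cases "b = i") (auto simp: same_type_def)
  qed
  then show ?thesis by blast
qed

text \<open>
  Back and forth: the extension axiom answers every choice of a witness for a quantifier, so two
  assignments of the same quantifier-free type in the random graph satisfy the same formulas.
\<close>

lemma sat_same_type:
  "wf_fm (graph_structure E) \<phi> \<Longrightarrow> same_type (fv \<phi>) e e' \<Longrightarrow>
     sat (graph_structure E) e \<phi> = sat (graph_structure E) e' \<phi>"
proof (induction \<phi> arbitrary: e e')
  case (Eq i j)
  then show ?case by (simp add: same_type_def)
next
  case (Rel s js)
  then obtain a b where "js = [a, b]"
    by (auto simp: graph_structure_def length_Suc_conv numeral_2_eq_2)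
  then show ?case using Rel by (simp add: graph_structure_def same_type_def)
next
  case (Neg \<phi>)
  then show ?case by (metis fv.simps(3) sat.simps(3) wf_fm.simps(3))
next
  case (Conj \<phi> \<psi>)
  have "same_type (fv \<phi>) e e'" "same_type (fv \<psi>) e e'"
    using Conj.prems(2) by (auto simp: same_type_def)
  then show ?case using Conj by simp
next
  case (Ex i \<phi>)
  have half: "sat (graph_structure E) e' (Ex i \<phi>)"
    if e: "sat (graph_structure E) e (Ex i \<phi>)" and st: "same_type (fv \<phi> - {i}) e e'" for e e'
  proof -
    obtain v where v: "sat (graph_structure E) (e(i := v)) \<phi>" using e by auto
    obtain v' where "same_type (fv \<phi>) (e(i := v)) (e'(i := v'))"
      using same_type_extend[OF finite_fv st] by blast
    then have "sat (graph_structure E) (e'(i := v')) \<phi>" using Ex.IH v Ex.prems(1) by auto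
    then show ?thesis by auto
  qed
  show ?case using half[of e e'] half[of e' e] Ex.prems(2) same_type_sym by auto
qed

text \<open>
  Being a union of orbits of the automorphism group, expressed by partial isomorphisms. Reducts have
  this property, and it will turn out to characterise them (\<open>reduct_iff_invariant\<close>).
\<close>

definition invariant :: "('s, 'v) rel_structure \<Rightarrow> bool" where
  "invariant \<Gamma> \<longleftrightarrow> is_rel_structure \<Gamma> \<and>
     (\<forall>s\<in>symbols \<Gamma>. \<forall>e e'. same_type {..<arity \<Gamma> s} e e' \<longrightarrow>
        map e [0..<arity \<Gamma> s] \<in> interp \<Gamma> s \<longrightarrow> map e' [0..<arity \<Gamma> s] \<in> interp \<Gamma> s)"

lemma reduct_invariant:
  assumes "reduct_of \<Gamma> (graph_structure E)"
  shows "invariant \<Gamma>"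
  unfolding invariant_def
proof (intro conjI ballI allI impI)
  show "is_rel_structure \<Gamma>" using assms by (simp add: reduct_of_def)
  fix s e e' assume s: "s \<in> symbols \<Gamma>" and st: "same_type {..<arity \<Gamma> s} e e'"
    and e: "map e [0..<arity \<Gamma> s] \<in> interp \<Gamma> s"
  obtain \<phi> where \<phi>: "fm_defines (graph_structure E) \<phi> (arity \<Gamma> s) (interp \<Gamma> s)"
    using assms s by (auto simp: reduct_of_def)
  have "same_type (fv \<phi>) e e'" using st \<phi> by (auto simp: same_type_def fm_defines_def)
  then show "map e' [0..<arity \<Gamma> s] \<in> interp \<Gamma> s"
    using \<phi> e sat_same_type[of \<phi> e e'] by (auto simp: fm_defines_def)
qed

lemma invariantD:
  assumes "invariant \<Gamma>" "s \<in> symbols \<Gamma>" "length js = arity \<Gamma> s" "same_type (set js) e e'"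
  shows "map e js \<in> interp \<Gamma> s \<longleftrightarrow> map e' js \<in> interp \<Gamma> s"
proof -
  have eq: "map f js = map (\<lambda>i. f (js ! i)) [0..<arity \<Gamma> s]" for f :: "nat \<Rightarrow> 'v"
    using assms(3) by (intro nth_equalityI) simp_all
  have "same_type {..<arity \<Gamma> s} (\<lambda>i. e (js ! i)) (\<lambda>i. e' (js ! i))"
    using assms(3,4) by (simp add: same_type_def)
  then show ?thesis
    using assms(1,2) same_type_sym unfolding eq invariant_def by metis
qed

definition agree_on :: "('s, 'v) rel_structure \<Rightarrow> nat \<Rightarrow> (nat \<Rightarrow> 'v) \<Rightarrow> (nat \<Rightarrow> 'v) \<Rightarrow> bool" where
  "agree_on \<Gamma> n \<rho> \<rho>' \<longleftrightarrow> (\<forall>s\<in>symbols \<Gamma>. \<forall>js. length js = arity \<Gamma> s \<longrightarrow> set js \<subseteq> {..<n} \<longrightarrow>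
     (map \<rho> js \<in> interp \<Gamma> s \<longleftrightarrow> map \<rho>' js \<in> interp \<Gamma> s))"

definition eqv :: "('s, 'v) rel_structure \<Rightarrow> nat \<Rightarrow> (nat set \<Rightarrow> bool) \<Rightarrow> (nat set \<Rightarrow> bool) \<Rightarrow> bool" where
  "eqv \<Gamma> n h h' \<longleftrightarrow> (\<forall>\<rho> \<rho>'. realises n \<rho> h \<longrightarrow> realises n \<rho>' h' \<longrightarrow> agree_on \<Gamma> n \<rho> \<rho>')"

lemma agree_on_same_type:
  assumes "invariant \<Gamma>" "same_type {..<n} \<rho> \<rho>'"
  shows "agree_on \<Gamma> n \<rho> \<rho>'"
  unfolding agree_on_def
proof (intro ballI allI impI)
  fix s js assume "s \<in> symbols \<Gamma>" "length js = arity \<Gamma> s" "set js \<subseteq> {..<n}"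
  then show "map \<rho> js \<in> interp \<Gamma> s \<longleftrightarrow> map \<rho>' js \<in> interp \<Gamma> s"
    using assms by (intro invariantD) (auto simp: same_type_def)
qed

lemma agree_on_sym: "agree_on \<Gamma> n \<rho> \<rho>' \<Longrightarrow> agree_on \<Gamma> n \<rho>' \<rho>"
  by (simp add: agree_on_def)

lemma agree_on_trans: "agree_on \<Gamma> n \<rho> \<rho>' \<Longrightarrow> agree_on \<Gamma> n \<rho>' \<rho>'' \<Longrightarrow> agree_on \<Gamma> n \<rho> \<rho>''"
  by (simp add: agree_on_def)

text \<open>
  One pair of realisations decides equivalence, as all realisations of a graph look alike in an invariant
  structure.
\<close>

lemma eqv_iff:
  assumes "invariant \<Gamma>" and \<rho>: "realises n \<rho> h" and \<rho>': "realises n \<rho>' h'"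
  shows "eqv \<Gamma> n h h' \<longleftrightarrow> agree_on \<Gamma> n \<rho> \<rho>'"
proof
  assume "eqv \<Gamma> n h h'"
  then show "agree_on \<Gamma> n \<rho> \<rho>'" using \<rho> \<rho>' by (simp add: eqv_def)
next
  assume *: "agree_on \<Gamma> n \<rho> \<rho>'"
  show "eqv \<Gamma> n h h'"
    unfolding eqv_def
  proof (intro allI impI)
    fix \<rho>1 \<rho>1' assume "realises n \<rho>1 h" "realises n \<rho>1' h'"
    then have "agree_on \<Gamma> n \<rho>1 \<rho>" "agree_on \<Gamma> n \<rho>' \<rho>1'"
      using assms by (auto intro!: agree_on_same_type realises_same_type)
    then show "agree_on \<Gamma> n \<rho>1 \<rho>1'" using * agree_on_trans by metis
  qed
qed

lemma realises_reindex:
  assumes "realises n \<rho> h" "inj_on \<sigma> {..<m}" "\<sigma> ` {..<m} \<subseteq> {..<n}"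
  shows "realises m (\<lambda>i. \<rho> (\<sigma> i)) (\<lambda>d. h (\<sigma> ` d))"
proof -
  have \<sigma>: "\<sigma> i < n" if "i < m" for i using assms(3) that by auto
  have \<sigma>i: "\<sigma> i = \<sigma> j \<longleftrightarrow> i = j" if "i < m" "j < m" for i j using assms(2) that by (auto simp: inj_on_def)
  show ?thesis
    unfolding realises_def
  proof (intro conjI allI impI)
    show "inj_on (\<lambda>i. \<rho> (\<sigma> i)) {..<m}"
      by (rule inj_onI) (use realises_inj[OF assms(1)] \<sigma> \<sigma>i in auto)
    fix i j assume "i < j \<and> j < m"
    then show "(\<rho> (\<sigma> i), \<rho> (\<sigma> j)) \<in> E \<longleftrightarrow> h (\<sigma> ` {i, j})"
      using realises_edge[OF assms(1), of "\<sigma> i" "\<sigma> j"] \<sigma> \<sigma>i by simp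
  qed
qed

lemma eqv_is_graph_type_equivalence:
  assumes inv: "invariant \<Gamma>"
  shows "graph_type_equivalence (eqv \<Gamma>)"
proof
  fix n h h' assume *: "eqv \<Gamma> n h h'"
  show "eqv \<Gamma> n h' h"
    unfolding eqv_def
  proof (intro allI impI)
    fix \<rho> \<rho>' assume "realises n \<rho> h'" "realises n \<rho>' h"
    then have "agree_on \<Gamma> n \<rho>' \<rho>" using * by (simp add: eqv_def)
    then show "agree_on \<Gamma> n \<rho> \<rho>'" by (rule agree_on_sym)
  qed
next
  fix n h h' h'' assume *: "eqv \<Gamma> n h h'" "eqv \<Gamma> n h' h''"
  obtain \<rho> \<rho>' \<rho>'' where r: "realises n \<rho> h" "realises n \<rho>' h'" "realises n \<rho>'' h''"
    using realisable by metis
  show "eqv \<Gamma> n h h''"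
    using * eqv_iff[OF inv r(1,2)] eqv_iff[OF inv r(2,3)] eqv_iff[OF inv r(1,3)] agree_on_trans by metis
next
  fix n h h' m and \<sigma> :: "nat \<Rightarrow> nat"
  assume *: "eqv \<Gamma> n h h'" and \<sigma>: "inj_on \<sigma> {..<m}" "\<sigma> ` {..<m} \<subseteq> {..<n}"
  obtain \<rho> \<rho>' where r: "realises n \<rho> h" "realises n \<rho>' h'" using realisable by metis
  have "agree_on \<Gamma> m (\<lambda>i. \<rho> (\<sigma> i)) (\<lambda>i. \<rho>' (\<sigma> i))"
    unfolding agree_on_def
  proof (intro ballI allI impI)
    fix s js assume s: "s \<in> symbols \<Gamma>" "length js = arity \<Gamma> s" "set js \<subseteq> {..<m}"
    then have "set (map \<sigma> js) \<subseteq> {..<n}" using \<sigma>(2) by auto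
    moreover have "agree_on \<Gamma> n \<rho> \<rho>'" using * r by (simp add: eqv_def)
    ultimately have "map \<rho> (map \<sigma> js) \<in> interp \<Gamma> s \<longleftrightarrow> map \<rho>' (map \<sigma> js) \<in> interp \<Gamma> s"
      using s unfolding agree_on_def by (metis length_map)
    then show "map (\<lambda>i. \<rho> (\<sigma> i)) js \<in> interp \<Gamma> s \<longleftrightarrow> map (\<lambda>i. \<rho>' (\<sigma> i)) js \<in> interp \<Gamma> s"
      by (simp add: comp_def)
  qed
  then show "eqv \<Gamma> m (\<lambda>d. h (\<sigma> ` d)) (\<lambda>d. h' (\<sigma> ` d))"
    using eqv_iff[OF inv realises_reindex[OF r(1) \<sigma>] realises_reindex[OF r(2) \<sigma>]] by simp
next
  fix n :: nat and h h' :: "nat set \<Rightarrow> bool"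
  assume *: "\<And>i j. i < j \<Longrightarrow> j < n \<Longrightarrow> h {i, j} = h' {i, j}"
  show "eqv \<Gamma> n h h'"
    unfolding eqv_def
  proof (intro allI impI)
    fix \<rho> \<rho>' assume "realises n \<rho> h" "realises n \<rho>' h'"
    then have "same_type {..<n} \<rho> \<rho>'" using * by (rule realises_same_type)
    then show "agree_on \<Gamma> n \<rho> \<rho>'" by (rule agree_on_same_type[OF inv])
  qed
qed

section \<open>Existential definability and the three closure properties\<close>

lemma qf_sat_agree:
  assumes ag: "agree_on \<Gamma> m \<rho> \<rho>'" and inj: "inj_on \<rho> {..<m}" "inj_on \<rho>' {..<m}"
  shows "quantifier_free \<psi> \<Longrightarrow> wf_fm \<Gamma> \<psi> \<Longrightarrow> \<forall>x\<in>fv \<psi>. c x < m \<Longrightarrow>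
    sat \<Gamma> (\<lambda>x. \<rho> (c x)) \<psi> \<longleftrightarrow> sat \<Gamma> (\<lambda>x. \<rho>' (c x)) \<psi>"
proof (induction \<psi>)
  case (Eq i j)
  then show ?case
    using inj_on_eq_iff[OF inj(1), of "c i" "c j"] inj_on_eq_iff[OF inj(2), of "c i" "c j"] by simp
next
  case (Rel s js)
  then have "set (map c js) \<subseteq> {..<m}" "length (map c js) = arity \<Gamma> s" "s \<in> symbols \<Gamma>" by auto
  then have "map \<rho> (map c js) \<in> interp \<Gamma> s \<longleftrightarrow> map \<rho>' (map c js) \<in> interp \<Gamma> s"
    using ag unfolding agree_on_def by blast
  then show ?case by (simp add: comp_def)
qed auto

lemma extend_injection:
  fixes \<rho> :: "nat \<Rightarrow> 'v"
  assumes "finite W" and inj: "inj_on \<rho> {..<n}"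
  shows "\<exists>m \<rho>'. n \<le> m \<and> (\<forall>i<n. \<rho>' i = \<rho> i) \<and> inj_on \<rho>' {..<m} \<and> W \<subseteq> \<rho>' ` {..<m}"
  using assms(1)
proof (induction W rule: finite_induct)
  case empty
  then show ?case using inj by (intro exI[of _ n] exI[of _ \<rho>]) simp
next
  case (insert w W)
  then obtain m \<rho>' where *: "n \<le> m" "\<forall>i<n. \<rho>' i = \<rho> i" "inj_on \<rho>' {..<m}" "W \<subseteq> \<rho>' ` {..<m}"
    by blast
  show ?case
  proof (cases "w \<in> \<rho>' ` {..<m}")
    case True
    then show ?thesis using * by (intro exI[of _ m] exI[of _ \<rho>']) simp
  next
    case False
    have "inj_on (\<rho>'(m := w)) {..<Suc m}"
    proof (rule inj_onI)
      fix a b assume "a \<in> {..<Suc m}" "b \<in> {..<Suc m}" "(\<rho>'(m := w)) a = (\<rho>'(m := w)) b"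
      then show "a = b"
        using False inj_onD[OF *(3), of a b] by (auto simp: less_Suc_eq split: if_splits)
    qed
    moreover have "insert w W \<subseteq> (\<rho>'(m := w)) ` {..<Suc m}"
    proof -
      have "\<rho>' ` {..<m} = (\<rho>'(m := w)) ` {..<m}" by (intro image_cong) auto
      then show ?thesis using *(4) by (auto simp: lessThan_Suc)
    qed
    moreover have "n \<le> Suc m" "\<forall>i<n. (\<rho>'(m := w)) i = \<rho> i" using *(1,2) by simp_all
    ultimately show ?thesis
      by (intro exI[of _ "Suc m"] exI[of _ "\<rho>'(m := w)"] conjI)
  qed
qed

text \<open>
  The tuple and the witnesses of the existential formula span a finite graph. The hypothesis
  provides an equivalent graph that extends \<open>h'\<close>; realised on top of the second tuple, it supplies the
  witnesses there, since equivalence preserves the quantifier-free part.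
\<close>

lemma transfer_half:
  fixes P :: "nat \<Rightarrow> (nat set \<Rightarrow> bool) \<Rightarrow> (nat set \<Rightarrow> bool) \<Rightarrow> bool"
  assumes def: "ex_definable_in \<Delta> \<Gamma>"
    and ext: "\<And>m k. n \<le> m \<Longrightarrow> (\<And>i j. i < j \<Longrightarrow> j < n \<Longrightarrow> k {i, j} = h {i, j}) \<Longrightarrow>
         \<exists>k'. (\<forall>i j. i < j \<and> j < n \<longrightarrow> k' {i, j} = h' {i, j}) \<and> eqv \<Gamma> m k k'"
    and \<rho>: "realises n \<rho> h" and \<rho>': "realises n \<rho>' h'"
    and s: "s \<in> symbols \<Delta>" and js: "length js = arity \<Delta> s" "set js \<subseteq> {..<n}"
    and \<rho>R: "map \<rho> js \<in> interp \<Delta> s"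
  shows "map \<rho>' js \<in> interp \<Delta> s"
proof -
  obtain \<phi> where "existential \<phi>" and \<phi>def: "fm_defines \<Gamma> \<phi> (arity \<Delta> s) (interp \<Delta> s)"
    using def s by (auto simp: ex_definable_in_def)
  then obtain xs \<psi> where \<psi>: "quantifier_free \<psi>" "\<phi> = foldr Ex xs \<psi>"
    by (auto simp: existential_def)
  have wf: "wf_fm \<Gamma> \<psi>" and fv: "fv \<psi> - set xs \<subseteq> {..<length js}"
    and mem: "\<And>e. map e [0..<length js] \<in> interp \<Delta> s \<longleftrightarrow> sat \<Gamma> e \<phi>"
    using \<phi>def \<psi> js by (auto simp: fm_defines_def wf_foldr_Ex fv_foldr_Ex)
  have map_js: "map (\<lambda>x. f (js ! x)) [0..<length js] = map f js" for f :: "nat \<Rightarrow> 'v"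
    by (intro nth_equalityI) simp_all
  have "sat \<Gamma> (\<lambda>x. \<rho> (js ! x)) \<phi>" using \<rho>R mem[of "\<lambda>x. \<rho> (js ! x)"] map_js[of \<rho>] by simp
  then obtain e where e: "\<forall>x. x \<notin> set xs \<longrightarrow> e x = \<rho> (js ! x)" "sat \<Gamma> e \<psi>"
    unfolding \<psi>(2) sat_foldr_Ex by (elim exE conjE) (rule that)
  have "inj_on \<rho> {..<n}" using \<rho> by (simp add: realises_def)
  then obtain m \<rho>1 where m: "n \<le> m" "\<forall>i<n. \<rho>1 i = \<rho> i" "inj_on \<rho>1 {..<m}" "e ` fv \<psi> \<subseteq> \<rho>1 ` {..<m}"
    using extend_injection[of "e ` fv \<psi>" \<rho> n] finite_fv by blast
  have r1: "realises m \<rho>1 (graph_of \<rho>1)" using m(3) by (rule realises_graph_of)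
  have "graph_of \<rho>1 {i, j} = h {i, j}" if "i < j" "j < n" for i j
    using m(2) \<rho> that by (simp add: realises_def)
  then obtain k' where k': "\<forall>i j. i < j \<and> j < n \<longrightarrow> k' {i, j} = h' {i, j}" "eqv \<Gamma> m (graph_of \<rho>1) k'"
    using ext[OF m(1), of "graph_of \<rho>1"] by blast
  have "realises n \<rho>' k'" using \<rho>' k'(1) by (simp add: realises_def)
  then obtain \<rho>2 where \<rho>2: "\<forall>i<n. \<rho>2 i = \<rho>' i" "realises m \<rho>2 k'"
    using realises_extend[OF m(1)] by blast
  have ag: "agree_on \<Gamma> m \<rho>1 \<rho>2" using k'(2) r1 \<rho>2(2) by (simp add: eqv_def)
  define c where "c x = inv_into {..<m} \<rho>1 (e x)" for x
  have c: "c x < m" "\<rho>1 (c x) = e x" if "x \<in> fv \<psi>" for x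
  proof -
    have "e x \<in> \<rho>1 ` {..<m}" using m(4) that by blast
    then show "c x < m" "\<rho>1 (c x) = e x"
      using inv_into_into[of "e x" \<rho>1 "{..<m}"] f_inv_into_f[of "e x" \<rho>1 "{..<m}"]
      by (simp_all add: c_def)
  qed
  have "sat \<Gamma> (\<lambda>x. \<rho>1 (c x)) \<psi>" using e(2) sat_cong[of \<psi> e "\<lambda>x. \<rho>1 (c x)"] c(2) by simp
  then have sat2: "sat \<Gamma> (\<lambda>x. \<rho>2 (c x)) \<psi>"
    using qf_sat_agree[OF ag m(3) _ \<psi>(1) wf, of c] \<rho>2(2) c(1) by (simp add: realises_def)
  define e2 where "e2 x = (if x \<in> fv \<psi> then \<rho>2 (c x) else \<rho>' (js ! x))" for x
  have "e2 x = \<rho>' (js ! x)" if x: "x \<notin> set xs" for x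
  proof (cases "x \<in> fv \<psi>")
    case True
    then have "x < length js" using fv x by auto
    then have "js ! x \<in> set js" by (rule nth_mem)
    then have "js ! x < n" using js(2) by auto
    have "\<rho>1 (c x) = \<rho>1 (js ! x)" using \<open>js ! x < n\<close> c[OF True] e(1) x m(2) by simp
    then have "c x = js ! x" using inj_onD[OF m(3), of "c x" "js ! x"] c[OF True] \<open>js ! x < n\<close> m(1) by simp
    then show ?thesis using True \<rho>2(1) \<open>js ! x < n\<close> by (simp add: e2_def)
  qed (simp add: e2_def)
  moreover have "sat \<Gamma> e2 \<psi>" using sat2 sat_cong[of \<psi> e2 "\<lambda>x. \<rho>2 (c x)"] by (simp add: e2_def)
  ultimately have "sat \<Gamma> (\<lambda>x. \<rho>' (js ! x)) \<phi>" unfolding \<psi>(2) sat_foldr_Ex by blast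
  then show ?thesis using mem[of "\<lambda>x. \<rho>' (js ! x)"] map_js[of \<rho>'] by simp
qed

text \<open>
  A relation between graphs that is contained in the equivalence of \<open>\<Gamma>\<close> need not be contained in
  that of an existentially definable \<open>\<Delta>\<close>. It is if the relation can be carried along to extensions, as is
  the case for complements, for switchings and for the relation that always holds.
\<close>

lemma eqv_transfer:
  fixes P :: "nat \<Rightarrow> (nat set \<Rightarrow> bool) \<Rightarrow> (nat set \<Rightarrow> bool) \<Rightarrow> bool"
  assumes def: "ex_definable_in \<Delta> \<Gamma>"
    and sym: "\<And>n h h'. P n h h' \<Longrightarrow> P n h' h"
    and ext: "\<And>n h h' m k. P n h h' \<Longrightarrow> n \<le> m \<Longrightarrow> (\<And>i j. i < j \<Longrightarrow> j < n \<Longrightarrow> k {i, j} = h {i, j}) \<Longrightarrow>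
         \<exists>k'. (\<forall>i j. i < j \<and> j < n \<longrightarrow> k' {i, j} = h' {i, j}) \<and> P m k k'"
    and sub: "\<And>n h h'. P n h h' \<Longrightarrow> eqv \<Gamma> n h h'"
    and P: "P n h h'"
  shows "eqv \<Delta> n h h'"
proof -
  have half: "map \<rho>' js \<in> interp \<Delta> s"
    if "P n h h'" "realises n \<rho> h" "realises n \<rho>' h'" "s \<in> symbols \<Delta>" "length js = arity \<Delta> s"
      "set js \<subseteq> {..<n}" "map \<rho> js \<in> interp \<Delta> s" for h h' \<rho> \<rho>' s js
  proof (rule transfer_half[OF def _ that(2-7)])
    fix m k assume m: "n \<le> m" and k: "\<And>i j. i < j \<Longrightarrow> j < n \<Longrightarrow> k {i, j} = h {i, j}"
    have "\<exists>k'. (\<forall>i j. i < j \<and> j < n \<longrightarrow> k' {i, j} = h' {i, j}) \<and> P m k k'"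
      using that(1) m by (rule ext) (rule k)
    then obtain k' where "\<forall>i j. i < j \<and> j < n \<longrightarrow> k' {i, j} = h' {i, j}" "P m k k'"
      by (elim exE conjE)
    then show "\<exists>k'. (\<forall>i j. i < j \<and> j < n \<longrightarrow> k' {i, j} = h' {i, j}) \<and> eqv \<Gamma> m k k'"
      using sub by (intro exI[of _ k']) simp
  qed
  show ?thesis
    unfolding eqv_def agree_on_def
  proof (intro allI impI ballI iffI)
    fix \<rho> \<rho>' s js assume *: "realises n \<rho> h" "realises n \<rho>' h'" "s \<in> symbols \<Delta>"
      "length js = arity \<Delta> s" "set js \<subseteq> {..<n}"
    show "map \<rho>' js \<in> interp \<Delta> s" if "map \<rho> js \<in> interp \<Delta> s" using half[OF P *] that .
    show "map \<rho> js \<in> interp \<Delta> s" if "map \<rho>' js \<in> interp \<Delta> s"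
      using half[OF sym[OF P] *(2,1,3-)] that .
  qed
qed

text \<open>
  The complete invariant of a reduct up to existential interdefinability.
\<close>

definition profile :: "('s, 'v) rel_structure \<Rightarrow> bool \<times> bool \<times> bool" where
  "profile \<Gamma> =
     (graph_type_equivalence.trivial (eqv \<Gamma>),
      graph_type_equivalence.switch_closed (eqv \<Gamma>),
      graph_type_equivalence.complement_closed (eqv \<Gamma>))"

definition profile_le :: "bool \<times> bool \<times> bool \<Rightarrow> bool \<times> bool \<times> bool \<Rightarrow> bool" where
  "profile_le a b \<longleftrightarrow> (fst a \<longrightarrow> fst b) \<and> (fst (snd a) \<longrightarrow> fst (snd b)) \<and> (snd (snd a) \<longrightarrow> snd (snd b))"

lemma profile_le_antisym: "profile_le a b \<Longrightarrow> profile_le b a \<Longrightarrow> a = b"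
  by (auto simp: profile_le_def prod_eq_iff)

lemma profile_mono:
  assumes inv: "invariant \<Gamma>" "invariant \<Delta>" and def: "ex_definable_in \<Delta> \<Gamma>"
  shows "profile_le (profile \<Gamma>) (profile \<Delta>)"
proof -
  interpret G: graph_type_equivalence "eqv \<Gamma>" using inv(1) by (rule eqv_is_graph_type_equivalence)
  interpret D: graph_type_equivalence "eqv \<Delta>" using inv(2) by (rule eqv_is_graph_type_equivalence)
  have "D.trivial" if G: "G.trivial"
  proof -
    have "eqv \<Delta> n h h'" for n h h'
    proof (rule eqv_transfer[OF def, of "\<lambda>_ _ _. True"])
      fix n m :: nat and h' k :: "nat set \<Rightarrow> bool"
      show "\<exists>k'. (\<forall>i j. i < j \<and> j < n \<longrightarrow> k' {i, j} = h' {i, j}) \<and> True" by blast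
    qed (use G in \<open>simp_all add: G.trivial_def G.trivial_at_def\<close>)
    then show ?thesis by (simp add: D.trivial_def D.trivial_at_def)
  qed
  moreover have "D.complement_closed" if G: "G.complement_closed"
  proof -
    have "eqv \<Delta> n h (\<lambda>d. \<not> h d)" for n h
    proof (rule eqv_transfer[OF def, of "\<lambda>n h h'. \<forall>i j. i < j \<and> j < n \<longrightarrow> h' {i, j} = (\<not> h {i, j})"])
      fix n m :: nat and h h' k :: "nat set \<Rightarrow> bool" assume "\<forall>i j. i < j \<and> j < n \<longrightarrow> h' {i, j} = (\<not> h {i, j})"
        and "\<And>i j. i < j \<Longrightarrow> j < n \<Longrightarrow> k {i, j} = h {i, j}"
      then show "\<exists>k'. (\<forall>i j. i < j \<and> j < n \<longrightarrow> k' {i, j} = h' {i, j}) \<and>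
           (\<forall>i j. i < j \<and> j < m \<longrightarrow> k' {i, j} = (\<not> k {i, j}))"
        by (intro exI[of _ "\<lambda>d. \<not> k d"]) simp
    next
      fix n :: nat and h h' :: "nat set \<Rightarrow> bool" assume *: "\<forall>i j. i < j \<and> j < n \<longrightarrow> h' {i, j} = (\<not> h {i, j})"
      have "eqv \<Gamma> n h (\<lambda>d. \<not> h d)" using G by (simp add: G.complement_closed_def G.complement_at_def)
      then show "eqv \<Gamma> n h h'" by (rule G.eqv_agree_right) (use * in simp)
    qed simp_all
    then show ?thesis by (simp add: D.complement_closed_def D.complement_at_def)
  qed
  moreover have "D.switch_closed" if G: "G.switch_closed"
  proof -
    have "eqv \<Delta> n h (switch {v} h)" for n h v
    proof (rule eqv_transfer[OF def, of "\<lambda>n h h'. \<forall>i j. i < j \<and> j < n \<longrightarrow> h' {i, j} = switch {v} h {i, j}"])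
      fix n m :: nat and h h' k :: "nat set \<Rightarrow> bool" assume "\<forall>i j. i < j \<and> j < n \<longrightarrow> h' {i, j} = switch {v} h {i, j}"
        and "\<And>i j. i < j \<Longrightarrow> j < n \<Longrightarrow> k {i, j} = h {i, j}"
      then show "\<exists>k'. (\<forall>i j. i < j \<and> j < n \<longrightarrow> k' {i, j} = h' {i, j}) \<and>
           (\<forall>i j. i < j \<and> j < m \<longrightarrow> k' {i, j} = switch {v} k {i, j})"
        by (intro exI[of _ "switch {v} k"]) simp
    next
      fix n :: nat and h h' :: "nat set \<Rightarrow> bool" assume *: "\<forall>i j. i < j \<and> j < n \<longrightarrow> h' {i, j} = switch {v} h {i, j}"
      have "eqv \<Gamma> n h (switch {v} h)" using G by (simp add: G.switch_closed_def G.switch_at_def)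
      then show "eqv \<Gamma> n h h'" by (rule G.eqv_agree_right) (use * in simp)
    qed auto
    then show ?thesis by (simp add: D.switch_closed_def D.switch_at_def)
  qed
  ultimately show ?thesis by (simp add: profile_le_def profile_def)
qed

text \<open>
  What the existential definition needs from \<open>rigid_extension\<close>. If all graphs are equivalent for
  \<open>\<Gamma>\<close>, then they are so for \<open>\<Delta>\<close>, and \<open>h\<close> serves as its own extension.
\<close>

lemma rigid_witness:
  assumes inv: "invariant \<Gamma>" "invariant \<Delta>" and le: "profile_le (profile \<Gamma>) (profile \<Delta>)"
  shows "\<exists>M k. n \<le> M \<and> (\<forall>i j. i < j \<and> j < n \<longrightarrow> k {i, j} = h {i, j}) \<and>
           (\<forall>k'. eqv \<Gamma> M k k' \<longrightarrow> eqv \<Delta> n h k')"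
proof -
  interpret G: graph_type_equivalence "eqv \<Gamma>" using inv(1) by (rule eqv_is_graph_type_equivalence)
  interpret D: graph_type_equivalence "eqv \<Delta>" using inv(2) by (rule eqv_is_graph_type_equivalence)
  have le: "G.trivial \<longrightarrow> D.trivial" "G.switch_closed \<longrightarrow> D.switch_closed"
    "G.complement_closed \<longrightarrow> D.complement_closed"
    using le by (simp_all add: profile_le_def profile_def)
  show ?thesis
  proof (cases "G.trivial")
    case True
    then show ?thesis using le(1)
      by (intro exI[of _ n] exI[of _ h]) (simp add: D.trivial_def D.trivial_at_def)
  next
    case False
    obtain M k where M: "n \<le> M" "\<forall>i j. i < j \<and> j < n \<longrightarrow> k {i, j} = h {i, j}"
      and rigid: "\<forall>k'. eqv \<Gamma> M k k' \<longrightarrow> (\<exists>b J. (b \<longrightarrow> G.complement_closed) \<and> (J \<noteq> {} \<longrightarrow> G.switch_closed) \<and>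
       (\<forall>i j. i < j \<and> j < n \<longrightarrow> k' {i, j} = (h {i, j} \<noteq> (b \<noteq> ((i \<in> J) \<noteq> (j \<in> J))))))"
      using G.rigid_extension[OF False, of n h] by (elim exE conjE) (rule that)
    have "eqv \<Delta> n h k'" if k': "eqv \<Gamma> M k k'" for k'
    proof -
      obtain b J where bJ: "b \<longrightarrow> G.complement_closed" "J \<noteq> {} \<longrightarrow> G.switch_closed"
        "\<forall>i j. i < j \<and> j < n \<longrightarrow> k' {i, j} = (h {i, j} \<noteq> (b \<noteq> ((i \<in> J) \<noteq> (j \<in> J))))"
        using mp[OF spec[OF rigid] k'] by (elim exE conjE) (rule that)
      show ?thesis
        by (rule D.eqv_normalise[OF D.eqv_refl, where b = b and J = "J \<inter> {..<n}"])
          (use bJ le in auto)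
    qed
    then show ?thesis using M by (intro exI[of _ M] exI[of _ k]) simp
  qed
qed

text \<open>
  The signature may be infinite, so the type of \<open>k\<close> is not described by listing all relations. One
  literal is enough to tell \<open>k\<close> from a given inequivalent graph, and there are only finitely many graphs
  on \<open>{..<M}\<close>. The variables \<open>n, \<dots>, n + M - 1\<close> stand for the vertices; the smaller ones
  are kept for the coordinates of the relation to be defined.
\<close>

lemma ex_separating_literal:
  assumes inv: "invariant \<Gamma>" and ne: "\<not> eqv \<Gamma> M k k'"
  shows "\<exists>L. quantifier_free L \<and> wf_fm \<Gamma> L \<and> fv L \<subseteq> {..n + M} \<and>
     (\<forall>e h. realises M (\<lambda>i. e (n + i)) h \<longrightarrow>
        (eqv \<Gamma> M k h \<longrightarrow> sat \<Gamma> e L) \<and> (eqv \<Gamma> M k' h \<longrightarrow> \<not> sat \<Gamma> e L))"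
proof -
  obtain r r' where r: "realises M r k" "realises M r' k'" using realisable by metis
  have "\<not> agree_on \<Gamma> M r r'" using ne eqv_iff[OF inv r] by simp
  then obtain s js where s: "s \<in> symbols \<Gamma>" "length js = arity \<Gamma> s" "set js \<subseteq> {..<M}"
    and diff: "(map r js \<in> interp \<Gamma> s) \<noteq> (map r' js \<in> interp \<Gamma> s)"
    by (auto simp: agree_on_def)
  define A where "A = Rel s (map ((+) n) js)"
  have A: "sat \<Gamma> e A \<longleftrightarrow> map (\<lambda>i. e (n + i)) js \<in> interp \<Gamma> s" for e
    by (simp add: A_def comp_def)
  define L where "L = (if map r js \<in> interp \<Gamma> s then A else Neg A)"
  have "fv A \<subseteq> {..n + M}" using s(3) by (auto simp: A_def)
  then have "quantifier_free L" "wf_fm \<Gamma> L" "fv L \<subseteq> {..n + M}"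
    using s by (simp_all add: L_def A_def)
  moreover have "(eqv \<Gamma> M k h \<longrightarrow> sat \<Gamma> e L) \<and> (eqv \<Gamma> M k' h \<longrightarrow> \<not> sat \<Gamma> e L)"
    if \<rho>: "realises M (\<lambda>i. e (n + i)) h" for e h
  proof -
    have "map r js \<in> interp \<Gamma> s \<longleftrightarrow> map (\<lambda>i. e (n + i)) js \<in> interp \<Gamma> s" if "eqv \<Gamma> M k h"
    proof -
      have "agree_on \<Gamma> M r (\<lambda>i. e (n + i))" using that r(1) \<rho> by (simp add: eqv_def)
      then show ?thesis using s by (simp add: agree_on_def)
    qed
    moreover have "map r' js \<in> interp \<Gamma> s \<longleftrightarrow> map (\<lambda>i. e (n + i)) js \<in> interp \<Gamma> s" if "eqv \<Gamma> M k' h"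
    proof -
      have "agree_on \<Gamma> M r' (\<lambda>i. e (n + i))" using that r(2) \<rho> by (simp add: eqv_def)
      then show ?thesis using s by (simp add: agree_on_def)
    qed
    ultimately show ?thesis using A[of e] diff by (auto simp: L_def)
  qed
  ultimately show ?thesis by (intro exI[of _ L]) simp
qed

lemma ex_type_formula:
  assumes inv: "invariant \<Gamma>"
  shows "\<exists>\<psi>. quantifier_free \<psi> \<and> wf_fm \<Gamma> \<psi> \<and> fv \<psi> \<subseteq> {..n + M} \<and>
     (\<forall>e. sat \<Gamma> e \<psi> \<longleftrightarrow> inj_on (\<lambda>i. e (n + i)) {..<M} \<and> eqv \<Gamma> M k (graph_of (\<lambda>i. e (n + i))))"
proof -
  interpret G: graph_type_equivalence "eqv \<Gamma>" using inv by (rule eqv_is_graph_type_equivalence)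
  define B where "B = {D. D \<subseteq> Pow {..<M} \<and> \<not> eqv \<Gamma> M k (\<lambda>d. d \<in> D)}"
  have fB: "finite B" unfolding B_def by (rule finite_subset[of _ "Pow (Pow {..<M})"]) auto
  have ex: "\<forall>D\<in>B. \<exists>L. quantifier_free L \<and> wf_fm \<Gamma> L \<and> fv L \<subseteq> {..n + M} \<and>
     (\<forall>e h. realises M (\<lambda>i. e (n + i)) h \<longrightarrow>
        (eqv \<Gamma> M k h \<longrightarrow> sat \<Gamma> e L) \<and> (eqv \<Gamma> M (\<lambda>d. d \<in> D) h \<longrightarrow> \<not> sat \<Gamma> e L))"
    using ex_separating_literal[OF inv] by (simp add: B_def)
  obtain L where "\<forall>D\<in>B. quantifier_free (L D) \<and> wf_fm \<Gamma> (L D) \<and> fv (L D) \<subseteq> {..n + M} \<and>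
     (\<forall>e h. realises M (\<lambda>i. e (n + i)) h \<longrightarrow>
        (eqv \<Gamma> M k h \<longrightarrow> sat \<Gamma> e (L D)) \<and> (eqv \<Gamma> M (\<lambda>d. d \<in> D) h \<longrightarrow> \<not> sat \<Gamma> e (L D)))"
    using bchoice[OF ex] by (elim exE) (rule that)
  note L = bspec[OF this]
  define I where "I = (\<lambda>(i, j). Neg (Eq (n + i) (n + j)) :: 'a fm) ` {(i, j). i < j \<and> j < M}"
  have "{(i, j). i < j \<and> j < M} \<subseteq> {..<M} \<times> {..<M}" by auto
  then have fI: "finite I" unfolding I_def using finite_subset by blast
  have "\<forall>\<phi>\<in>I \<union> L ` B. quantifier_free \<phi> \<and> wf_fm \<Gamma> \<phi> \<and> fv \<phi> \<subseteq> {..n + M}"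
    using L by (auto simp: I_def)
  then obtain \<psi> where \<psi>: "quantifier_free \<psi>" "wf_fm \<Gamma> \<psi>" "fv \<psi> \<subseteq> {..n + M}"
    and sat: "\<forall>e. sat \<Gamma> e \<psi> \<longleftrightarrow> (\<forall>\<phi>\<in>I \<union> L ` B. sat \<Gamma> e \<phi>)"
    using ex_finite_conjunction[of "I \<union> L ` B" \<Gamma> "{..n + M}" 0] fI fB by auto
  have "sat \<Gamma> e \<psi> \<longleftrightarrow> inj_on \<rho> {..<M} \<and> eqv \<Gamma> M k (graph_of \<rho>)" if \<rho>: "\<rho> = (\<lambda>i. e (n + i))" for e \<rho>
  proof -
    have I: "(\<forall>\<phi>\<in>I. sat \<Gamma> e \<phi>) \<longleftrightarrow> inj_on \<rho> {..<M}"
    proof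
      assume "\<forall>\<phi>\<in>I. sat \<Gamma> e \<phi>"
      then have ne: "\<rho> i \<noteq> \<rho> j" if "i < j" "j < M" for i j using that by (auto simp: I_def \<rho>)
      show "inj_on \<rho> {..<M}"
        by (rule inj_onI) (metis ne lessThan_iff linorder_neqE_nat)
    next
      assume "inj_on \<rho> {..<M}"
      then show "\<forall>\<phi>\<in>I. sat \<Gamma> e \<phi>" by (auto simp: I_def \<rho> inj_on_def)
    qed
    have "(\<forall>D\<in>B. sat \<Gamma> e (L D)) \<longleftrightarrow> eqv \<Gamma> M k (graph_of \<rho>)" if "inj_on \<rho> {..<M}"
    proof
      have r: "realises M (\<lambda>i. e (n + i)) (graph_of \<rho>)"
        using realises_graph_of[OF that] by (simp add: \<rho>)
      show "\<forall>D\<in>B. sat \<Gamma> e (L D)" if "eqv \<Gamma> M k (graph_of \<rho>)" using L r that by blast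
      assume sat: "\<forall>D\<in>B. sat \<Gamma> e (L D)"
      define D where "D = {d \<in> Pow {..<M}. graph_of \<rho> d}"
      have D: "eqv \<Gamma> M (\<lambda>d. d \<in> D) (graph_of \<rho>)"
        by (rule G.eqv_agree) (simp add: D_def)
      show "eqv \<Gamma> M k (graph_of \<rho>)"
      proof (rule ccontr)
        assume "\<not> eqv \<Gamma> M k (graph_of \<rho>)"
        then have "D \<in> B" using G.eqv_trans[OF _ D] by (auto simp: B_def D_def)
        then show False using L r D sat by blast
      qed
    qed
    then show ?thesis using I sat by auto
  qed
  then show ?thesis using \<psi> by (intro exI[of _ \<psi>]) simp
qed

text \<open>
  Tuples may have repeated entries. Enumerating exactly \<open>n\<close> distinct vertices that include all entries
  bounds the number of patterns \<open>\<tau>\<close> that have to be considered.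
\<close>

lemma ex_enumeration:
  fixes e :: "nat \<Rightarrow> 'v"
  shows "\<exists>\<rho> \<tau>. inj_on \<rho> {..<n} \<and> length \<tau> = n \<and> set \<tau> \<subseteq> {..<n} \<and> (\<forall>i<n. e i = \<rho> (\<tau> ! i))"
proof -
  let ?F = "e ` {..<n}"
  have c: "card ?F \<le> n" using card_image_le[of "{..<n}" e] by simp
  have "infinite (UNIV - ?F)" using infinite_vertices by (simp add: Diff_infinite_finite)
  then have "\<exists>B. finite B \<and> card B = n - card ?F \<and> B \<subseteq> UNIV - ?F"
    by (rule infinite_arbitrarily_large)
  then obtain B where B: "finite B" "card B = n - card ?F" "B \<subseteq> UNIV - ?F" by blast
  have "card (?F \<union> B) = n" using B c by (subst card_Un_disjoint) auto
  then obtain \<rho> where \<rho>: "bij_betw \<rho> {..<n} (?F \<union> B)"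
    using ex_bij_betw_nat_finite[of "?F \<union> B"] B(1) by (auto simp: atLeast0LessThan)
  define \<tau> where "\<tau> = map (\<lambda>i. inv_into {..<n} \<rho> (e i)) [0..<n]"
  have im: "e i \<in> \<rho> ` {..<n}" if "i < n" for i using \<rho> that by (auto simp: bij_betw_def)
  have "set \<tau> \<subseteq> {..<n}" using inv_into_into[OF im] by (auto simp: \<tau>_def)
  moreover have "\<forall>i<n. e i = \<rho> (\<tau> ! i)" using f_inv_into_f[OF im] by (simp add: \<tau>_def)
  moreover have "length \<tau> = n" by (simp add: \<tau>_def)
  moreover have "inj_on \<rho> {..<n}" using \<rho> by (simp add: bij_betw_def)
  ultimately show ?thesis by blast
qed

text \<open>
  A pattern \<open>(\<tau>, D)\<close> says that the tuple consists of the entries \<open>\<tau>\<close> of an enumeration of \<open>n\<close>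
  vertices that induce the graph \<open>D\<close>. Whether the tuple then lies in the relation depends
  only on the pattern. The defining formula is the disjunction, over the finitely many patterns inside
  the relation, of the statement that the tuple arises through \<open>\<tau>\<close> from the first \<open>n\<close> of \<open>M D\<close>
  distinct vertices whose type in \<open>\<Gamma>\<close> is that of the rigid extension \<open>k D\<close>. All disjuncts share the
  bound variables \<open>n, \<dots>, N - 1\<close>, which puts the disjunction into existential form.
\<close>

theorem profile_le_imp_ex_definable:
  assumes inv: "invariant \<Gamma>" "invariant \<Delta>" and le: "profile_le (profile \<Gamma>) (profile \<Delta>)"
  shows "ex_definable_in \<Delta> \<Gamma>"
  unfolding ex_definable_in_def
proof
  interpret D: graph_type_equivalence "eqv \<Delta>" using inv(2) by (rule eqv_is_graph_type_equivalence)
  fix s assume s: "s \<in> symbols \<Delta>"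
  define n where "n = arity \<Delta> s"
  define Gs where "Gs = Pow (Pow {..<n})"
  have "\<forall>D. \<exists>Mk. n \<le> fst Mk \<and> (\<forall>i j. i < j \<and> j < n \<longrightarrow> snd Mk {i, j} = ({i, j} \<in> D)) \<and>
           (\<forall>k'. eqv \<Gamma> (fst Mk) (snd Mk) k' \<longrightarrow> eqv \<Delta> n (\<lambda>d. d \<in> D) k')"
  proof
    fix D :: "nat set set"
    show "\<exists>Mk. n \<le> fst Mk \<and> (\<forall>i j. i < j \<and> j < n \<longrightarrow> snd Mk {i, j} = ({i, j} \<in> D)) \<and>
           (\<forall>k'. eqv \<Gamma> (fst Mk) (snd Mk) k' \<longrightarrow> eqv \<Delta> n (\<lambda>d. d \<in> D) k')"
      using rigid_witness[OF inv le, of n "\<lambda>d. d \<in> D"] by simp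
  qed
  from choice[OF this] obtain Mk where Mk:
    "\<forall>D. n \<le> fst (Mk D) \<and> (\<forall>i j. i < j \<and> j < n \<longrightarrow> snd (Mk D) {i, j} = ({i, j} \<in> D)) \<and>
           (\<forall>k'. eqv \<Gamma> (fst (Mk D)) (snd (Mk D)) k' \<longrightarrow> eqv \<Delta> n (\<lambda>d. d \<in> D) k')"
    by (elim exE)
  define M where "M D = fst (Mk D)" for D
  define k where "k D = snd (Mk D)" for D
  have M: "n \<le> M D" and k: "\<And>i j. i < j \<Longrightarrow> j < n \<Longrightarrow> k D {i, j} = ({i, j} \<in> D)"
    and rigid: "\<And>k'. eqv \<Gamma> (M D) (k D) k' \<Longrightarrow> eqv \<Delta> n (\<lambda>d. d \<in> D) k'" for D
    using spec[OF Mk, of D] by (simp_all add: M_def k_def)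
  define N where "N = Suc (n + Max (M ` Gs))"
  have fG: "finite Gs" by (simp add: Gs_def)
  have MN: "n + M D < N" if "D \<in> Gs" for D
    using that fG by (simp add: N_def less_Suc_eq_le)
  have "\<forall>D. \<exists>\<psi>. quantifier_free \<psi> \<and> wf_fm \<Gamma> \<psi> \<and> fv \<psi> \<subseteq> {..n + M D} \<and>
     (\<forall>e. sat \<Gamma> e \<psi> \<longleftrightarrow> inj_on (\<lambda>i. e (n + i)) {..<M D} \<and>
        eqv \<Gamma> (M D) (k D) (graph_of (\<lambda>i. e (n + i))))"
    using ex_type_formula[OF inv(1)] by simp
  from choice[OF this] obtain \<psi> where \<psi>: "\<forall>D. quantifier_free (\<psi> D) \<and> wf_fm \<Gamma> (\<psi> D) \<and>
     fv (\<psi> D) \<subseteq> {..n + M D} \<and>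
     (\<forall>e. sat \<Gamma> e (\<psi> D) \<longleftrightarrow> inj_on (\<lambda>i. e (n + i)) {..<M D} \<and>
        eqv \<Gamma> (M D) (k D) (graph_of (\<lambda>i. e (n + i))))"
    by (elim exE)
  define pats where "pats = {(\<tau>, D). set \<tau> \<subseteq> {..<n} \<and> length \<tau> = n \<and> D \<in> Gs \<and>
     (\<exists>\<rho>. realises n \<rho> (\<lambda>d. d \<in> D) \<and> map \<rho> \<tau> \<in> interp \<Delta> s)}"
  have "pats \<subseteq> {\<tau>. set \<tau> \<subseteq> {..<n} \<and> length \<tau> = n} \<times> Gs" by (auto simp: pats_def)
  then have fp: "finite pats"
    using finite_lists_length_eq[of "{..<n}" n] fG by (meson finite_SigmaI finite_lessThan finite_subset)
  have "\<forall>p. \<exists>\<theta>. p \<in> pats \<longrightarrow> quantifier_free \<theta> \<and> wf_fm \<Gamma> \<theta> \<and> fv \<theta> \<subseteq> {..<N} \<and>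
     (\<forall>e. sat \<Gamma> e \<theta> \<longleftrightarrow> sat \<Gamma> e (\<psi> (snd p)) \<and> (\<forall>i<n. e i = e (n + fst p ! i)))"
  proof (intro allI)
    fix p show "\<exists>\<theta>. p \<in> pats \<longrightarrow> quantifier_free \<theta> \<and> wf_fm \<Gamma> \<theta> \<and> fv \<theta> \<subseteq> {..<N} \<and>
     (\<forall>e. sat \<Gamma> e \<theta> \<longleftrightarrow> sat \<Gamma> e (\<psi> (snd p)) \<and> (\<forall>i<n. e i = e (n + fst p ! i)))"
    proof (cases "p \<in> pats")
      case True
      define \<tau> where "\<tau> = fst p"
      define D where "D = snd p"
      have p: "set \<tau> \<subseteq> {..<n}" "length \<tau> = n" "D \<in> Gs" using True by (auto simp: pats_def \<tau>_def D_def)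
      have \<tau>: "\<tau> ! i < n" if "i < n" for i
      proof -
        have "\<tau> ! i \<in> set \<tau>" using p(2) that by (intro nth_mem) simp
        then show ?thesis using p(1) by auto
      qed
      let ?A = "insert (\<psi> D) ((\<lambda>i. Eq i (n + \<tau> ! i)) ` {..<n})"
      have A: "\<forall>\<phi>\<in>?A. quantifier_free \<phi> \<and> wf_fm \<Gamma> \<phi> \<and> fv \<phi> \<subseteq> {..<N}"
      proof -
        have "fv (\<psi> D) \<subseteq> {..<N}" using spec[OF \<psi>, of D] MN[OF p(3)] by auto
        moreover have "i < N \<and> n + \<tau> ! i < N" if "i < n" for i
          using \<tau>[OF that] that M[of D] MN[OF p(3)] by linarith
        ultimately show ?thesis using spec[OF \<psi>, of D] by auto
      qed
      have fA: "finite ?A" and N0: "0 \<in> {..<N}" by (simp_all add: N_def)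
      obtain \<theta> where \<theta>: "quantifier_free \<theta>" "wf_fm \<Gamma> \<theta>" "fv \<theta> \<subseteq> {..<N}"
        and "\<forall>e. sat \<Gamma> e \<theta> \<longleftrightarrow> (\<forall>\<phi>\<in>?A. sat \<Gamma> e \<phi>)"
        using ex_finite_conjunction[OF fA A N0] by (elim exE conjE) (rule that)
      then have "\<forall>e. sat \<Gamma> e \<theta> \<longleftrightarrow> sat \<Gamma> e (\<psi> D) \<and> (\<forall>i<n. e i = e (n + \<tau> ! i))" by auto
      then show ?thesis using \<theta> by (intro exI[of _ \<theta>]) (simp add: \<tau>_def D_def)
    qed simp
  qed
  from choice[OF this] obtain \<theta> where \<theta>0: "\<forall>p. p \<in> pats \<longrightarrow> quantifier_free (\<theta> p) \<and> wf_fm \<Gamma> (\<theta> p) \<and>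
     fv (\<theta> p) \<subseteq> {..<N} \<and>
     (\<forall>e. sat \<Gamma> e (\<theta> p) \<longleftrightarrow> sat \<Gamma> e (\<psi> (snd p)) \<and> (\<forall>i<n. e i = e (n + fst p ! i)))"
    by (elim exE)
  have \<theta>: "sat \<Gamma> e (\<theta> (\<tau>, D)) \<longleftrightarrow> inj_on (\<lambda>i. e (n + i)) {..<M D} \<and>
        eqv \<Gamma> (M D) (k D) (graph_of (\<lambda>i. e (n + i))) \<and> (\<forall>i<n. e i = e (n + \<tau> ! i))"
    if "(\<tau>, D) \<in> pats" for \<tau> D e
    using mp[OF spec[OF \<theta>0] that] spec[OF \<psi>, of D] by simp
  have \<theta>N: "\<forall>\<phi>\<in>\<theta> ` pats. quantifier_free \<phi> \<and> wf_fm \<Gamma> \<phi> \<and> fv \<phi> \<subseteq> {..<N}"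
  proof (rule ballI, elim imageE, simp only:)
    fix p assume "p \<in> pats"
    then show "quantifier_free (\<theta> p) \<and> wf_fm \<Gamma> (\<theta> p) \<and> fv (\<theta> p) \<subseteq> {..<N}"
      using mp[OF spec[OF \<theta>0, of p]] by simp
  qed
  have f\<theta>: "finite (\<theta> ` pats)" and N0: "0 \<in> {..<N}" using fp by (simp_all add: N_def)
  obtain \<beta> where \<beta>: "quantifier_free \<beta>" "wf_fm \<Gamma> \<beta>" "fv \<beta> \<subseteq> {..<N}"
    and sat\<beta>: "\<forall>e. sat \<Gamma> e \<beta> \<longleftrightarrow> (\<exists>\<phi>\<in>\<theta> ` pats. sat \<Gamma> e \<phi>)"
    using ex_finite_disjunction[OF f\<theta> \<theta>N N0] by (elim exE conjE) (rule that)
  define \<Phi> where "\<Phi> = foldr Ex [n..<N] \<beta>"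
  have "map e [0..<n] \<in> interp \<Delta> s \<longleftrightarrow> sat \<Gamma> e \<Phi>" for e
  proof
    assume e: "map e [0..<n] \<in> interp \<Delta> s"
    obtain \<rho> \<tau> where \<rho>: "inj_on \<rho> {..<n}" and \<tau>: "length \<tau> = n" "set \<tau> \<subseteq> {..<n}"
      and e\<rho>: "\<forall>i<n. e i = \<rho> (\<tau> ! i)"
      using ex_enumeration[of n e] by (elim exE conjE) (rule that)
    define D where "D = {d \<in> Pow {..<n}. graph_of \<rho> d}"
    have D: "D \<in> Gs" by (auto simp: D_def Gs_def)
    have r: "realises n \<rho> (\<lambda>d. d \<in> D)"
      using realises_graph_of[OF \<rho>] by (rule realises_agree) (simp add: D_def)
    have "map \<rho> \<tau> = map e [0..<n]" using \<tau>(1) e\<rho> by (intro nth_equalityI) simp_all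
    then have pat: "(\<tau>, D) \<in> pats" using \<tau> D r e by (auto simp: pats_def)
    have "realises n \<rho> (k D)" using r by (rule realises_agree) (simp add: k)
    then obtain \<rho>1 where \<rho>1: "\<forall>i<n. \<rho>1 i = \<rho> i" "realises (M D) \<rho>1 (k D)"
      using realises_extend[OF M] by blast
    define e1 where "e1 x = (if n \<le> x \<and> x < n + M D then \<rho>1 (x - n) else e x)" for x
    have \<tau>n: "\<tau> ! i < n" if "i < n" for i
    proof -
      have "\<tau> ! i \<in> set \<tau>" using \<tau>(1) that by (intro nth_mem) simp
      then show ?thesis using \<tau>(2) by auto
    qed
    have r1: "realises (M D) (\<lambda>i. e1 (n + i)) (k D)"
      using \<rho>1(2) by (auto simp: realises_def e1_def inj_on_def)
    then have "inj_on (\<lambda>i. e1 (n + i)) {..<M D}" by (simp add: realises_def)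
    moreover have "eqv \<Gamma> (M D) (k D) (graph_of (\<lambda>i. e1 (n + i)))"
    proof -
      interpret G: graph_type_equivalence "eqv \<Gamma>" using inv(1) by (rule eqv_is_graph_type_equivalence)
      show ?thesis by (rule G.eqv_agree) (use r1 in \<open>simp add: realises_def\<close>)
    qed
    moreover have "e1 i = e1 (n + \<tau> ! i)" if "i < n" for i
      using that e\<rho> \<rho>1(1) \<tau>n[OF that] M[of D] by (simp add: e1_def)
    ultimately have "sat \<Gamma> e1 (\<theta> (\<tau>, D))" using \<theta>[OF pat] by simp
    then have "sat \<Gamma> e1 \<beta>" using sat\<beta> pat by blast
    moreover have "\<forall>x. x \<notin> set [n..<N] \<longrightarrow> e1 x = e x" using MN[OF D] by (auto simp: e1_def)
    ultimately show "sat \<Gamma> e \<Phi>" unfolding \<Phi>_def sat_foldr_Ex by (intro exI[of _ e1] conjI)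
  next
    assume "sat \<Gamma> e \<Phi>"
    then obtain e1 where e1: "\<forall>x. x \<notin> set [n..<N] \<longrightarrow> e1 x = e x" "sat \<Gamma> e1 \<beta>"
      unfolding \<Phi>_def sat_foldr_Ex by (elim exE conjE) (rule that)
    then obtain \<tau> D where pat: "(\<tau>, D) \<in> pats" and "sat \<Gamma> e1 (\<theta> (\<tau>, D))" using sat\<beta> by auto
    then have e1M: "inj_on (\<lambda>i. e1 (n + i)) {..<M D}" "eqv \<Gamma> (M D) (k D) (graph_of (\<lambda>i. e1 (n + i)))"
      and e1\<tau>: "\<forall>i<n. e1 i = e1 (n + \<tau> ! i)" using \<theta>[OF pat] by simp_all
    let ?\<rho> = "\<lambda>i. e1 (n + i)"
    obtain \<rho>0 where \<rho>0: "realises n \<rho>0 (\<lambda>d. d \<in> D)" "map \<rho>0 \<tau> \<in> interp \<Delta> s"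
      and \<tau>: "set \<tau> \<subseteq> {..<n}" "length \<tau> = n"
      using pat by (auto simp: pats_def)
    have "realises n ?\<rho> (graph_of ?\<rho>)"
      using e1M(1) M[of D] by (intro realises_graph_of) (auto simp: inj_on_def)
    then have "agree_on \<Delta> n \<rho>0 ?\<rho>" using rigid[OF e1M(2)] \<rho>0(1) by (simp add: eqv_def)
    then have "map ?\<rho> \<tau> \<in> interp \<Delta> s" using \<rho>0(2) \<tau> s by (simp add: agree_on_def n_def)
    moreover have "map ?\<rho> \<tau> = map e [0..<n]"
    proof (rule nth_equalityI)
      fix i assume "i < length (map ?\<rho> \<tau>)"
      then have i: "i < n" using \<tau>(2) by simp
      then have "e1 (n + \<tau> ! i) = e1 i" using e1\<tau> by simp
      also have "e1 i = e i" using e1(1) i by simp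
      finally show "map ?\<rho> \<tau> ! i = map e [0..<n] ! i" using i \<tau>(2) by simp
    qed (use \<tau>(2) in simp)
    ultimately show "map e [0..<n] \<in> interp \<Delta> s" by simp
  qed
  moreover have "wf_fm \<Gamma> \<Phi>" "fv \<Phi> \<subseteq> {..<n}" "existential \<Phi>"
    using \<beta> by (auto simp: \<Phi>_def wf_foldr_Ex fv_foldr_Ex existential_def)
  ultimately show "\<exists>\<phi>. existential \<phi> \<and> fm_defines \<Gamma> \<phi> (arity \<Delta> s) (interp \<Delta> s)"
    by (intro exI[of _ \<Phi>]) (simp add: fm_defines_def n_def)
qed

theorem ex_interdefinable_iff_profile:
  assumes "invariant \<Gamma>" "invariant \<Delta>"
  shows "ex_interdefinable \<Gamma> \<Delta> \<longleftrightarrow> profile \<Gamma> = profile \<Delta>"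
proof
  assume "ex_interdefinable \<Gamma> \<Delta>"
  then show "profile \<Gamma> = profile \<Delta>"
    using assms by (intro profile_le_antisym) (auto simp: ex_interdefinable_def intro: profile_mono)
next
  assume "profile \<Gamma> = profile \<Delta>"
  then have "profile_le (profile \<Gamma>) (profile \<Delta>)" "profile_le (profile \<Delta>) (profile \<Gamma>)"
    by (simp_all add: profile_le_def)
  then show "ex_interdefinable \<Gamma> \<Delta>"
    using assms by (simp add: ex_interdefinable_def profile_le_imp_ex_definable)
qed

end

section \<open>Five reducts and the classification\<close>

text \<open>
  Structures with one relation are given a symbol for every element of the type of symbols, all of
  them with the same interpretation, because nothing is known about this type but that it is
  nonempty.
\<close>

definition single :: "nat \<Rightarrow> 'v list set \<Rightarrow> ('s, 'v) rel_structure" where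
  "single n R = \<lparr>symbols = UNIV, arity = (\<lambda>_. n), interp = (\<lambda>_. R)\<rparr>"

text \<open>
  The triples with an odd number of edges are the two-graph of \<open>h\<close>. Switching preserves it, since it
  changes zero or two pairs of each triple, and complementing reverses it.
\<close>

definition odd_on :: "(nat set \<Rightarrow> bool) \<Rightarrow> nat \<Rightarrow> nat \<Rightarrow> nat \<Rightarrow> bool" where
  "odd_on h x y z \<longleftrightarrow> (h {x, y} \<noteq> h {y, z}) \<noteq> h {x, z}"

lemma upt_numerals:
  "[0..<2] = [0, 1 :: nat]" "[0..<3] = [0, 1, 2 :: nat]" "[0..<4] = [0, 1, 2, 3 :: nat]"
  "[0..<6] = [0, 1, 2, 3, 4, 5 :: nat]"
  by (simp_all add: upt_rec)

context graph_type_equivalence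
begin

lemma trivial_imp_closed: "trivial \<Longrightarrow> switch_closed \<and> complement_closed"
  by (simp add: trivial_def trivial_at_def switch_closed_def switch_at_def
      complement_closed_def complement_at_def)

end

context random_graph
begin

definition edge_rel :: "'v list set" where
  "edge_rel = {[x, y] | x y. (x, y) \<in> E}"

text \<open>
  The requirement that \<open>x \<noteq> y\<close> and \<open>u \<noteq> v\<close> keeps the relation invariant under complements: a loop is
  never an edge, before or after.
\<close>

definition same_edge_rel :: "'v list set" where
  "same_edge_rel = {[x, y, u, v] | x y u v. x \<noteq> y \<and> u \<noteq> v \<and> ((x, y) \<in> E \<longleftrightarrow> (u, v) \<in> E)}"

definition odd_triple :: "'v \<Rightarrow> 'v \<Rightarrow> 'v \<Rightarrow> bool" where
  "odd_triple x y z \<longleftrightarrow> (((x, y) \<in> E) \<noteq> ((y, z) \<in> E)) \<noteq> ((x, z) \<in> E)"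

definition odd_triple_rel :: "'v list set" where
  "odd_triple_rel = {[x, y, z] | x y z. distinct [x, y, z] \<and> odd_triple x y z}"

definition same_parity_rel :: "'v list set" where
  "same_parity_rel = {[x, y, z, u, v, w] | x y z u v w.
     distinct [x, y, z] \<and> distinct [u, v, w] \<and> (odd_triple x y z \<longleftrightarrow> odd_triple u v w)}"

lemma graph_structure_eq_single: "graph_structure E = single 2 edge_rel"
  by (simp add: graph_structure_def single_def edge_rel_def)

lemma single_simps [simp]:
  "symbols (single n R) = UNIV" "arity (single n R) s = n" "interp (single n R) s = R"
  by (simp_all add: single_def)

lemma invariant_single:
  assumes "\<And>xs. xs \<in> R \<Longrightarrow> length xs = n"
    and "\<And>e e'. same_type {..<n} e e' \<Longrightarrow> map e [0..<n] \<in> R \<Longrightarrow> map e' [0..<n] \<in> R"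
  shows "invariant (single n R)"
  using assms by (simp add: invariant_def is_rel_structure_def)

lemma eqv_single_iff:
  assumes inv: "invariant (single n R :: ('s, 'v) rel_structure)"
    and Q: "\<And>\<rho> h js. realises m \<rho> h \<Longrightarrow> length js = n \<Longrightarrow> set js \<subseteq> {..<m} \<Longrightarrow> map \<rho> js \<in> R \<longleftrightarrow> Q h js"
  shows "eqv (single n R :: ('s, 'v) rel_structure) m h h' \<longleftrightarrow>
           (\<forall>js. length js = n \<longrightarrow> set js \<subseteq> {..<m} \<longrightarrow> Q h js = Q h' js)"
proof -
  obtain \<rho> \<rho>' where r: "realises m \<rho> h" "realises m \<rho>' h'" using realisable by metis
  show ?thesis
    unfolding eqv_iff[OF inv r] agree_on_def using Q[OF r(1)] Q[OF r(2)] by simp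
qed

lemma edge_rel_iff:
  assumes "realises m \<rho> h" "length js = 2" "set js \<subseteq> {..<m}"
  shows "map \<rho> js \<in> edge_rel \<longleftrightarrow> js ! 0 \<noteq> js ! 1 \<and> h {js ! 0, js ! 1}"
proof -
  obtain a b where js: "js = [a, b]" using assms(2) by (auto simp: length_Suc_conv numeral_2_eq_2)
  show ?thesis
    using assms(1,3) E_irrefl realises_edge[of m \<rho> h a b]
    by (cases "a = b") (simp_all add: js edge_rel_def)
qed

lemma same_edge_rel_iff:
  assumes "realises m \<rho> h" "length js = 4" "set js \<subseteq> {..<m}"
  shows "map \<rho> js \<in> same_edge_rel \<longleftrightarrow> js ! 0 \<noteq> js ! 1 \<and> js ! 2 \<noteq> js ! 3 \<and>
           (h {js ! 0, js ! 1} \<longleftrightarrow> h {js ! 2, js ! 3})"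
proof -
  obtain a b c d where js: "js = [a, b, c, d]"
    using assms(2) by (auto simp: length_Suc_conv eval_nat_numeral)
  show ?thesis
    using assms(3) realises_edge[OF assms(1)] realises_inj[OF assms(1)]
    by (auto simp: js same_edge_rel_def eval_nat_numeral)
qed

lemma odd_triple_iff:
  assumes "realises m \<rho> h" "a < m" "b < m" "c < m" "distinct [a, b, c]"
  shows "odd_triple (\<rho> a) (\<rho> b) (\<rho> c) \<longleftrightarrow> odd_on h a b c"
  using assms(2-5) realises_edge[OF assms(1)] by (simp add: odd_triple_def odd_on_def)

lemma odd_triple_rel_iff:
  assumes "realises m \<rho> h" "length js = 3" "set js \<subseteq> {..<m}"
  shows "map \<rho> js \<in> odd_triple_rel \<longleftrightarrow> distinct js \<and> odd_on h (js ! 0) (js ! 1) (js ! 2)"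
proof -
  obtain a b c where js: "js = [a, b, c]"
    using assms(2) by (auto simp: length_Suc_conv eval_nat_numeral)
  have "map \<rho> js \<in> odd_triple_rel \<longleftrightarrow> distinct [a, b, c] \<and> odd_triple (\<rho> a) (\<rho> b) (\<rho> c)"
    using assms(3) realises_inj[OF assms(1)] by (auto simp: js odd_triple_rel_def)
  then show ?thesis
    using assms(3) odd_triple_iff[OF assms(1), of a b c] by (auto simp: js eval_nat_numeral)
qed

lemma same_parity_rel_iff:
  assumes "realises m \<rho> h" "length js = 6" "set js \<subseteq> {..<m}"
  shows "map \<rho> js \<in> same_parity_rel \<longleftrightarrow>
     distinct [js ! 0, js ! 1, js ! 2] \<and> distinct [js ! 3, js ! 4, js ! 5] \<and>
     (odd_on h (js ! 0) (js ! 1) (js ! 2) \<longleftrightarrow> odd_on h (js ! 3) (js ! 4) (js ! 5))"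
proof -
  obtain a b c u v w where js: "js = [a, b, c, u, v, w]"
    using assms(2) by (auto simp: length_Suc_conv eval_nat_numeral)
  have "map \<rho> js \<in> same_parity_rel \<longleftrightarrow> distinct [a, b, c] \<and> distinct [u, v, w] \<and>
      (odd_triple (\<rho> a) (\<rho> b) (\<rho> c) \<longleftrightarrow> odd_triple (\<rho> u) (\<rho> v) (\<rho> w))"
    using assms(3) realises_inj[OF assms(1)] by (simp add: js same_parity_rel_def)
  moreover have "js ! 0 = a" "js ! 1 = b" "js ! 2 = c" "js ! 3 = u" "js ! 4 = v" "js ! 5 = w"
    by (simp_all add: js)
  ultimately show ?thesis
    using assms(3) odd_triple_iff[OF assms(1), of a b c] odd_triple_iff[OF assms(1), of u v w]
    by (auto simp: js)
qed

lemma invariant_edge: "invariant (single 2 edge_rel)"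
  by (rule invariant_single) (auto simp: edge_rel_def same_type_def upt_numerals)

lemma invariant_same_edge: "invariant (single 4 same_edge_rel)"
  by (rule invariant_single) (auto simp: same_edge_rel_def same_type_def upt_numerals)

lemma same_type_odd_triple:
  assumes "same_type S e e'" "a \<in> S" "b \<in> S" "c \<in> S"
  shows "odd_triple (e a) (e b) (e c) = odd_triple (e' a) (e' b) (e' c)"
  using assms by (simp add: odd_triple_def same_type_def)

lemma same_type_distinct:
  assumes "same_type S e e'" "a \<in> S" "b \<in> S" "c \<in> S"
  shows "distinct [e a, e b, e c] = distinct [e' a, e' b, e' c]"
  using assms by (simp add: same_type_def)

lemma invariant_odd_triple: "invariant (single 3 odd_triple_rel)"
proof (rule invariant_single)
  fix e e' :: "nat \<Rightarrow> 'v" assume st: "same_type {..<3} e e'" and "map e [0..<3] \<in> odd_triple_rel"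
  then show "map e' [0..<3] \<in> odd_triple_rel"
    using same_type_odd_triple[OF st, of 0 1 2] same_type_distinct[OF st, of 0 1 2]
    by (simp add: odd_triple_rel_def upt_numerals)
qed (auto simp: odd_triple_rel_def)

lemma invariant_same_parity: "invariant (single 6 same_parity_rel)"
proof (rule invariant_single)
  fix e e' :: "nat \<Rightarrow> 'v" assume st: "same_type {..<6} e e'" and "map e [0..<6] \<in> same_parity_rel"
  then show "map e' [0..<6] \<in> same_parity_rel"
    using same_type_odd_triple[OF st, of 0 1 2] same_type_distinct[OF st, of 0 1 2]
      same_type_odd_triple[OF st, of 3 4 5] same_type_distinct[OF st, of 3 4 5]
    by (simp add: same_parity_rel_def upt_numerals)
qed (auto simp: same_parity_rel_def)

lemma eqv_edge:
  "eqv (single 2 edge_rel :: ('s, 'v) rel_structure) m h h' \<longleftrightarrow>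
     (\<forall>js. length js = 2 \<longrightarrow> set js \<subseteq> {..<m} \<longrightarrow>
        (js ! 0 \<noteq> js ! 1 \<and> h {js ! 0, js ! 1}) = (js ! 0 \<noteq> js ! 1 \<and> h' {js ! 0, js ! 1}))"
  using invariant_edge edge_rel_iff by (rule eqv_single_iff)

lemma eqv_same_edge:
  "eqv (single 4 same_edge_rel :: ('s, 'v) rel_structure) m h h' \<longleftrightarrow>
     (\<forall>js. length js = 4 \<longrightarrow> set js \<subseteq> {..<m} \<longrightarrow>
        (js ! 0 \<noteq> js ! 1 \<and> js ! 2 \<noteq> js ! 3 \<and> (h {js ! 0, js ! 1} \<longleftrightarrow> h {js ! 2, js ! 3})) =
        (js ! 0 \<noteq> js ! 1 \<and> js ! 2 \<noteq> js ! 3 \<and> (h' {js ! 0, js ! 1} \<longleftrightarrow> h' {js ! 2, js ! 3})))"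
  using invariant_same_edge same_edge_rel_iff by (rule eqv_single_iff)

lemma eqv_odd_triple:
  "eqv (single 3 odd_triple_rel :: ('s, 'v) rel_structure) m h h' \<longleftrightarrow>
     (\<forall>js. length js = 3 \<longrightarrow> set js \<subseteq> {..<m} \<longrightarrow>
        (distinct js \<and> odd_on h (js ! 0) (js ! 1) (js ! 2)) =
        (distinct js \<and> odd_on h' (js ! 0) (js ! 1) (js ! 2)))"
  using invariant_odd_triple odd_triple_rel_iff by (rule eqv_single_iff)

lemma eqv_same_parity:
  "eqv (single 6 same_parity_rel :: ('s, 'v) rel_structure) m h h' \<longleftrightarrow>
     (\<forall>js. length js = 6 \<longrightarrow> set js \<subseteq> {..<m} \<longrightarrow>
        (distinct [js ! 0, js ! 1, js ! 2] \<and> distinct [js ! 3, js ! 4, js ! 5] \<and>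
          (odd_on h (js ! 0) (js ! 1) (js ! 2) \<longleftrightarrow> odd_on h (js ! 3) (js ! 4) (js ! 5))) =
        (distinct [js ! 0, js ! 1, js ! 2] \<and> distinct [js ! 3, js ! 4, js ! 5] \<and>
          (odd_on h' (js ! 0) (js ! 1) (js ! 2) \<longleftrightarrow> odd_on h' (js ! 3) (js ! 4) (js ! 5))))"
  using invariant_same_parity same_parity_rel_iff by (rule eqv_single_iff)

lemma odd_on_complement: "odd_on (\<lambda>d. \<not> h d) x y z \<longleftrightarrow> \<not> odd_on h x y z"
  by (auto simp: odd_on_def)

lemma odd_on_switch: "odd_on (switch J h) x y z \<longleftrightarrow> odd_on h x y z"
  by (auto simp: odd_on_def)

lemma profile_edge: "profile (single 2 edge_rel :: ('s, 'v) rel_structure) = (False, False, False)"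
proof -
  let ?\<Gamma> = "single 2 edge_rel :: ('s, 'v) rel_structure"
  interpret G: graph_type_equivalence "eqv ?\<Gamma>"
    using invariant_edge by (rule eqv_is_graph_type_equivalence)
  have ne: "\<not> eqv ?\<Gamma> 2 h h'" if "h {0, 1} \<noteq> h' {0, 1}" for h h'
    unfolding eqv_edge by (intro notI, drule spec[where x = "[0, 1]"]) (use that in simp)
  have "\<not> G.trivial" unfolding G.trivial_def G.trivial_at_def using ne[of "\<lambda>_. True" "\<lambda>_. False"] by auto
  moreover have "\<not> G.switch_at 2"
    unfolding G.switch_at_def using ne[of "\<lambda>_. True" "switch {0} (\<lambda>_. True)"] by auto
  moreover have "\<not> G.complement_at 2"
    unfolding G.complement_at_def using ne[of h "\<lambda>d. \<not> h d" for h] by simp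
  ultimately show ?thesis by (auto simp: profile_def G.switch_closed_def G.complement_closed_def)
qed

lemma profile_same_edge:
  "profile (single 4 same_edge_rel :: ('s, 'v) rel_structure) = (False, False, True)"
proof -
  let ?\<Gamma> = "single 4 same_edge_rel :: ('s, 'v) rel_structure"
  interpret G: graph_type_equivalence "eqv ?\<Gamma>"
    using invariant_same_edge by (rule eqv_is_graph_type_equivalence)
  have "\<not> eqv ?\<Gamma> 3 (\<lambda>_. True) (switch {0} (\<lambda>_. True))"
    unfolding eqv_same_edge
    by (intro notI, drule spec[where x = "[0, 1, 1, 2]"]) simp
  then have sc: "\<not> G.switch_closed" by (auto simp: G.switch_closed_def G.switch_at_def)
  have nt: "\<not> G.trivial" using sc G.trivial_imp_closed by blast
  have "eqv ?\<Gamma> n h (\<lambda>d. \<not> h d)" for n h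
    unfolding eqv_same_edge by simp
  then have cc: "G.complement_closed" by (simp add: G.complement_closed_def G.complement_at_def)
  show ?thesis using nt sc cc by (simp add: profile_def)
qed

lemma profile_odd_triple:
  "profile (single 3 odd_triple_rel :: ('s, 'v) rel_structure) = (False, True, False)"
proof -
  let ?\<Gamma> = "single 3 odd_triple_rel :: ('s, 'v) rel_structure"
  interpret G: graph_type_equivalence "eqv ?\<Gamma>"
    using invariant_odd_triple by (rule eqv_is_graph_type_equivalence)
  have "\<not> eqv ?\<Gamma> 3 h (\<lambda>d. \<not> h d)" for h
    unfolding eqv_odd_triple odd_on_complement
    by (intro notI, drule spec[where x = "[0, 1, 2]"]) simp
  then have cc: "\<not> G.complement_closed" by (auto simp: G.complement_closed_def G.complement_at_def)
  have nt: "\<not> G.trivial" using cc G.trivial_imp_closed by blast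
  have "eqv ?\<Gamma> n h (switch {v} h)" for n h v
    unfolding eqv_odd_triple odd_on_switch by simp
  then have sc: "G.switch_closed" by (simp add: G.switch_closed_def G.switch_at_def)
  show ?thesis using nt sc cc by (simp add: profile_def)
qed

lemma profile_same_parity:
  "profile (single 6 same_parity_rel :: ('s, 'v) rel_structure) = (False, True, True)"
proof -
  let ?\<Gamma> = "single 6 same_parity_rel :: ('s, 'v) rel_structure"
  interpret G: graph_type_equivalence "eqv ?\<Gamma>"
    using invariant_same_parity by (rule eqv_is_graph_type_equivalence)
  \<comment> \<open>A single edge makes exactly the two triples containing it odd.\<close>
  have "\<not> eqv ?\<Gamma> 4 (\<lambda>_. False) (\<lambda>d. d = {0, 1})"
    unfolding eqv_same_parity
    by (intro notI, drule spec[where x = "[0, 1, 2, 1, 2, 3]"])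
      (simp add: odd_on_def doubleton_eq_iff)
  then have nt: "\<not> G.trivial" by (auto simp: G.trivial_def G.trivial_at_def)
  have "eqv ?\<Gamma> n h (\<lambda>d. \<not> h d)" for n h
    unfolding eqv_same_parity odd_on_complement by simp
  then have cc: "G.complement_closed" by (simp add: G.complement_closed_def G.complement_at_def)
  have "eqv ?\<Gamma> n h (switch {v} h)" for n h v
    unfolding eqv_same_parity odd_on_switch by simp
  then have sc: "G.switch_closed" by (simp add: G.switch_closed_def G.switch_at_def)
  show ?thesis using nt sc cc by (simp add: profile_def)
qed

definition no_relations :: "('s, 'v) rel_structure" where
  "no_relations = \<lparr>symbols = {}, arity = (\<lambda>_. 0), interp = (\<lambda>_. {})\<rparr>"

lemma invariant_no_relations: "invariant no_relations"
  by (simp add: invariant_def is_rel_structure_def no_relations_def)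

lemma profile_no_relations: "profile (no_relations :: ('s, 'v) rel_structure) = (True, True, True)"
proof -
  let ?\<Gamma> = "no_relations :: ('s, 'v) rel_structure"
  interpret G: graph_type_equivalence "eqv ?\<Gamma>"
    using invariant_no_relations by (rule eqv_is_graph_type_equivalence)
  have "agree_on ?\<Gamma> n \<rho> \<rho>'" for n \<rho> \<rho>' by (simp add: agree_on_def no_relations_def)
  then have "G.trivial" by (simp add: G.trivial_def G.trivial_at_def eqv_def)
  then show ?thesis using G.trivial_imp_closed by (simp add: profile_def)
qed

text \<open>
  The graph itself has the smallest profile, so every invariant structure is even existentially
  definable in it.
\<close>

lemma reduct_iff_invariant: "reduct_of \<Gamma> (graph_structure E) \<longleftrightarrow> invariant \<Gamma>"
proof
  assume inv: "invariant \<Gamma>"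
  have "ex_definable_in \<Gamma> (graph_structure E)"
    unfolding graph_structure_eq_single
    using invariant_edge inv
    by (rule profile_le_imp_ex_definable) (simp add: profile_edge profile_le_def)
  then show "reduct_of \<Gamma> (graph_structure E)"
    using inv by (auto simp: reduct_of_def ex_definable_in_def invariant_def)
qed (rule reduct_invariant)

lemma profiles_of_reducts:
  "profile ` (reducts E :: ('s, 'v) rel_structure set) =
     {(True, True, True), (False, False, False), (False, False, True),
      (False, True, False), (False, True, True)}" (is "_ = ?P")
proof
  show "profile ` (reducts E :: ('s, 'v) rel_structure set) \<subseteq> ?P"
  proof
    fix p assume "p \<in> profile ` (reducts E :: ('s, 'v) rel_structure set)"
    then obtain \<Gamma> :: "('s, 'v) rel_structure" where \<Gamma>: "invariant \<Gamma>" "p = profile \<Gamma>"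
      by (auto simp: reducts_def reduct_iff_invariant)
    interpret G: graph_type_equivalence "eqv \<Gamma>" using \<Gamma>(1) by (rule eqv_is_graph_type_equivalence)
    show "p \<in> ?P" using G.trivial_imp_closed unfolding \<Gamma>(2) profile_def
      by (cases "G.trivial"; cases "G.switch_closed"; cases "G.complement_closed") simp_all
  qed
  have "profile \<Gamma> \<in> profile ` (reducts E :: ('s, 'v) rel_structure set)"
    if "invariant \<Gamma>" for \<Gamma> :: "('s, 'v) rel_structure"
    using that by (simp add: reducts_def reduct_iff_invariant)
  note this[OF invariant_edge] this[OF invariant_same_edge] this[OF invariant_odd_triple]
    this[OF invariant_same_parity] this[OF invariant_no_relations]
  then show "?P \<subseteq> profile ` (reducts E :: ('s, 'v) rel_structure set)"
    by (simp add: profile_edge profile_same_edge profile_odd_triple profile_same_parity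
        profile_no_relations)
qed

end

lemma card_quotient_kernel:
  "card (A // {(x, y). x \<in> A \<and> y \<in> A \<and> f x = f y}) = card (f ` A)"
proof -
  let ?r = "{(x, y). x \<in> A \<and> y \<in> A \<and> f x = f y}"
  let ?g = "\<lambda>y. {x \<in> A. y = f x}"
  have "A // ?r = ?g ` (f ` A)" by (auto simp: quotient_def image_iff)
  moreover have "inj_on ?g (f ` A)" by (rule inj_onI) auto
  ultimately show ?thesis by (simp add: card_image)
qed

theorem corollary15:
  fixes E :: "('v \<times> 'v) set"
  assumes "random_graph E"
  shows "equiv (reducts E :: ('s, 'v) rel_structure set) (ex_interdef_rel E) \<and>
         card ((reducts E :: ('s, 'v) rel_structure set) // ex_interdef_rel E) = 5"
proof -
  interpret random_graph E by (rule assms)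
  let ?R = "reducts E :: ('s, 'v) rel_structure set"
  have rel: "ex_interdef_rel E = {(\<Gamma>, \<Delta>). \<Gamma> \<in> ?R \<and> \<Delta> \<in> ?R \<and> profile \<Gamma> = profile \<Delta>}"
    using ex_interdefinable_iff_profile
    by (auto simp: ex_interdef_rel_def reducts_def reduct_iff_invariant)
  have "equiv ?R (ex_interdef_rel E)"
    unfolding rel by (rule equivI) (auto simp: refl_on_def sym_def trans_def)
  moreover have "card (?R // ex_interdef_rel E) = 5"
    unfolding rel card_quotient_kernel profiles_of_reducts by simp
  ultimately show ?thesis by blast
qed

end
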